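(* Let $C\in\mathbb{R}$ and let $u(t,x)$ be a real strong solution of $$u_t+uu_x=\int_{-\infty}^{x}\tfrac12u_x^2(t,z)\,dz+C\int_{-\infty}^{\infty}u_x^2(t,z)\,dz,\qquad u(0,x)=u_0(x),\quad x\in\mathbb{R}.$$ Suppose there exists a set $\Omega=(a,b)\times[t_1,t_2]$ with $-\infty\le a<b\le\infty$ and $0\le t_1<t_2$ (within the existence interval of $u$) such that $$u(t,x)=0\quad\text{for all }(x,t)\in\Omega,$$ and that one of the following cases holds: 1) $C>0$; 2) $C=0$ and $b=\infty$; 3) $-\frac12<C<0$ and ($b=\infty$ or $a=-\infty$); 4) $C=-\frac12$ and $a=-\infty$; 5) $C<-\frac12$. Then $u\equiv0$ for all $(x,t)\in\mathbb{R}\times\mathbb{R}^+$.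
   Context: A strong solution is a solution with $u\in C([0,T];E^s_{p,r})\cap C^1([0,T];\bar E^s_{p,r})$ for every $T$ less than its maximal existence time, for some admissible $(s,p,r)$, i.e. $s\ge2$, $1\le p,r\le\infty$, with $r=p$ if $s=2$, $1\le p\le2$, and $r=2$ if $s=2$, $2\le p\le\infty$. Here, with $\frac1p+\frac1q=1$, $$E^s_{p,r}=L^\infty\cap\dot B^{s}_{p,r}\cap\dot B^{s-1}_{p,r}\cap\dot W^{1,q},\qquad \bar E^s_{p,r}=L^\infty\cap\dot B^{s-1}_{p,r}$$ are spaces of functions on $\mathbb{R}$ normed by the sum of the (semi)norms, where $\|u\|_{\dot W^{1,q}}=\|u_x\|_{L^q}$ and $\|u\|_{\dot B^\sigma_{p,r}}=\big\|(2^{j\sigma}\|\dot\Delta_ju\|_{L^p})_{j\in\mathbb{Z}}\big\|_{\ell^r}$ with $\dot\Delta_ju=\mathcal{F}^{-1}(\varphi(2^{-j}\cdot)\mathcal{F}u)$ the standard homogeneous dyadic blocks ($\varphi\in C_c^\infty$ even, supported in $\{\frac34\le|\xi|\le\frac83\}$, $\sum_{j\in\mathbb{Z}}\varphi(2^{-j}\xi)=1$ for $\xi\neq0$). *)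

theory Defs
  imports "HOL-Probability.Essential_Supremum"
begin

section \<open>Lebesgue and sequence norms with exponents in \<open>[1,\<infinity>]\<close>\<close>

definition epowr :: "ennreal \<Rightarrow> real \<Rightarrow> ennreal" where
  "epowr a x = (if a = \<infinity> then \<infinity> else ennreal (enn2real a powr x))"

text \<open>The norms are extended-valued.  With \<open>M = lborel\<close> this is the norm of \<open>L\<^sup>p\<close> on the real line,
  with \<open>M = count_space UNIV\<close> the norm of \<open>\<ell>\<^sup>p\<close>.\<close>

definition Lp_norm :: "'a measure \<Rightarrow> ennreal \<Rightarrow> ('a \<Rightarrow> ennreal) \<Rightarrow> ennreal" where
  "Lp_norm M p f =
     (if p = \<infinity> then esssup M f
      else epowr (\<integral>\<^sup>+ x. epowr (f x) (enn2real p) \<partial>M) (1 / enn2real p))"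

definition L_norm :: "ennreal \<Rightarrow> (real \<Rightarrow> real) \<Rightarrow> ennreal" where
  "L_norm p f = Lp_norm lborel p (\<lambda>x. ennreal \<bar>f x\<bar>)"


section \<open>Homogeneous Besov seminorms\<close>

definition smooth :: "(real \<Rightarrow> real) \<Rightarrow> bool" where
  "smooth f \<longleftrightarrow> (\<forall>n x. (deriv ^^ n) f field_differentiable at x)"

definition dyadic_partition :: "(real \<Rightarrow> real) \<Rightarrow> bool" where
  "dyadic_partition \<phi> \<longleftrightarrow>
     smooth \<phi> \<and> (\<forall>\<xi>. \<phi> (- \<xi>) = \<phi> \<xi>) \<and>
     (\<forall>\<xi>. \<phi> \<xi> \<noteq> 0 \<longrightarrow> 3/4 \<le> \<bar>\<xi>\<bar> \<and> \<bar>\<xi>\<bar> \<le> 8/3) \<and>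
     (\<forall>\<xi>. \<xi> \<noteq> 0 \<longrightarrow> ((\<lambda>j::int. \<phi> (2 powr (- real_of_int j) * \<xi>)) has_sum 1) UNIV)"

definition inverse_fourier :: "(real \<Rightarrow> real) \<Rightarrow> real \<Rightarrow> complex" where
  "inverse_fourier g x =
     1 / (2 * complex_of_real pi) * (\<integral>\<xi>. cis (x * \<xi>) * complex_of_real (g \<xi>) \<partial>lborel)"

text \<open>The block \<open>F\<^sup>-\<^sup>1(\<phi>(2\<^sup>-\<^sup>j\<cdot>) F f)\<close> of a bounded function \<open>f\<close>.  Here \<open>F f\<close> is a tempered
  distribution; evaluating the inverse transform of the compactly supported distribution
  \<open>\<phi>(2\<^sup>-\<^sup>j\<cdot>) F f\<close> at \<open>x\<close> means pairing \<open>f\<close> with the Fourier transform of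
  \<open>\<xi> \<mapsto> \<phi>(2\<^sup>-\<^sup>j\<xi>) e\<^sup>i\<^sup>x\<^sup>\<xi> / 2\<pi>\<close>, that is, convolving \<open>f\<close> with \<open>F\<^sup>-\<^sup>1(\<phi>(2\<^sup>-\<^sup>j\<cdot>))\<close>.  This kernel is
  real-valued because \<open>\<phi>\<close> is even.  Only bounded \<open>f\<close> matter below, since every space considered
  is contained in \<open>L\<^sup>\<infinity>\<close>.\<close>

definition dyadic_block :: "(real \<Rightarrow> real) \<Rightarrow> int \<Rightarrow> (real \<Rightarrow> real) \<Rightarrow> real \<Rightarrow> real" where
  "dyadic_block \<phi> j f x =
     (\<integral>y. Re (inverse_fourier (\<lambda>\<xi>. \<phi> (2 powr (- real_of_int j) * \<xi>)) (x - y)) * f y \<partial>lborel)"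

definition besov_norm ::
  "(real \<Rightarrow> real) \<Rightarrow> real \<Rightarrow> ennreal \<Rightarrow> ennreal \<Rightarrow> (real \<Rightarrow> real) \<Rightarrow> ennreal" where
  "besov_norm \<phi> \<sigma> p r f =
     Lp_norm (count_space UNIV) r
       (\<lambda>j::int. ennreal (2 powr (real_of_int j * \<sigma>)) * L_norm p (dyadic_block \<phi> j f))"


section \<open>Weak derivatives\<close>

definition test_function :: "(real \<Rightarrow> real) \<Rightarrow> bool" where
  "test_function \<psi> \<longleftrightarrow> smooth \<psi> \<and> (\<exists>R. \<forall>x. \<psi> x \<noteq> 0 \<longrightarrow> \<bar>x\<bar> \<le> R)"

definition locally_integrable :: "(real \<Rightarrow> real) \<Rightarrow> bool" where
  "locally_integrable f \<longleftrightarrow> f \<in> borel_measurable borel \<and> (\<forall>R. set_integrable lborel {-R..R} f)"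

definition weak_derivative :: "(real \<Rightarrow> real) \<Rightarrow> (real \<Rightarrow> real) \<Rightarrow> bool" where
  "weak_derivative f g \<longleftrightarrow>
     locally_integrable f \<and> locally_integrable g \<and>
     (\<forall>\<psi>. test_function \<psi> \<longrightarrow> (\<integral>x. f x * deriv \<psi> x \<partial>lborel) = - (\<integral>x. g x * \<psi> x \<partial>lborel))"

text \<open>The weak derivative is unique up to null sets, so the infimum is the \<open>L\<^sup>q\<close> norm of any weak
  derivative, and it is \<open>\<infinity>\<close> if there is none.\<close>

definition W1_norm :: "ennreal \<Rightarrow> (real \<Rightarrow> real) \<Rightarrow> ennreal" where
  "W1_norm q f = (INF g \<in> {g. weak_derivative f g}. L_norm q g)"


section \<open>The solution spaces\<close>

definition admissible :: "real \<Rightarrow> ennreal \<Rightarrow> ennreal \<Rightarrow> bool" where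
  "admissible s p r \<longleftrightarrow>
     2 \<le> s \<and> 1 \<le> p \<and> 1 \<le> r \<and>
     (s = 2 \<and> p \<le> 2 \<longrightarrow> r = p) \<and> (s = 2 \<and> 2 \<le> p \<longrightarrow> r = 2)"

definition E_norm ::
  "(real \<Rightarrow> real) \<Rightarrow> real \<Rightarrow> ennreal \<Rightarrow> ennreal \<Rightarrow> ennreal \<Rightarrow> (real \<Rightarrow> real) \<Rightarrow> ennreal" where
  "E_norm \<phi> s p q r f =
     L_norm \<infinity> f + besov_norm \<phi> s p r f + besov_norm \<phi> (s - 1) p r f + W1_norm q f"

definition Ebar_norm ::
  "(real \<Rightarrow> real) \<Rightarrow> real \<Rightarrow> ennreal \<Rightarrow> ennreal \<Rightarrow> (real \<Rightarrow> real) \<Rightarrow> ennreal" where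
  "Ebar_norm \<phi> s p r f = L_norm \<infinity> f + besov_norm \<phi> (s - 1) p r f"

text \<open>\<open>C([0,T];X)\<close> and \<open>C\<^sup>1([0,T];X)\<close> for the space \<open>X\<close> of all measurable functions \<open>f\<close> on the line
  with \<open>N f < \<infinity>\<close>; the derivative \<open>f'\<close> is one-sided at the end points.\<close>

definition C0_in :: "((real \<Rightarrow> real) \<Rightarrow> ennreal) \<Rightarrow> real \<Rightarrow> (real \<Rightarrow> real \<Rightarrow> real) \<Rightarrow> bool" where
  "C0_in N T f \<longleftrightarrow>
     (\<forall>t\<in>{0..T}. f t \<in> borel_measurable borel \<and> N (f t) < \<infinity> \<and>
        ((\<lambda>\<tau>. N (\<lambda>x. f \<tau> x - f t x)) \<longlongrightarrow> 0) (at t within {0..T}))"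

definition C1_in ::
  "((real \<Rightarrow> real) \<Rightarrow> ennreal) \<Rightarrow> real \<Rightarrow> (real \<Rightarrow> real \<Rightarrow> real) \<Rightarrow> (real \<Rightarrow> real \<Rightarrow> real) \<Rightarrow> bool" where
  "C1_in N T f f' \<longleftrightarrow>
     C0_in N T f \<and> C0_in N T f' \<and>
     (\<forall>t\<in>{0..T}. ((\<lambda>\<tau>. N (\<lambda>x. (f \<tau> x - f t x) / (\<tau> - t) - f' t x)) \<longlongrightarrow> 0) (at t within {0..T}))"


section \<open>Strong solutions\<close>

text \<open>\<open>u t x\<close> is a solution on \<open>[0,Tm)\<close>.  Elements of \<open>E\<^sup>s\<^sub>p\<^sub>,\<^sub>r\<close> are classes of functions modulo null
  sets; each class has a continuous representative (there is a locally integrable weak derivative),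
  and \<open>u t\<close> is taken to be that one, so that its pointwise values are meaningful.  The equation is
  an identity in \<open>L\<^sup>\<infinity>\<close> at each time, hence stated almost everywhere in \<open>x\<close>.  Integrability of
  \<open>u\<^sub>x\<^sup>2\<close> is part of what the equation means, but has to be required because the Bochner integral of a
  non-integrable function is \<open>0\<close> by convention.\<close>

definition strong_solution ::
  "(real \<Rightarrow> real) \<Rightarrow> real \<Rightarrow> real \<Rightarrow> ennreal \<Rightarrow> ennreal \<Rightarrow> ennreal \<Rightarrow> ereal \<Rightarrow>
   (real \<Rightarrow> real) \<Rightarrow> (real \<Rightarrow> real \<Rightarrow> real) \<Rightarrow> bool" where
  "strong_solution \<phi> C s p q r Tm u0 u \<longleftrightarrow>
     0 < Tm \<and> (\<forall>x. u 0 x = u0 x) \<and>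
     (\<exists>ut ux. \<forall>T>0. ereal T < Tm \<longrightarrow>
        C0_in (E_norm \<phi> s p q r) T u \<and>
        C1_in (Ebar_norm \<phi> s p r) T u ut \<and>
        (\<forall>t\<in>{0..T}.
           continuous_on UNIV (u t) \<and>
           weak_derivative (u t) (ux t) \<and>
           integrable lborel (\<lambda>z. (ux t z)\<^sup>2) \<and>
           (AE x in lborel.
              ut t x + u t x * ux t x =
                (LINT z:{..x}|lborel. 1/2 * (ux t z)\<^sup>2) + C * (LINT z|lborel. (ux t z)\<^sup>2))))"

text \<open>\<open>Tm\<close> is the maximal existence time: \<open>u\<close> has no continuation to a longer time interval.\<close>

definition maximal_strong_solution ::
  "(real \<Rightarrow> real) \<Rightarrow> real \<Rightarrow> real \<Rightarrow> ennreal \<Rightarrow> ennreal \<Rightarrow> ennreal \<Rightarrow> ereal \<Rightarrow>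
   (real \<Rightarrow> real) \<Rightarrow> (real \<Rightarrow> real \<Rightarrow> real) \<Rightarrow> bool" where
  "maximal_strong_solution \<phi> C s p q r Tm u0 u \<longleftrightarrow>
     strong_solution \<phi> C s p q r Tm u0 u \<and>
     \<not> (\<exists>T' v. Tm < T' \<and> strong_solution \<phi> C s p q r T' u0 v \<and>
              (\<forall>t x. 0 \<le> t \<and> ereal t < Tm \<longrightarrow> v t x = u t x))"

end

theory Submission
  imports Defs "HOL-Probability.Characteristic_Functions" "HOL-Probability.Sinc_Integral"
begin

text \<open>On \<open>\<Omega>\<close> the left-hand side of the equation vanishes, hence so does the right-hand side
  \<open>1/2 \<integral>\<^bsub>-\<infinity>\<^esub>\<^sup>x u\<^sub>x\<^sup>2 + C \<integral> u\<^sub>x\<^sup>2\<close> for \<open>x\<close> in \<open>(a,b)\<close>.  It lies between \<open>C m\<close> and \<open>(C + 1/2) m\<close>, where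
  \<open>m = \<integral> u\<^sub>x\<^sup>2\<close>, and tends to these values as \<open>x \<rightarrow> \<mp>\<infinity>\<close>; in each of the five cases this forces
  \<open>m = 0\<close>, so that \<open>u = 0\<close> at time \<open>t\<^sub>1\<close>.  That \<open>u\<close> then vanishes at all times is a uniqueness statement:
  functions in \<open>E\<^sup>s\<^sub>p\<^sub>,\<^sub>r\<close> are Lipschitz, locally uniformly in time, and along characteristics \<open>u\<close> changes at
  the rate of the right-hand side, which is nondecreasing in \<open>x\<close>.  So \<open>u\<close> becomes nondecreasing in \<open>x\<close>,
  whence \<open>1/2 \<integral>\<^sub>x\<^sup>y u\<^sub>x\<^sup>2 \<le> L/2 (u(y) - u(x))\<close>, and Gronwall's inequality gives that \<open>u\<close> is constant
  in \<open>x\<close>.  Finally, the zero solution exists for all times, so that the maximal time is infinite.\<close>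

section \<open>Smooth functions and weak derivatives\<close>

text \<open>No flow of characteristics is constructed. The equation holds only almost everywhere in
  x and \<open>ux\<close> has no pointwise meaning, so a curve could run inside an exceptional null
  set. Instead u(t+h) at the point x + h u(t,x) is compared with u(t,x) for a single small h;
  averaging over the segment between the two points removes the null sets, and the error is at most
  \<epsilon> h uniformly in x. This uniformity permits a Gronwall argument for the whole family of
  pairs x \<le> y at once, without forming a supremum that would have to be differentiated in time.
  Monotonicity and constancy are instances of one such argument for \<alpha> u(x) + \<beta> u(y).
  The Lipschitz bound has to be extracted from Besov norms built on an arbitrary dyadic partition.
  The frequency analysis is carried out with integrable kernels in physical space: a block is the
  difference of two low-pass convolutions and is reproduced by a low-pass convolution at twice its
  scale. The partition function also supplies the test functions, through a normalised primitive of
  its square.\<close>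

lemma smooth_coinduct:
  assumes "f \<in> S" and "\<And>g. g \<in> S \<Longrightarrow> (\<forall>x. g field_differentiable at x) \<and> deriv g \<in> S"
  shows "smooth f"
proof -
  have "(deriv ^^ n) f \<in> S" for n by (induction n) (use assms in auto)
  then show ?thesis unfolding smooth_def using assms(2) by blast
qed

lemma smooth_iff_deriv: "smooth f \<longleftrightarrow> (\<forall>x. f field_differentiable at x) \<and> smooth (deriv f)"
proof
  assume f: "smooth f"
  have "(deriv ^^ n) (deriv f) = (deriv ^^ Suc n) f" for n by (simp add: funpow_swap1)
  then have "smooth (deriv f)" using f unfolding smooth_def by metis
  moreover have "f field_differentiable at x" for x
    using f unfolding smooth_def by (metis funpow_0)
  ultimately show "(\<forall>x. f field_differentiable at x) \<and> smooth (deriv f)" by blast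
next
  assume "(\<forall>x. f field_differentiable at x) \<and> smooth (deriv f)"
  then have "(deriv ^^ n) f field_differentiable at x" for n x
    by (cases n) (auto simp: smooth_def funpow_swap1)
  then show "smooth f" by (simp add: smooth_def)
qed

lemma smooth_const: "smooth (\<lambda>x. c)"
  by (rule smooth_coinduct[of _ "range (\<lambda>c x. c)"]) auto

text \<open>Closing under all three operations at once makes the class invariant under
  \<open>deriv\<close>: the product rule leads from products to sums of products, the chain rule to
  a constant times an affine substitution. Smoothness then follows from
  \<open>smooth_coinduct\<close> without a formula for higher derivatives.\<close>

inductive smooth_generated :: "(real \<Rightarrow> real) \<Rightarrow> bool" where
  base: "smooth f \<Longrightarrow> smooth_generated f"
| add: "smooth_generated f \<Longrightarrow> smooth_generated g \<Longrightarrow> smooth_generated (\<lambda>x. f x + g x)"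
| mult: "smooth_generated f \<Longrightarrow> smooth_generated g \<Longrightarrow> smooth_generated (\<lambda>x. f x * g x)"
| affine: "smooth_generated f \<Longrightarrow> smooth_generated (\<lambda>x. f (a * x + b))"

lemma smooth_generated_deriv:
  "smooth_generated f \<Longrightarrow> (\<forall>x. f field_differentiable at x) \<and> smooth_generated (deriv f)"
proof (induction rule: smooth_generated.induct)
  case (base f)
  then show ?case using smooth_iff_deriv smooth_generated.base by blast
next
  case (add f g)
  then have "deriv (\<lambda>x. f x + g x) = (\<lambda>x. deriv f x + deriv g x)" by auto
  with add show ?case by (auto intro: smooth_generated.add field_differentiable_add)
next
  case (mult f g)
  then have "deriv (\<lambda>x. f x * g x) = (\<lambda>x. f x * deriv g x + deriv f x * g x)" by auto
  with mult show ?case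
    by (auto intro!: smooth_generated.add smooth_generated.mult field_differentiable_mult)
next
  case (affine f a b)
  have d: "((\<lambda>x. f (a * x + b)) has_real_derivative a * deriv f (a * x + b)) (at x)" for x
    unfolding mult.commute[of a "deriv f _"] using affine.IH
    by (intro DERIV_chain2[where f=f]) (auto simp: field_differentiable_derivI intro!: derivative_eq_intros)
  then have "deriv (\<lambda>x. f (a * x + b)) = (\<lambda>x. a * deriv f (a * x + b))" by (auto intro!: DERIV_imp_deriv)
  moreover have "smooth_generated (\<lambda>x. a * deriv f (a * x + b))"
    by (rule smooth_generated.mult[OF smooth_generated.base[OF smooth_const] smooth_generated.affine])
      (use affine.IH in blast)
  ultimately show ?case using d by (auto simp: field_differentiable_def)
qed

lemma smooth_generated_imp_smooth: "smooth_generated f \<Longrightarrow> smooth f"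
  by (rule smooth_coinduct[of _ "Collect smooth_generated"]) (use smooth_generated_deriv in auto)

lemmas smooth_add = smooth_generated_imp_smooth[OF smooth_generated.add[OF smooth_generated.base smooth_generated.base]]
  and smooth_mult = smooth_generated_imp_smooth[OF smooth_generated.mult[OF smooth_generated.base smooth_generated.base]]
  and smooth_affine = smooth_generated_imp_smooth[OF smooth_generated.affine[OF smooth_generated.base]]

lemma smooth_DERIV: "smooth f \<Longrightarrow> (f has_real_derivative deriv f x) (at x)"
  using field_differentiable_derivI smooth_iff_deriv by blast

lemma smooth_continuous: "smooth f \<Longrightarrow> continuous_on A f"
  by (meson DERIV_isCont continuous_at_imp_continuous_on smooth_DERIV)

section \<open>Finite sums of the dyadic partition and a smooth step\<close>

lemma dyadic_partition_D:
  assumes "dyadic_partition \<phi>"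
  shows "smooth \<phi>" "\<phi> (- \<xi>) = \<phi> \<xi>" "\<bar>\<xi>\<bar> < 3/4 \<Longrightarrow> \<phi> \<xi> = 0" "8/3 < \<bar>\<xi>\<bar> \<Longrightarrow> \<phi> \<xi> = 0"
  using assms unfolding dyadic_partition_def by (fastforce)+

lemma dyadic_partition_sum:
  assumes "dyadic_partition \<phi>" "finite J" "\<xi> \<noteq> 0"
    and "\<And>j. j \<notin> J \<Longrightarrow> \<phi> (2 powr (- real_of_int j) * \<xi>) = 0"
  shows "(\<Sum>j\<in>J. \<phi> (2 powr (- real_of_int j) * \<xi>)) = 1"
proof -
  have "((\<lambda>j::int. \<phi> (2 powr (- real_of_int j) * \<xi>)) has_sum 1) UNIV"
    using assms(1,3) by (auto simp: dyadic_partition_def)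
  then have "((\<lambda>j::int. \<phi> (2 powr (- real_of_int j) * \<xi>)) has_sum 1) J"
    using assms(4) by (subst has_sum_cong_neutral[where T=UNIV]) auto
  with assms(2) show ?thesis
    by (metis has_sum_finite infsumI)
qed

text \<open>\<kappa> is the primitive of \<phi>^2 divided by its total mass. The square makes it
  monotone although \<phi> may change sign, and the support of \<phi> lies inside [-3, 3], which
  leaves room for R = 4.\<close>

lemma smooth_step_exists:
  assumes "dyadic_partition \<phi>"
  obtains \<kappa> k :: "real \<Rightarrow> real" and R :: real
  where "0 < R" "smooth \<kappa>" "\<And>x. (\<kappa> has_real_derivative k x) (at x)" "continuous_on UNIV k"
    "\<And>x. x \<le> - R \<Longrightarrow> \<kappa> x = 0" "\<And>x. R \<le> x \<Longrightarrow> \<kappa> x = 1" "\<And>x. 0 \<le> \<kappa> x" "\<And>x. \<kappa> x \<le> 1"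
    "\<And>x. R < \<bar>x\<bar> \<Longrightarrow> k x = 0" "\<And>x. 0 \<le> k x"
proof -
  note D = dyadic_partition_D[OF assms]
  define g where "g \<equiv> \<lambda>x. \<phi> x * \<phi> x"
  have sg: "smooth g" unfolding g_def by (intro smooth_mult D)
  have cg: "continuous_on A g" for A using sg by (rule smooth_continuous)
  have g0: "g x = 0" if "3 \<le> \<bar>x\<bar>" for x using D(4)[of x] that by (auto simp: g_def)
  have gnn: "0 \<le> g x" for x by (simp add: g_def)
  define c where "c = integral {-4..4} g"
  have gint: "g integrable_on {a..b}" for a b by (rule integrable_continuous_real[OF cg])
  have c: "0 < c"
  proof -
    \<comment> \<open>If \<phi> vanished identically, the sum over the empty index set would have to
      be 1.\<close>
    obtain x where x: "\<phi> x \<noteq> 0"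
      using dyadic_partition_sum[OF assms, of "{}" 1] by auto
    have xb: "x \<in> {-4..4}" using D(4)[of x] x by force
    have "c \<noteq> 0"
    proof
      assume "c = 0"
      then have "(g has_integral 0) (cbox (-4) 4)"
        using gint[of "-4" 4] by (metis c_def integrable_integral cbox_interval)
      from has_integral_0_cbox_imp_0[OF cg gnn this, of x] xb x show False by (auto simp: g_def)
    qed
    moreover have "0 \<le> c" unfolding c_def using gnn by (intro integral_nonneg gint) auto
    ultimately show ?thesis by simp
  qed
  define \<kappa> where "\<kappa> \<equiv> \<lambda>x. integral {-4..x} g / c"
  have k0: "\<kappa> x = 0" if "x \<le> -3" for x
  proof -
    have "integral {-4..x} g = integral {-4..x} (\<lambda>_. 0)"
      using that by (intro integral_cong g0) auto
    then show ?thesis by (simp add: \<kappa>_def)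
  qed
  have k1: "\<kappa> x = 1" if "4 \<le> x" for x
  proof -
    have "integral {-4..4} g + integral {4..x} g = integral {-4..x} g"
      using that by (intro Henstock_Kurzweil_Integration.integral_combine gint) auto
    moreover have "integral {4..x} g = integral {4..x} (\<lambda>_. 0)"
      by (intro integral_cong g0) auto
    ultimately show ?thesis using c by (simp add: \<kappa>_def c_def)
  qed
  have mono: "\<kappa> x \<le> \<kappa> y" if "x \<le> y" for x y
    unfolding \<kappa>_def using that c gnn
    by (intro divide_right_mono integral_subset_le gint) auto
  have kb: "0 \<le> \<kappa> x" "\<kappa> x \<le> 1" for x
    using mono[of "min x (-3)" x] k0[of "min x (-3)"] mono[of x "max x 4"] k1[of "max x 4"] by auto
  \<comment> \<open>The integral from -4 is a two-sided primitive only for x > -4; further left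
    \<kappa> vanishes in a neighbourhood.\<close>
  have der: "(\<kappa> has_real_derivative g x / c) (at x)" for x
  proof (cases "-4 < x")
    case True
    have "((\<lambda>u. integral {-4..u} g) has_real_derivative g x) (at x within {-4..x+1})"
      using True by (intro integral_has_real_derivative cg) auto
    then have "((\<lambda>u. integral {-4..u} g) has_real_derivative g x) (at x)"
      using True by (subst (asm) at_within_interior) auto
    then show ?thesis unfolding \<kappa>_def using c by (intro DERIV_cdivide)
  next
    case False
    then have "eventually (\<lambda>y. \<kappa> y = 0) (nhds x)"
      using k0 by (intro eventually_nhds_in_open[of "{..<-3}", THEN eventually_mono]) auto
    then have "(\<kappa> has_real_derivative 0) (at x) \<longleftrightarrow> ((\<lambda>_. 0) has_real_derivative 0) (at x)"
      by (intro DERIV_cong_ev) auto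
    moreover have "g x = 0" using False by (intro g0) auto
    ultimately show ?thesis by simp
  qed
  have "deriv \<kappa> = (\<lambda>x. (1 / c) * g x)" using der by (auto intro!: DERIV_imp_deriv)
  moreover have "smooth (\<lambda>x. (1 / c) * g x)" by (intro smooth_mult smooth_const sg)
  ultimately have "smooth \<kappa>"
    using der by (subst smooth_iff_deriv) (auto simp: field_differentiable_def)
  have "continuous_on UNIV (\<lambda>x. g x / c)" using c by (intro continuous_intros cg) auto
  show ?thesis
  proof (rule that[of 4 \<kappa> "\<lambda>x. g x / c"])
    show "smooth \<kappa>" "continuous_on UNIV (\<lambda>x. g x / c)" by fact+
    show "(\<kappa> has_real_derivative g x / c) (at x)" for x by (rule der)
    show "\<kappa> x = 0" if "x \<le> - 4" for x using that by (intro k0) auto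
    show "g x / c = 0" if "4 < \<bar>x\<bar>" for x using that g0[of x] by auto
    show "0 \<le> g x / c" for x using gnn[of x] c by simp
  qed (use k1 kb in auto)
qed

text \<open>The sign passes from intervals to finite disjoint unions of them, from these to compact
  sets by outer approximation, and from compact sets to the Borel set where h is negative by inner
  regularity. This takes the place of Lebesgue's differentiation theorem.\<close>

lemma AE_nonneg_if_interval_integrals_nonneg:
  fixes h :: "real \<Rightarrow> real"
  assumes hm[measurable]: "h \<in> borel_measurable borel"
    and int: "\<And>R. set_integrable lborel {-R..R} h"
    and nn: "\<And>x y. x \<le> y \<Longrightarrow> 0 \<le> (LINT z:{x..y}|lborel. h z)"
  shows "AE x in lborel. 0 \<le> h x"
proof -
  have sub: "set_integrable lborel S h" if "S \<in> sets borel" "S \<subseteq> {-R..R}" for S R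
    using set_integrable_subset[OF int] that by auto
  have compact_nn: "0 \<le> (LINT z:K|lborel. h z)" if K: "compact K" for K
  proof -
    define d where "d n = 1 / real (Suc n)" for n
    have d0: "0 < d n" "d n \<le> 1" for n by (auto simp: d_def)
    \<comment> \<open>Indices of the cells of a grid of mesh \<open>d n\<close> that meet K; the
      union of these cells contains K and stays within distance \<open>d n\<close> of it.\<close>
    define J where "J n = (\<lambda>k. \<lfloor>k / d n\<rfloor>) ` K" for n
    define cell where "cell n i = {real_of_int i * d n..<real_of_int (i + 1) * d n}" for n and i :: int
    have cell_iff: "z \<in> cell n i \<longleftrightarrow> \<lfloor>z / d n\<rfloor> = i" for z n i
      using d0[of n] unfolding cell_def by (auto simp: floor_eq_iff field_simps)
    obtain R where R: "\<And>k. k \<in> K \<Longrightarrow> \<bar>k\<bar> \<le> R"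
      using compact_imp_bounded[OF K] by (auto simp: bounded_real)
    have finJ: "finite (J n)" for n
    proof (rule finite_subset)
      show "J n \<subseteq> {\<lfloor>- R / d n\<rfloor>..\<lfloor>R / d n\<rfloor>}"
      proof
        fix i assume "i \<in> J n"
        then obtain k where k: "k \<in> K" "i = \<lfloor>k / d n\<rfloor>" by (auto simp: J_def)
        have "- R / d n \<le> k / d n" "k / d n \<le> R / d n"
          using R[OF k(1)] d0[of n] by (intro divide_right_mono; simp)+
        then show "i \<in> {\<lfloor>- R / d n\<rfloor>..\<lfloor>R / d n\<rfloor>}"
          unfolding k(2) by (auto intro: floor_mono)
      qed
    qed simp
    define U where "U n = (\<Union>i\<in>J n. cell n i)" for n
    have near: "\<exists>k\<in>K. \<bar>z - k\<bar> \<le> d n" if z: "z \<in> U n" for z n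
    proof -
      obtain k where k: "k \<in> K" "\<lfloor>z / d n\<rfloor> = \<lfloor>k / d n\<rfloor>"
        using z by (auto simp: U_def J_def cell_iff)
      have "\<bar>z / d n - k / d n\<bar> \<le> 1" using k(2) by linarith
      then have "\<bar>z - k\<bar> / d n \<le> 1" using d0[of n] by (simp add: diff_divide_distrib[symmetric] abs_divide)
      with k(1) show ?thesis using d0[of n] by (auto simp: field_simps)
    qed
    have KU: "K \<subseteq> U n" for n by (auto simp: U_def J_def cell_iff)
    have UR: "U n \<subseteq> {-(R+1)..R+1}" for n
      using near R d0[of n] by (fastforce simp: abs_le_iff)
    have cellm[measurable]: "cell n i \<in> sets borel" for n i by (simp add: cell_def)
    have Um[measurable]: "U n \<in> sets borel" for n unfolding U_def using finJ by auto
    have cellint: "0 \<le> (LINT z:cell n i|lborel. h z)" for n i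
    proof -
      have "(LINT z:cell n i|lborel. h z)
          = (LINT z:{real_of_int i * d n..real_of_int (i + 1) * d n}|lborel. h z)"
        by (intro set_integral_null_delta[symmetric] set_integral_cong_set)
           (auto simp: cell_def set_borel_measurable_def intro!: AE_I'[of "{real_of_int (i+1) * d n}"])
      then show ?thesis using nn d0[of n] by (auto intro!: nn mult_right_mono)
    qed
    have Uint: "0 \<le> (LINT z:U n|lborel. h z)" for n
      unfolding U_def
    proof (subst set_integral_finite_Union)
      show "disjoint_family_on (cell n) (J n)"
        by (auto simp: disjoint_family_on_def cell_iff)
      show "set_integrable lborel (cell n i) h" if "i \<in> J n" for i
        using UR that by (intro sub[of _ "R+1"]) (auto simp: U_def)
    qed (auto simp: finJ cellint intro!: sum_nonneg)
    have Km[measurable]: "K \<in> sets borel" using K by (simp add: borel_compact)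
    \<comment> \<open>A point outside the closed set K has positive distance to it and leaves
      \<open>U n\<close> once the mesh is smaller, so the indicators converge pointwise.\<close>
    have "(\<lambda>n. LINT z:U n|lborel. h z) \<longlonglongrightarrow> (LINT z:K|lborel. h z)"
      unfolding set_lebesgue_integral_def
    proof (rule integral_dominated_convergence[where w="\<lambda>z. norm (indicator {-(R+1)..R+1} z *\<^sub>R h z)"])
      show "integrable lborel (\<lambda>z. norm (indicator {-(R+1)..R+1} z *\<^sub>R h z))"
        using int[of "R+1"] by (intro integrable_norm) (simp add: set_integrable_def)
      show "AE z in lborel. (\<lambda>n. indicator (U n) z *\<^sub>R h z) \<longlonglongrightarrow> indicator K z *\<^sub>R h z"
      proof (rule AE_I2)
        fix z
        have "\<forall>\<^sub>F n in sequentially. indicator (U n) z = (indicator K z :: real)"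
        proof (cases "z \<in> K")
          case True
          then have "z \<in> U n" for n using KU by blast
          then show ?thesis by (simp add: True)
        next
          case False
          then obtain e where e: "0 < e" "\<And>k. k \<in> K \<Longrightarrow> e \<le> dist z k"
            using separate_point_closed[OF compact_imp_closed[OF K]] by blast
          have "\<forall>\<^sub>F n in sequentially. d n < e"
            unfolding d_def using order_tendstoD(2)[OF LIMSEQ_inverse_real_of_nat e(1)]
            by (simp add: inverse_eq_divide)
          then show ?thesis
          proof eventually_elim
            case (elim n)
            then have "z \<notin> U n" using near[of z n] e(2) by (force simp: dist_real_def)
            with False show ?case by simp
          qed
        qed
        then show "(\<lambda>n. indicator (U n) z *\<^sub>R h z) \<longlonglongrightarrow> indicator K z *\<^sub>R h z"
          by (intro tendsto_eventually) (auto elim: eventually_mono)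
      qed
      show "AE z in lborel. norm (indicator (U n) z *\<^sub>R h z) \<le> norm (indicator {-(R+1)..R+1} z *\<^sub>R h z)" for n
      proof (rule AE_I2)
        fix z
        show "norm (indicator (U n) z *\<^sub>R h z) \<le> norm (indicator {-(R+1)..R+1} z *\<^sub>R h z)"
          using UR[of n] by (cases "z \<in> U n") (force simp: indicator_def)+
      qed
    qed measurable
    then show ?thesis by (rule LIMSEQ_le_const) (use Uint in blast)
  qed
  have AE_R: "AE x in lborel. x \<in> {-R..R} \<longrightarrow> 0 \<le> h x" for R
  proof -
    \<comment> \<open>The negative part of h on [-R, R] as a density gives a finite measure, hence
      an inner regular one. On a compact subset of B its mass is minus the integral of h, which is
      at most 0.\<close>
    define N where "N = density lborel (\<lambda>x. ennreal (- h x) * indicator {-R..R} x)"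
    define B where "B = {x\<in>{-R..R}. h x < 0}"
    have Bm[measurable]: "B \<in> sets borel" unfolding B_def by measurable
    have "emeasure N (space N) = (\<integral>\<^sup>+ x. ennreal (- (indicator {-R..R} x *\<^sub>R h x)) \<partial>lborel)"
      unfolding N_def by (subst emeasure_density) (auto intro!: nn_integral_cong split: split_indicator)
    also have "\<dots> < \<infinity>"
      using int[of R] unfolding set_integrable_def real_integrable_def by (auto simp: less_top)
    finally have fin: "emeasure N (space N) \<noteq> \<infinity>" by simp
    have sN: "sets N = sets borel" by (simp add: N_def)
    have "emeasure N B = (SUP K \<in> {K. K \<subseteq> B \<and> compact K}. emeasure N K)"
      by (rule inner_regular[OF sN fin Bm])
    also have "\<dots> \<le> 0"
    proof (rule SUP_least)
      fix K assume K: "K \<in> {K. K \<subseteq> B \<and> compact K}"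
      then have Km[measurable]: "K \<in> sets borel" by (simp add: borel_compact)
      have iK: "integrable lborel (\<lambda>x. indicator K x *\<^sub>R h x)"
        using sub[of K R] K by (force simp: B_def set_integrable_def)
      have "emeasure N K = (\<integral>\<^sup>+ x. ennreal (- (indicator K x *\<^sub>R h x)) \<partial>lborel)"
        unfolding N_def using K
        by (subst emeasure_density) (auto simp: B_def intro!: nn_integral_cong split: split_indicator)
      also have "\<dots> = ennreal (\<integral>x. - (indicator K x *\<^sub>R h x) \<partial>lborel)"
        using K by (intro nn_integral_eq_integral integrable_minus iK)
          (auto simp: B_def split: split_indicator intro!: AE_I2)
      also have "\<dots> \<le> ennreal 0"
        using compact_nn[of K] K by (intro ennreal_leI) (simp add: set_lebesgue_integral_def)
      finally show "emeasure N K \<le> 0" by simp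
    qed
    finally have "(\<integral>\<^sup>+ x. ennreal (- h x) * indicator {-R..R} x * indicator B x \<partial>lborel) = 0"
      unfolding N_def by (subst (asm) emeasure_density) auto
    then have "AE x in lborel. ennreal (- h x) * indicator {-R..R} x * indicator B x = 0"
      by (subst (asm) nn_integral_0_iff_AE) auto
    then show ?thesis
      by eventually_elim (auto simp: B_def indicator_def not_le[symmetric] ennreal_eq_0_iff split: if_splits)
  qed
  have "AE x in lborel. \<forall>n::nat. x \<in> {-real n..real n} \<longrightarrow> 0 \<le> h x"
    using AE_R by (subst AE_all_countable) auto
  then show ?thesis
  proof eventually_elim
    case (elim x)
    obtain n where "\<bar>x\<bar> \<le> real n" using real_arch_simple by blast
    with elim show ?case by (auto simp: abs_le_iff)
  qed
qed

lemma AE_le_if_interval_integrals_le: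
  fixes g :: "real \<Rightarrow> real"
  assumes "locally_integrable g"
    and "\<And>x y. x \<le> y \<Longrightarrow> (LINT z:{x..y}|lborel. g z) \<le> L * (y - x)"
  shows "AE x in lborel. g x \<le> L"
proof -
  have gm[measurable]: "g \<in> borel_measurable borel" and gi: "set_integrable lborel {-R..R} g" for R
    using assms(1) by (auto simp: locally_integrable_def)
  have ci: "set_integrable lborel {x..y} (\<lambda>_. L)" for x y :: real
    by (intro borel_integrable_atLeastAtMost' continuous_on_const)
  have gi': "set_integrable lborel {x..y} g" for x y
    by (rule set_integrable_subset[OF gi[of "max \<bar>x\<bar> \<bar>y\<bar>"]]) auto
  have "AE x in lborel. 0 \<le> L - g x"
  proof (rule AE_nonneg_if_interval_integrals_nonneg)
    fix x y :: real assume "x \<le> y"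
    then show "0 \<le> (LINT z:{x..y}|lborel. L - g z)"
      using assms(2)[of x y] by (subst set_integral_diff(2)[OF ci gi'])
        (simp add: set_lebesgue_integral_def mult.commute)
  qed (auto intro!: set_integral_diff(1)[OF ci gi'])
  then show ?thesis by eventually_elim simp
qed

text \<open>The indicator of \<open>[x,y]\<close> is the limit of the test functions
  \<open>z \<mapsto> \<kappa>((z - x)/\<epsilon>) - \<kappa>((z - y)/\<epsilon>)\<close> for a smooth step \<open>\<kappa>\<close>.\<close>

lemma weak_derivative_FTC:
  assumes "dyadic_partition \<phi>" and wd: "weak_derivative f g" and cf: "continuous_on UNIV f"
    and "x \<le> y"
  shows "f y - f x = (LINT z:{x..y}|lborel. g z)"
proof (cases "x = y")
  case True
  then show ?thesis by (simp add: set_integral_at_point[where f=g])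
next
  case False
  with assms have xy: "x < y" by simp
  obtain \<kappa> k R where R: "0 < R" and sk: "smooth \<kappa>" and dk: "\<And>x. (\<kappa> has_real_derivative k x) (at x)"
    and ck: "continuous_on UNIV k"
    and k0: "\<And>x. x \<le> - R \<Longrightarrow> \<kappa> x = 0" and k1: "\<And>x. R \<le> x \<Longrightarrow> \<kappa> x = 1"
    and knn: "\<And>x. 0 \<le> \<kappa> x" and kle: "\<And>x. \<kappa> x \<le> 1"
    and kz: "\<And>x. R < \<bar>x\<bar> \<Longrightarrow> k x = 0" and kpos: "\<And>x. 0 \<le> k x"
    by (rule smooth_step_exists[OF assms(1)]) (rule that; assumption)
  have gm[measurable]: "g \<in> borel_measurable borel" and gi: "set_integrable lborel {-R..R} g" for R
    using wd by (auto simp: weak_derivative_def locally_integrable_def)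
  have fm[measurable]: "f \<in> borel_measurable borel" using cf by (rule borel_measurable_continuous_onI)
  have km[measurable]: "k \<in> borel_measurable borel" using ck by (rule borel_measurable_continuous_onI)
  have \<kappa>m[measurable]: "\<kappa> \<in> borel_measurable borel"
    using smooth_continuous[OF sk] by (rule borel_measurable_continuous_onI)
  define d where "d n = 1 / real (Suc n)" for n
  have d0: "0 < d n" "d n \<le> 1" for n by (auto simp: d_def)
  have dlim: "d \<longlonglongrightarrow> 0"
    unfolding d_def using LIMSEQ_inverse_real_of_nat by (simp add: inverse_eq_divide)
  have kbd: "\<exists>M. \<forall>z. \<bar>k z\<bar> \<le> M"
  proof -
    have "bounded (k ` {-R..R})"
      by (intro compact_imp_bounded compact_continuous_image continuous_on_subset[OF ck]) auto
    then obtain M where M: "\<And>z. z \<in> {-R..R} \<Longrightarrow> \<bar>k z\<bar> \<le> M"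
      unfolding bounded_real by blast
    have "\<bar>k z\<bar> \<le> \<bar>M\<bar>" for z
    proof (cases "R < \<bar>z\<bar>")
      case False
      then have "z \<in> {-R..R}" by auto
      from M[OF this] show ?thesis by linarith
    qed (simp add: kz)
    then show ?thesis by blast
  qed
  then obtain M where M: "\<And>z. \<bar>k z\<bar> \<le> M" by blast
  have kint: "(\<integral>z. k z \<partial>lborel) = 1"
  proof -
    have "(\<integral>z. k z * indicator {-R..R} z \<partial>lborel) = \<kappa> R - \<kappa> (-R)"
      using R dk by (intro integral_FTC_Icc_real)
        (auto intro!: continuous_on_interior continuous_on_subset[OF ck]
          simp: continuous_on_eq_continuous_at[symmetric] ck[unfolded continuous_on_eq_continuous_at[OF open_UNIV]])
    also have "(\<lambda>z. k z * indicator {-R..R} z) = k"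
    proof
      fix z show "k z * indicator {-R..R} z = k z"
        using kz[of z] by (cases "R < \<bar>z\<bar>") (auto simp: indicator_def)
    qed
    finally show ?thesis using k0[of "-R"] k1[of R] R by simp
  qed
  \<comment> \<open>The density k of the step has mass 1, so f averaged against k at scale
    \<open>d n\<close> tends to f c. This is where continuity of f enters.\<close>
  have mollify: "(\<lambda>n. \<integral>w. f (c + d n * w) * k w \<partial>lborel) \<longlonglongrightarrow> f c" for c
  proof -
    have "bounded (f ` {c - R..c + R})"
      by (intro compact_imp_bounded compact_continuous_image continuous_on_subset[OF cf]) auto
    then obtain N where N: "\<And>z. z \<in> {c - R..c + R} \<Longrightarrow> \<bar>f z\<bar> \<le> N"
      unfolding bounded_real by blast
    have N0: "0 \<le> N" using N[of c] R by auto
    have "(\<lambda>n. \<integral>w. f (c + d n * w) * k w \<partial>lborel) \<longlonglongrightarrow> (\<integral>w. f c * k w \<partial>lborel)"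
    proof (rule integral_dominated_convergence[where w="\<lambda>w. N * M * indicator {-R..R} w"])
      show "AE w in lborel. (\<lambda>n. f (c + d n * w) * k w) \<longlonglongrightarrow> f c * k w"
      proof (rule AE_I2)
        fix w
        have "(\<lambda>n. c + d n * w) \<longlonglongrightarrow> c + 0 * w" by (intro tendsto_intros dlim)
        then have "(\<lambda>n. f (c + d n * w)) \<longlonglongrightarrow> f c"
          by (intro continuous_on_tendsto_compose[OF cf]) auto
        then show "(\<lambda>n. f (c + d n * w) * k w) \<longlonglongrightarrow> f c * k w" by (intro tendsto_intros)
      qed
      show "AE w in lborel. norm (f (c + d n * w) * k w) \<le> N * M * indicator {-R..R} w" for n
      proof (rule AE_I2)
        fix w
        show "norm (f (c + d n * w) * k w) \<le> N * M * indicator {-R..R} w"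
        proof (cases "\<bar>w\<bar> \<le> R")
          case True
          have "\<bar>d n * w\<bar> \<le> 1 * R" unfolding abs_mult using d0[of n] True by (intro mult_mono) auto
          then have "c + d n * w \<in> {c - R..c + R}" by (auto simp: abs_le_iff)
          then have "\<bar>f (c + d n * w)\<bar> * \<bar>k w\<bar> \<le> N * M" using N M N0 by (intro mult_mono) auto
          then show ?thesis using True by (simp add: abs_mult abs_le_iff)
        qed (use kz[of w] M[of 0] N0 in auto)
      qed
    qed (auto intro!: integrable_mult_right simp: integrable_indicator_iff emeasure_lborel_Icc_eq)
    then show ?thesis by (simp add: kint)
  qed
  define \<psi> where "\<psi> n z = \<kappa> ((z - x) / d n) - \<kappa> ((z - y) / d n)" for n z
  have dpsi: "(\<psi> n has_real_derivative (k ((z - x) / d n) - k ((z - y) / d n)) / d n) (at z)" for n z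
    unfolding \<psi>_def using d0[of n]
    by (auto intro!: derivative_eq_intros DERIV_chain2[OF dk] simp: field_simps)
  have \<psi>0: "\<psi> n z = 0" if out: "z \<notin> {x - R..y + R}" for n z
  proof -
    have Rd: "R * d n \<le> R" using R d0[of n] by (simp add: mult_left_le)
    consider "z < x - R" | "y + R < z" using out by (metis atLeastAtMost_iff not_le)
    then show ?thesis
    proof cases
      case 1
      have "(z - x) / d n \<le> (- R * d n) / d n" "(z - y) / d n \<le> (- R * d n) / d n"
        using 1 xy d0[of n] Rd by (intro divide_right_mono; simp)+
      then show ?thesis using d0[of n] by (simp add: \<psi>_def k0)
    next
      case 2
      have "(R * d n) / d n \<le> (z - x) / d n" "(R * d n) / d n \<le> (z - y) / d n"
        using 2 xy d0[of n] Rd by (intro divide_right_mono; simp)+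
      then show ?thesis using d0[of n] by (simp add: \<psi>_def k1)
    qed
  qed
  have tf: "test_function (\<psi> n)" for n
  proof -
    have "smooth (\<lambda>z. \<kappa> ((1 / d n) * z + (- x / d n)) + (-1) * \<kappa> ((1 / d n) * z + (- y / d n)))"
      by (intro smooth_add smooth_mult smooth_const smooth_affine[OF sk])
    also have "(\<lambda>z. \<kappa> ((1 / d n) * z + (- x / d n)) + (-1) * \<kappa> ((1 / d n) * z + (- y / d n))) = \<psi> n"
      unfolding \<psi>_def by (simp add: diff_divide_distrib)
    finally have "smooth (\<psi> n)" .
    moreover have "\<psi> n z \<noteq> 0 \<longrightarrow> \<bar>z\<bar> \<le> \<bar>x\<bar> + \<bar>y\<bar> + R" for z using \<psi>0[of z n] R by force
    ultimately show ?thesis unfolding test_function_def by blast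
  qed
  have shift: "(\<integral>z. f z * k ((z - c) / d n) / d n \<partial>lborel) = (\<integral>w. f (c + d n * w) * k w \<partial>lborel)"
    and shift_int: "integrable lborel (\<lambda>z. f z * k ((z - c) / d n) / d n)" for c n
  proof -
    show "(\<integral>z. f z * k ((z - c) / d n) / d n \<partial>lborel) = (\<integral>w. f (c + d n * w) * k w \<partial>lborel)"
      using d0[of n] by (subst lborel_integral_real_affine[where c="d n" and t=c]) auto
    have "integrable lborel (\<lambda>z. indicator {c - R * d n..c + R * d n} z *\<^sub>R (f z * k ((z - c) / d n) / d n))"
      using d0[of n]
      by (intro borel_integrable_compact continuous_intros continuous_on_subset[OF cf]
           continuous_on_compose2[OF ck]) auto
    also have "(\<lambda>z. indicator {c - R * d n..c + R * d n} z *\<^sub>R (f z * k ((z - c) / d n) / d n))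
      = (\<lambda>z. f z * k ((z - c) / d n) / d n)"
    proof
      fix z
      have "k ((z - c) / d n) = 0" if "z \<notin> {c - R * d n..c + R * d n}"
      proof (rule kz)
        have "R * d n < \<bar>z - c\<bar>" using that by auto
        then show "R < \<bar>(z - c) / d n\<bar>" using d0[of n] by (simp add: field_simps)
      qed
      then show "indicator {c - R * d n..c + R * d n} z *\<^sub>R (f z * k ((z - c) / d n) / d n)
        = f z * k ((z - c) / d n) / d n" by (auto simp: indicator_def)
    qed
    finally show "integrable lborel (\<lambda>z. f z * k ((z - c) / d n) / d n)" .
  qed
  \<comment> \<open>The definition of the weak derivative, tested with \<open>\<psi> n\<close>; the
    two parts of \<open>deriv (\<psi> n)\<close> are bumps at x and at y.\<close>
  have eq: "(\<integral>w. f (x + d n * w) * k w \<partial>lborel) - (\<integral>w. f (y + d n * w) * k w \<partial>lborel)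
      = - (\<integral>z. g z * \<psi> n z \<partial>lborel)" for n
  proof -
    have "- (\<integral>z. g z * \<psi> n z \<partial>lborel) = (\<integral>z. f z * deriv (\<psi> n) z \<partial>lborel)"
      using wd tf by (simp add: weak_derivative_def)
    also have "\<dots> = (\<integral>z. f z * k ((z - x) / d n) / d n - f z * k ((z - y) / d n) / d n \<partial>lborel)"
      by (intro Bochner_Integration.integral_cong refl)
        (simp add: DERIV_imp_deriv[OF dpsi] diff_divide_distrib right_diff_distrib)
    also have "\<dots> = (\<integral>z. f z * k ((z - x) / d n) / d n \<partial>lborel) - (\<integral>z. f z * k ((z - y) / d n) / d n \<partial>lborel)"
      by (intro Bochner_Integration.integral_diff shift_int)
    finally show ?thesis by (simp only: shift)
  qed
  let ?J = "{-(\<bar>x\<bar>+\<bar>y\<bar>+R)..\<bar>x\<bar>+\<bar>y\<bar>+R}"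
  have "(\<lambda>n. \<integral>z. g z * \<psi> n z \<partial>lborel) \<longlonglongrightarrow> (\<integral>z. g z * indicator {x..y} z \<partial>lborel)"
  proof (rule integral_dominated_convergence[where w="\<lambda>z. norm (indicator ?J z *\<^sub>R g z)"])
    show "integrable lborel (\<lambda>z. norm (indicator ?J z *\<^sub>R g z))"
      using gi unfolding set_integrable_def by (intro integrable_norm)
    show "AE z in lborel. norm (g z * \<psi> n z) \<le> norm (indicator ?J z *\<^sub>R g z)" for n
    proof (rule AE_I2)
      fix z
      have "\<bar>\<psi> n z\<bar> \<le> 1"
        using knn[of "(z-x)/d n"] knn[of "(z-y)/d n"] kle[of "(z-x)/d n"] kle[of "(z-y)/d n"]
        by (simp add: \<psi>_def abs_le_iff)
      then have "\<bar>g z\<bar> * \<bar>\<psi> n z\<bar> \<le> \<bar>g z\<bar>" by (simp add: mult_left_le)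
      then show "norm (g z * \<psi> n z) \<le> norm (indicator ?J z *\<^sub>R g z)"
      proof (cases "z \<in> {x - R..y + R}")
        case True
        then have "z \<in> ?J" by auto
        then have "indicator ?J z = (1::real)" by (rule indicator_simps)
        with \<open>\<bar>g z\<bar> * \<bar>\<psi> n z\<bar> \<le> \<bar>g z\<bar>\<close> show ?thesis by (simp add: abs_mult)
      qed (simp add: \<psi>0)
    qed
    show "AE z in lborel. (\<lambda>n. g z * \<psi> n z) \<longlonglongrightarrow> g z * indicator {x..y} z"
    proof -
      \<comment> \<open>At an end point the argument of one of the two steps is 0 for every n, and
        the limit would involve \<kappa> 0; two points form a null set.\<close>
      have "AE z in lborel. z \<noteq> x" "AE z in lborel. z \<noteq> y" by (rule AE_lborel_singleton)+
      then show ?thesis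
      proof eventually_elim
        case (elim z)
        have lim: "(\<lambda>n. \<kappa> ((z - c) / d n)) \<longlonglongrightarrow> (if c < z then 1 else 0)" if "z \<noteq> c" for c
        proof -
          have "\<forall>\<^sub>F n in sequentially. d n < \<bar>z - c\<bar> / R"
            using that R by (intro order_tendstoD(2)[OF dlim]) auto
          then have "\<forall>\<^sub>F n in sequentially. \<kappa> ((z - c) / d n) = (if c < z then 1 else 0)"
          proof eventually_elim
            case (elim n)
            then have *: "R * d n < \<bar>z - c\<bar>" using R by (simp add: field_simps)
            show ?case
            proof (cases "c < z")
              case True
              with * have "R \<le> (z - c) / d n" using d0[of n] by (simp add: field_simps)
              then show ?thesis using True k1 by simp
            next
              case False
              with * have "(z - c) / d n \<le> - R" using d0[of n] by (simp add: field_simps)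
              then show ?thesis using False k0 by simp
            qed
          qed
          then show ?thesis by (rule tendsto_eventually)
        qed
        have "(\<lambda>n. \<psi> n z) \<longlonglongrightarrow> (if x < z then 1 else 0) - (if y < z then 1 else 0)"
          unfolding \<psi>_def using elim by (intro tendsto_diff lim) auto
        also have "(if x < z then 1 else 0) - (if y < z then 1 else 0) = (indicator {x..y} z :: real)"
          using elim xy by (auto simp: indicator_def)
        finally show ?case by (intro tendsto_mult tendsto_const)
      qed
    qed
  qed (auto simp: \<psi>_def)
  then have "(\<lambda>n. - (\<integral>z. g z * \<psi> n z \<partial>lborel)) \<longlonglongrightarrow> - (\<integral>z. g z * indicator {x..y} z \<partial>lborel)"
    by (intro tendsto_intros)
  moreover have "(\<lambda>n. - (\<integral>z. g z * \<psi> n z \<partial>lborel)) \<longlonglongrightarrow> f x - f y"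
    unfolding eq[symmetric] by (intro tendsto_diff mollify)
  ultimately have "f x - f y = - (\<integral>z. g z * indicator {x..y} z \<partial>lborel)"
    by (rule LIMSEQ_unique[rotated])
  then show ?thesis by (simp add: set_lebesgue_integral_def mult.commute)
qed

section \<open>Uniqueness for vanishing data\<close>

text \<open>The set of violations is open, and a nonempty open set has positive measure. This
  upgrades almost-everywhere estimates between continuous functions to all points.\<close>

lemma AE_le_imp_le:
  fixes f g :: "real \<Rightarrow> real"
  assumes "continuous_on UNIV f" "continuous_on UNIV g" and ae: "AE x in lborel. f x \<le> g x"
  shows "f x \<le> g x"
proof (rule ccontr)
  assume "\<not> f x \<le> g x"
  define S where "S = {x. g x < f x}"
  have "open S" unfolding S_def by (intro open_Collect_less assms)
  moreover have "x \<in> S" using \<open>\<not> f x \<le> g x\<close> by (simp add: S_def)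
  ultimately obtain e where e: "0 < e" "ball x e \<subseteq> S" by (rule openE)
  have "AE y in lborel. y \<notin> ball x e"
    using ae by eventually_elim (use e(2) in \<open>auto simp: S_def\<close>)
  then have "ball x e \<in> null_sets lborel" by (subst AE_iff_null_sets) auto
  then have "emeasure lborel (ball x e) = 0" by (rule null_setsD1)
  moreover have "ball x e = {x - e<..<x + e}" by (rule ball_eq_greaterThanLessThan)
  ultimately show False using e(1) by simp
qed

text \<open>Gronwall's inequality for a family, without derivatives. At the infimum T of the times
  at which some member exceeds \<eta> exp(a s), continuity of each single member keeps it below the
  barrier, and \<open>step\<close>, being uniform in i, prevents all members from crossing shortly
  after T. Uniformity in i is asked of \<open>step\<close> only.\<close>

lemma barrier_bound:
  fixes f :: "'i \<Rightarrow> real \<Rightarrow> real"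
  assumes cont: "\<And>i. i \<in> I \<Longrightarrow> continuous_on {0..\<tau>} (f i)"
    and init: "\<And>i. i \<in> I \<Longrightarrow> f i 0 \<le> 0"
    and step: "\<And>t E \<epsilon>. 0 \<le> t \<Longrightarrow> t < \<tau> \<Longrightarrow> 0 \<le> E \<Longrightarrow> \<forall>i\<in>I. f i t \<le> E \<Longrightarrow> 0 < \<epsilon> \<Longrightarrow>
        \<exists>d>0. \<forall>h. 0 < h \<and> h < d \<longrightarrow> (\<forall>i\<in>I. f i (t + h) \<le> E + c * h * E + \<epsilon> * h)"
    and "i \<in> I" "0 \<le> t" "t \<le> \<tau>"
  shows "f i t \<le> 0"
proof (rule field_le_epsilon)
  fix \<eta>' :: real assume "0 < \<eta>'"
  \<comment> \<open>\<bar>c\<bar> pays for the growth term, and 1 for the slack \<epsilon> h when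
    \<epsilon> is the height of the barrier itself.\<close>
  define a where "a = \<bar>c\<bar> + 1"
  define \<eta> where "\<eta> = \<eta>' / exp (a * t)"
  have \<eta>: "0 < \<eta>" using \<open>0 < \<eta>'\<close> by (simp add: \<eta>_def)
  define e where "e s = \<eta> * exp (a * s)" for s
  have epos: "0 < e s" for s using \<eta> by (simp add: e_def)
  define Bad where "Bad = {s\<in>{0..\<tau>}. \<exists>i\<in>I. e s < f i s}"
  have "Bad = {}"
  proof (rule ccontr)
    assume ne: "Bad \<noteq> {}"
    have bb: "bdd_below Bad" by (rule bdd_belowI[of _ 0]) (auto simp: Bad_def)
    define T where "T = Inf Bad"
    obtain s0 where s0: "s0 \<in> Bad" using ne by blast
    have T0: "0 \<le> T" unfolding T_def using ne by (intro cInf_greatest) (auto simp: Bad_def)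
    have Ts: "T \<le> s" if "s \<in> Bad" for s unfolding T_def using that bb by (rule cInf_lower)
    have T\<tau>: "T \<le> \<tau>" using Ts[OF s0] s0 by (auto simp: Bad_def)
    have good: "f i s \<le> e s" if "i \<in> I" "0 \<le> s" "s < T" for i s
    proof (rule ccontr)
      assume "\<not> f i s \<le> e s"
      then have "s \<in> Bad" using that T\<tau> by (auto simp: Bad_def not_le)
      with Ts[of s] that show False by auto
    qed
    have goodT: "f i T \<le> e T" if i: "i \<in> I" for i
    proof (rule ccontr)
      assume "\<not> f i T \<le> e T"
      then have pos: "0 < f i T - e T" by simp
      have "T \<noteq> 0" using pos init[OF i] epos[of 0] by auto
      then have T: "0 < T" using T0 by simp
      have "continuous_on {0..\<tau>} (\<lambda>s. f i s - e s)"
        unfolding e_def by (intro continuous_intros cont i)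
      then obtain d where d: "0 < d"
        "\<And>s. s \<in> {0..\<tau>} \<Longrightarrow> dist s T < d \<Longrightarrow> dist (f i s - e s) (f i T - e T) < f i T - e T"
        unfolding continuous_on_iff using pos T T\<tau> by (metis atLeastAtMost_iff T0)
      define s where "s = max 0 (T - d / 2)"
      have "s < T" "0 \<le> s" "dist s T < d" using T d(1) by (auto simp: s_def dist_real_def)
      with d(2)[of s] T\<tau> good[OF i, of s] show False by (auto simp: dist_real_def)
    qed
    \<comment> \<open>\<open>step\<close> only advances from times before \<tau>; with T = \<tau>
      the sole bad time would be T, which \<open>goodT\<close> excludes.\<close>
    have "T \<noteq> \<tau>"
    proof
      assume "T = \<tau>"
      with s0 Ts[OF s0] have "s0 = T" by (auto simp: Bad_def)
      moreover obtain j where "j \<in> I" "e s0 < f j s0" using s0 by (auto simp: Bad_def)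
      ultimately show False using goodT[of j] by simp
    qed
    with T\<tau> have "T < \<tau>" by simp
    \<comment> \<open>Both the bound E and the slack \<epsilon> are taken to be
      \<open>e T\<close>.\<close>
    from step[OF T0 this less_imp_le[OF epos] _ epos, of T T] goodT
    obtain d where d: "0 < d" "\<And>h i. 0 < h \<Longrightarrow> h < d \<Longrightarrow> i \<in> I \<Longrightarrow> f i (T + h) \<le> e T + c * h * e T + e T * h"
      by auto
    obtain s where s: "s \<in> Bad" "s < T + d"
      using cInf_lessD[OF ne, of "T + d"] d(1) by (auto simp: T_def)
    obtain j where j: "j \<in> I" "e s < f j s" using s(1) by (auto simp: Bad_def)
    have sT: "T < s" using Ts[OF s(1)] goodT[OF j(1)] j(2) by (cases "s = T") auto
    have "f j s \<le> e T + c * (s - T) * e T + e T * (s - T)"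
      using d(2)[of "s - T" j] sT s(2) j by simp
    also have "\<dots> = e T * (1 + (c + 1) * (s - T))" by (simp add: algebra_simps)
    also have "\<dots> \<le> e T * (1 + a * (s - T))"
      using epos[of T] sT by (intro mult_left_mono add_left_mono mult_right_mono) (auto simp: a_def)
    also have "\<dots> \<le> e T * exp (a * (s - T))"
      using epos[of T] by (intro mult_left_mono exp_ge_add_one_self) auto
    also have "\<dots> = e s" by (simp add: e_def exp_add[symmetric] algebra_simps)
    finally show False using j by simp
  qed
  moreover have "t \<in> Bad" if "e t < f i t" using assms(4-6) that by (auto simp: Bad_def)
  ultimately have "f i t \<le> e t" by (metis empty_iff not_le)
  also have "e t = \<eta>'" by (simp add: e_def \<eta>_def)
  finally show "f i t \<le> 0 + \<eta>'" by simp
qed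

section \<open>The right-hand side of the equation\<close>

lemma locally_integrable_imp_set_integrable:
  assumes "locally_integrable v"
  shows "set_integrable lborel {a..b} v"
proof -
  define R where "R = max \<bar>a\<bar> \<bar>b\<bar>"
  have "set_integrable lborel {-R..R} v" using assms by (simp add: locally_integrable_def)
  then show ?thesis by (rule set_integrable_subset) (auto simp: R_def)
qed

lemma integrable_imp_set_integrable:
  fixes g :: "real \<Rightarrow> real"
  assumes "integrable lborel g" "A \<in> sets borel"
  shows "set_integrable lborel A g"
  unfolding set_integrable_def using assms by (intro integrable_mult_indicator) auto

text \<open>The right-hand side as a functional of the spatial derivative; the name refers to the
  Hunter-Saxton equation, which results from differentiating the equation in x. As a function in its
  own right it is available at every x, whereas the equation is an almost-everywhere
  statement.\<close>

definition hs_source :: "real \<Rightarrow> (real \<Rightarrow> real) \<Rightarrow> real \<Rightarrow> real" where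
  "hs_source C v x = (LINT z:{..x}|lborel. 1/2 * (v z)\<^sup>2) + C * (LINT z|lborel. (v z)\<^sup>2)"

text \<open>The term with C does not depend on x and cancels. Monotonicity and the Lipschitz bound
  of the source both come from this identity.\<close>

lemma hs_source_diff:
  assumes "integrable lborel (\<lambda>z. (v z)\<^sup>2)" "x \<le> y"
  shows "hs_source C v y - hs_source C v x = (LINT z:{x<..y}|lborel. 1/2 * (v z)\<^sup>2)"
proof -
  have i: "set_integrable lborel A (\<lambda>z. 1/2 * (v z)\<^sup>2)" if "A \<in> sets borel" for A
    using assms(1) that by (intro set_integrable_mult_right integrable_imp_set_integrable) auto
  have "(LINT z:{..x} \<union> {x<..y}|lborel. 1/2 * (v z)\<^sup>2)
      = (LINT z:{..x}|lborel. 1/2 * (v z)\<^sup>2) + (LINT z:{x<..y}|lborel. 1/2 * (v z)\<^sup>2)"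
    by (intro set_integral_Un i) auto
  moreover have "{..x} \<union> {x<..y} = {..y}" using assms(2) by auto
  ultimately have "(LINT z:{..y}|lborel. 1/2 * (v z)\<^sup>2)
      = (LINT z:{..x}|lborel. 1/2 * (v z)\<^sup>2) + (LINT z:{x<..y}|lborel. 1/2 * (v z)\<^sup>2)" by (simp only:)
  then show ?thesis unfolding hs_source_def by linarith
qed

lemma hs_source_mono:
  assumes "integrable lborel (\<lambda>z. (v z)\<^sup>2)" "x \<le> y"
  shows "hs_source C v x \<le> hs_source C v y"
proof -
  have "0 \<le> (LINT z:{x<..y}|lborel. 1/2 * (v z)\<^sup>2)"
    unfolding set_lebesgue_integral_def by (intro integral_nonneg_AE) (auto simp: indicator_def)
  then show ?thesis using hs_source_diff[OF assms, of C] by simp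
qed

lemma hs_source_lipschitz:
  assumes sq: "integrable lborel (\<lambda>z. (v z)\<^sup>2)" and bd: "AE z in lborel. \<bar>v z\<bar> \<le> L"
  shows "\<bar>hs_source C v y - hs_source C v x\<bar> \<le> L\<^sup>2 / 2 * \<bar>y - x\<bar>"
proof -
  have *: "\<bar>hs_source C v y - hs_source C v x\<bar> \<le> L\<^sup>2 / 2 * \<bar>y - x\<bar>" if "x \<le> y" for x y
  proof -
    have "(LINT z:{x<..y}|lborel. 1/2 * (v z)\<^sup>2) \<le> (LINT z:{x<..y}|lborel. L\<^sup>2 / 2)"
    proof (rule set_integral_mono_AE)
      show "set_integrable lborel {x<..y} (\<lambda>z. 1/2 * (v z)\<^sup>2)"
        using sq by (intro set_integrable_mult_right integrable_imp_set_integrable) auto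
      show "set_integrable lborel {x<..y} (\<lambda>z. L\<^sup>2 / 2)"
        by (rule set_integrable_subset[where A="{x..y}"])
           (auto intro!: borel_integrable_atLeastAtMost' continuous_on_const)
      show "AE z in lborel. z \<in> {x<..y} \<longrightarrow> 1/2 * (v z)\<^sup>2 \<le> L\<^sup>2 / 2"
        using bd
      proof eventually_elim
        case (elim z)
        with power_mono[OF this, of 2] show ?case by simp
      qed
    qed
    also have "\<dots> = L\<^sup>2 / 2 * (y - x)" using that by (simp add: set_lebesgue_integral_def)
    finally show ?thesis using hs_source_diff[OF sq that, of C] hs_source_mono[OF sq that, of C] that by simp
  qed
  show ?thesis using *[of x y] *[of y x] by (cases "x \<le> y") (auto simp: abs_minus_commute)
qed

section \<open>One Euler step along characteristics\<close>

lemma set_integral_AE_near_const: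
  fixes v :: "real \<Rightarrow> real"
  assumes "locally_integrable v" "a \<le> b"
    and "AE z in lborel. z \<in> {a..b} \<longrightarrow> \<bar>\<xi> * v z - k\<bar> \<le> \<kappa>"
  shows "\<bar>\<xi> * (LINT z:{a..b}|lborel. v z) - (b - a) * k\<bar> \<le> \<kappa> * (b - a)"
proof -
  have vi: "set_integrable lborel {a..b} v"
    by (rule locally_integrable_imp_set_integrable[OF assms(1)])
  have ci: "set_integrable lborel {a..b} (\<lambda>_. c::real)" for c
    by (intro borel_integrable_atLeastAtMost' continuous_on_const)
  have cv: "(LINT z:{a..b}|lborel. c) = c * (b - a)" for c :: real
    using assms(2) by (simp add: set_lebesgue_integral_def)
  have di: "set_integrable lborel {a..b} (\<lambda>z. \<xi> * v z - k)"
    by (intro set_integral_diff(1) ci set_integrable_mult_right vi)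
  have dv: "(LINT z:{a..b}|lborel. \<xi> * v z - k) = \<xi> * (LINT z:{a..b}|lborel. v z) - (b - a) * k"
    using set_integral_diff(2)[OF set_integrable_mult_right[of \<xi>, OF vi] ci[of k]] cv[of k]
    by (simp add: mult.commute)
  have "(LINT z:{a..b}|lborel. \<xi> * v z - k) \<le> (LINT z:{a..b}|lborel. \<kappa>)"
    using assms(3) by (intro set_integral_mono_AE di ci) (auto elim: eventually_mono)
  moreover have "(LINT z:{a..b}|lborel. - \<kappa>) \<le> (LINT z:{a..b}|lborel. \<xi> * v z - k)"
    using assms(3) by (intro set_integral_mono_AE di ci) (auto elim: eventually_mono)
  ultimately show ?thesis unfolding cv dv by (simp add: abs_le_iff)
qed

lemma continuous_on_lipschitz_real:
  fixes f :: "real \<Rightarrow> real"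
  assumes "\<And>x y. \<bar>f x - f y\<bar> \<le> L * \<bar>x - y\<bar>"
  shows "continuous_on A f"
proof -
  have "\<bar>f x - f y\<bar> \<le> \<bar>L\<bar> * \<bar>x - y\<bar>" for x y
    using assms[of x y] mult_right_mono[OF abs_ge_self[of L], of "\<bar>x - y\<bar>"] by auto
  then have "\<bar>L\<bar>-lipschitz_on A f" by (intro lipschitz_onI) (auto simp: dist_real_def)
  then show ?thesis by (rule lipschitz_on_continuous_on)
qed

text \<open>The point is that the error is uniform in \<open>x\<close>.
  Since \<open>ft\<close> is only defined almost everywhere, a Lipschitz difference quotient \<open>g\<close> of \<open>F\<close> takes its place.\<close>

lemma euler_step_along_characteristics:
  fixes f fx ft :: "real \<Rightarrow> real" and F :: "real \<Rightarrow> real \<Rightarrow> real"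
  assumes lip: "\<And>x y. \<bar>f x - f y\<bar> \<le> L * \<bar>x - y\<bar>" and L: "0 \<le> L" and bd: "\<And>x. \<bar>f x\<bar> \<le> B"
    and FTC: "\<And>x y. x \<le> y \<Longrightarrow> f y - f x = (LINT z:{x..y}|lborel. fx z)"
    and loc: "locally_integrable fx" and fxL: "AE z in lborel. \<bar>fx z\<bar> \<le> L"
    and sq: "integrable lborel (\<lambda>z. (fx z)\<^sup>2)"
    and eq: "AE x in lborel. ft x + f x * fx x = hs_source C fx x"
    and quot: "\<And>\<epsilon>. 0 < \<epsilon> \<Longrightarrow> \<exists>d>0. \<forall>h. 0 < h \<and> h < d \<longrightarrow> (AE x in lborel. \<bar>(F h x - f x) / h - ft x\<bar> \<le> \<epsilon>)"
    and dF: "0 < dF" and FL: "\<And>h x y. 0 < h \<Longrightarrow> h < dF \<Longrightarrow> \<bar>F h x - F h y\<bar> \<le> L * \<bar>x - y\<bar>"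
    and \<epsilon>: "0 < \<epsilon>"
  shows "\<exists>d>0. \<forall>h. 0 < h \<and> h < d \<longrightarrow> (\<forall>x. \<bar>F h (x + h * f x) - f x - h * hs_source C fx x\<bar> \<le> \<epsilon> * h)"
proof -
  define Q where "Q = hs_source C fx"
  have QL: "\<bar>Q y - Q x\<bar> \<le> L\<^sup>2 / 2 * \<bar>y - x\<bar>" for x y
    unfolding Q_def by (rule hs_source_lipschitz[OF sq fxL])
  have B: "0 \<le> B" using bd[of 0] by linarith
  \<comment> \<open>Five parts: 2e for replacing the quotient of F by g, e for moving g from x to y,
    2e for the increment of f along the segment.\<close>
  define e where "e = \<epsilon> / 5"
  have e: "0 < e" using \<epsilon> by (simp add: e_def)
  obtain d1 where d1: "0 < d1"
    "\<And>h. 0 < h \<Longrightarrow> h < d1 \<Longrightarrow> AE x in lborel. \<bar>(F h x - f x) / h - ft x\<bar> \<le> e"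
    using quot[OF e] by blast
  \<comment> \<open>A step size fixed in advance: the Lipschitz constant 2L/k of g depends on
    \<epsilon> through k but not on h, so h can be chosen small afterwards.\<close>
  define k where "k = min dF d1 / 2"
  have k: "0 < k" "k < dF" "k < d1" using dF d1(1) by (auto simp: k_def)
  define g where "g x = (F k x - f x) / k" for x
  define G where "G = 2 * L / k"
  have G: "0 \<le> G" using L k by (simp add: G_def)
  have gL: "\<bar>g x - g y\<bar> \<le> G * \<bar>x - y\<bar>" for x y
  proof -
    have "\<bar>g x - g y\<bar> = \<bar>(F k x - F k y) - (f x - f y)\<bar> / k"
      using k by (simp add: g_def diff_divide_distrib[symmetric] abs_divide algebra_simps)
    also have "\<dots> \<le> (L * \<bar>x - y\<bar> + L * \<bar>x - y\<bar>) / k"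
      using FL[of k x y] lip[of x y] k by (intro divide_right_mono) auto
    finally show ?thesis by (simp add: G_def)
  qed
  have gft: "AE x in lborel. \<bar>g x - ft x\<bar> \<le> e" unfolding g_def using k by (intro d1) auto
  have cf: "continuous_on UNIV f" by (rule continuous_on_lipschitz_real[OF lip])
  have cg: "continuous_on UNIV g" by (rule continuous_on_lipschitz_real[OF gL])
  have cQ: "continuous_on UNIV Q" by (rule continuous_on_lipschitz_real[OF QL])
  have Fg: "\<bar>F h x - f x - h * g x\<bar> \<le> 2 * e * h" if h: "0 < h" "h < dF" "h < d1" for h x
  proof -
    have "AE x in lborel. \<bar>F h x - f x - h * g x\<bar> \<le> 2 * e * h"
      using d1(2)[OF h(1,3)] gft
    proof eventually_elim
      case (elim x)
      then have "\<bar>(F h x - f x) / h - g x\<bar> \<le> 2 * e" by linarith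
      then have "\<bar>(F h x - f x) / h - g x\<bar> * h \<le> 2 * e * h" using h by (intro mult_right_mono) auto
      moreover have "\<bar>(F h x - f x) / h - g x\<bar> * h = \<bar>((F h x - f x) / h - g x) * h\<bar>"
        using h by (simp add: abs_mult)
      moreover have "((F h x - f x) / h - g x) * h = F h x - f x - h * g x"
        using h by (simp add: field_simps)
      ultimately show ?case by simp
    qed
    moreover have cF: "continuous_on UNIV (F h)"
      using FL[OF h(1,2)] by (rule continuous_on_lipschitz_real)
    moreover have "continuous_on UNIV (\<lambda>x. \<bar>F h x - f x - h * g x\<bar>)"
      by (intro continuous_intros cf cg cF)
    ultimately show ?thesis by (intro AE_le_imp_le[where g="\<lambda>_. 2 * e * h"] continuous_on_const)
  qed
  \<comment> \<open>Used where f x = 0: the segment from x to x + h f x is then a point, and nothing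
    can be averaged over it.\<close>
  have Qg: "\<bar>Q x - g x\<bar> \<le> e + L * \<bar>f x\<bar>" for x
  proof (rule AE_le_imp_le[of _ "\<lambda>x. e + L * \<bar>f x\<bar>"])
    show "AE x in lborel. \<bar>Q x - g x\<bar> \<le> e + L * \<bar>f x\<bar>"
      using gft eq fxL
    proof eventually_elim
      case (elim x)
      have "\<bar>f x * fx x\<bar> \<le> \<bar>f x\<bar> * L" unfolding abs_mult using elim(3) by (intro mult_left_mono) auto
      then show ?case using elim(1,2) by (simp add: Q_def mult.commute)
    qed
  qed (auto intro!: continuous_intros cf cg cQ)
  have step: "\<bar>f (x + h * f x) - f x - h * (Q x - g x)\<bar> \<le> (e + (h * B) * (2 * L\<^sup>2 + G)) * h"
    if h: "0 < h" for h x
  proof (cases "f x = 0")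
    case True
    have "h * \<bar>Q x - g x\<bar> \<le> h * e" using Qg[of x] True h by (intro mult_left_mono) auto
    also have "\<dots> \<le> (e + (h * B) * (2 * L\<^sup>2 + G)) * h"
      using h B G by (simp add: algebra_simps)
    finally show ?thesis using True h by (simp add: abs_mult)
  next
    case False
    define y where "y = x + h * f x"
    define c where "c = e + (h * B) * (2 * L\<^sup>2 + G)"
    have yx: "\<bar>y - x\<bar> \<le> h * B" using bd[of x] h by (simp add: y_def abs_mult)
    \<comment> \<open>At almost every z of the segment the equation expresses
      \<open>f z * fx z\<close> by the source and \<open>ft\<close>. Freezing f, the source and g at
      x costs Lipschitz errors of order h, and replacing \<open>ft\<close> by g costs e.\<close>
    have ae: "AE z in lborel. z \<in> {min x y..max x y} \<longrightarrow> \<bar>f x * fx z - (Q x - g x)\<bar> \<le> c"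
      using gft eq fxL
    proof eventually_elim
      case (elim z)
      show ?case
      proof
        assume "z \<in> {min x y..max x y}"
        then have zx: "\<bar>z - x\<bar> \<le> h * B" using yx by (auto simp: min_def max_def split: if_splits)
        have "\<bar>(f x - f z) * fx z\<bar> \<le> (L * \<bar>z - x\<bar>) * L"
          unfolding abs_mult using lip[of x z] elim(3) L
          by (intro mult_mono) (auto simp: abs_minus_commute)
        then have 1: "\<bar>(f x - f z) * fx z\<bar> \<le> L\<^sup>2 * \<bar>z - x\<bar>" by (simp add: power2_eq_square mult_ac)
        have "f x * fx z - (Q x - g x) = (f x - f z) * fx z + (Q z - Q x) + (g z - ft z) - (g z - g x)"
          using elim(2) by (simp add: Q_def algebra_simps)
        then have "\<bar>f x * fx z - (Q x - g x)\<bar> \<le> L\<^sup>2 * \<bar>z - x\<bar> + L\<^sup>2 / 2 * \<bar>z - x\<bar> + e + G * \<bar>z - x\<bar>"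
          using 1 QL[of z x] gL[of z x] elim(1) by linarith
        also have "\<dots> \<le> e + \<bar>z - x\<bar> * (2 * L\<^sup>2 + G)" by (simp add: algebra_simps)
        also have "\<dots> \<le> c" unfolding c_def using zx G by (intro add_left_mono mult_right_mono) auto
        finally show "\<bar>f x * fx z - (Q x - g x)\<bar> \<le> c" .
      qed
    qed
    \<comment> \<open>The sign of f x decides on which side of x the point y lies, hence the minimum
      and the maximum.\<close>
    have "\<bar>f x * (LINT z:{min x y..max x y}|lborel. fx z) - (max x y - min x y) * (Q x - g x)\<bar>
        \<le> c * (max x y - min x y)"
      by (rule set_integral_AE_near_const[OF loc _ ae]) auto
    then have main: "\<bar>f x * (f (max x y) - f (min x y)) - (max x y - min x y) * (Q x - g x)\<bar>
        \<le> c * (max x y - min x y)" by (subst FTC) (auto simp: min_def)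
    have neg: "f x * (f x - f y) - (x - y) * (Q x - g x) = - (f x * (f y - f x) - (y - x) * (Q x - g x))"
      by (simp add: algebra_simps)
    have "\<bar>f x * (f y - f x) - (y - x) * (Q x - g x)\<bar> \<le> c * \<bar>y - x\<bar>"
    proof (cases "x \<le> y")
      case True
      then have "max x y = y" "min x y = x" "\<bar>y - x\<bar> = y - x" by auto
      with main show ?thesis by metis
    next
      case False
      then have "max x y = x" "min x y = y" "\<bar>y - x\<bar> = x - y" by auto
      with main neg show ?thesis by (metis abs_minus_cancel)
    qed
    \<comment> \<open>A factor f x now occurs on both sides and can be divided out.\<close>
    also have "y - x = f x * h" by (simp add: y_def)
    finally have "\<bar>f x * (f y - f x - h * (Q x - g x))\<bar> \<le> c * \<bar>f x * h\<bar>"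
      by (simp add: algebra_simps)
    then have "\<bar>f x\<bar> * \<bar>f y - f x - h * (Q x - g x)\<bar> \<le> \<bar>f x\<bar> * (c * h)"
      using h by (simp add: abs_mult mult_ac)
    then show ?thesis using False by (simp add: y_def c_def)
  qed
  define K where "K = B * (2 * L\<^sup>2 + G)"
  have K: "0 \<le> K" using B G by (simp add: K_def)
  \<comment> \<open>Makes both h K and h B G at most e; the summand 1 keeps the denominator
    positive.\<close>
  define d where "d = min (min dF d1) (e / (K + B * G + 1))"
  have KBG: "0 \<le> B * G" using B G by simp
  have "0 < d" using dF d1(1) e K KBG by (auto simp: d_def)
  moreover have "\<bar>F h (x + h * f x) - f x - h * Q x\<bar> \<le> \<epsilon> * h" if h: "0 < h" "h < d" for h x
  proof -
    define y where "y = x + h * f x"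
    have "h < e / (K + B * G + 1)" using h by (simp add: d_def)
    then have "h * (K + B * G + 1) < e" using K KBG by (simp add: pos_less_divide_eq)
    then have "h * K + h * (B * G) + h < e" by (simp add: algebra_simps)
    moreover have "0 \<le> h * K" "0 \<le> h * (B * G)" using h K KBG by auto
    ultimately have small: "h * K \<le> e" "h * (B * G) \<le> e" using h(1) by linarith+
    have 1: "\<bar>F h y - f y - h * g y\<bar> \<le> 2 * e * h" using h by (intro Fg) (auto simp: d_def)
    have "\<bar>g y - g x\<bar> \<le> G * (h * B)"
      using gL[of y x] bd[of x] h(1) G
      by (intro order_trans[OF gL] mult_left_mono) (auto simp: y_def abs_mult)
    then have "\<bar>g y - g x\<bar> \<le> e" using small(2) by (simp add: mult_ac)
    then have "h * \<bar>g y - g x\<bar> \<le> h * e" using h(1) by (intro mult_left_mono) auto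
    then have 2: "\<bar>h * (g y - g x)\<bar> \<le> e * h" using h(1) by (simp add: abs_mult mult.commute)
    have "(e + (h * B) * (2 * L\<^sup>2 + G)) * h \<le> (e + e) * h"
      using small(1) h(1) by (intro mult_right_mono add_left_mono) (auto simp: K_def mult_ac)
    with step[OF h(1), of x] have 3: "\<bar>f y - f x - h * (Q x - g x)\<bar> \<le> 2 * e * h" by (simp add: y_def)
    have "F h y - f x - h * Q x = (F h y - f y - h * g y) + h * (g y - g x) + (f y - f x - h * (Q x - g x))"
      by (simp add: algebra_simps)
    then have "\<bar>F h y - f x - h * Q x\<bar> \<le> 2 * e * h + e * h + 2 * e * h" using 1 2 3 by linarith
    also have "\<dots> = \<epsilon> * h" by (simp add: e_def)
    finally show ?thesis by (simp add: y_def)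
  qed
  ultimately show ?thesis by (auto simp: Q_def)
qed

text \<open>Increments of f are the interval integrals of \<open>fx\<close>, so a Lipschitz constant
  bounds these integrals for \<open>fx\<close> and for its negative.\<close>

lemma AE_bounded_if_FTC:
  fixes f fx :: "real \<Rightarrow> real"
  assumes loc: "locally_integrable fx"
    and FTC: "\<And>x y. x \<le> y \<Longrightarrow> f y - f x = (LINT z:{x..y}|lborel. fx z)"
    and lip: "\<And>x y. \<bar>f x - f y\<bar> \<le> L * \<bar>x - y\<bar>"
  shows "AE z in lborel. \<bar>fx z\<bar> \<le> L"
proof -
  have 1: "AE z in lborel. fx z \<le> L"
  proof (rule AE_le_if_interval_integrals_le[OF loc])
    fix x y :: real assume xy: "x \<le> y"
    show "(LINT z:{x..y}|lborel. fx z) \<le> L * (y - x)"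
      using FTC[OF xy] lip[of y x] xy by simp
  qed
  have loc': "locally_integrable (\<lambda>z. - fx z)"
    using loc by (auto simp: locally_integrable_def set_integrable_def)
  have 2: "AE z in lborel. - fx z \<le> L"
  proof (rule AE_le_if_interval_integrals_le[OF loc'])
    fix x y :: real assume xy: "x \<le> y"
    have "(LINT z:{x..y}|lborel. - fx z) = - (f y - f x)"
      unfolding FTC[OF xy] by (simp add: set_lebesgue_integral_def)
    then show "(LINT z:{x..y}|lborel. - fx z) \<le> L * (y - x)"
      using lip[of y x] xy by simp
  qed
  from 1 2 show ?thesis by eventually_elim auto
qed

lemma AE_nonneg_if_FTC_mono:
  fixes f fx :: "real \<Rightarrow> real"
  assumes loc: "locally_integrable fx"
    and FTC: "\<And>x y. x \<le> y \<Longrightarrow> f y - f x = (LINT z:{x..y}|lborel. fx z)"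
    and mono: "\<And>x y. x \<le> y \<Longrightarrow> f x \<le> f y"
  shows "AE z in lborel. 0 \<le> fx z"
  using loc by (intro AE_nonneg_if_interval_integrals_nonneg)
    (auto simp: locally_integrable_def FTC[symmetric] mono)

lemma AE_zero_if_FTC_const:
  fixes f fx :: "real \<Rightarrow> real"
  assumes "locally_integrable fx"
    and "\<And>x y. x \<le> y \<Longrightarrow> f y - f x = (LINT z:{x..y}|lborel. fx z)"
    and "\<And>x y. f x = f y"
  shows "AE z in lborel. fx z = 0"
proof -
  have "AE z in lborel. \<bar>fx z\<bar> \<le> 0"
    by (rule AE_bounded_if_FTC[OF assms(1,2)]) (use assms(3) in auto)
  then show ?thesis by eventually_elim simp
qed

text \<open>x + h f x is continuous and differs from x by at most h B, so it takes every value: each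
  point at time t + h is the end of a segment that starts at time t.\<close>

lemma characteristic_preimage:
  fixes f :: "real \<Rightarrow> real"
  assumes lip: "\<And>x y. \<bar>f x - f y\<bar> \<le> L * \<bar>x - y\<bar>" and bd: "\<And>x. \<bar>f x\<bar> \<le> B" and h: "0 < h"
  obtains x where "x + h * f x = y"
proof -
  have cf: "continuous_on A (\<lambda>x. x + h * f x)" for A
    by (intro continuous_intros continuous_on_lipschitz_real[OF lip])
  have B: "- B \<le> f z" "f z \<le> B" for z using bd[of z] by auto
  have "\<exists>x\<ge>y - h * B. x \<le> y + h * B \<and> x + h * f x = y"
  proof (rule IVT')
    show "y - h * B + h * f (y - h * B) \<le> y" using B(2) h by (simp add: mult_left_mono)
    have "h * (- B) \<le> h * f (y + h * B)" using B(1) h by (intro mult_left_mono) auto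
    then show "y \<le> y + h * B + h * f (y + h * B)" by simp
    have "0 \<le> B" using bd[of 0] by linarith
    then have "0 \<le> h * B" using h by simp
    then show "y - h * B \<le> y + h * B" by simp
  qed (rule cf)
  then show ?thesis using that by blast
qed

text \<open>For h L < 1 the segments do not cross, so an ordered pair of end points comes from an
  ordered pair of starting points, to which source inequalities for x \<le> y apply.\<close>

lemma characteristic_mono:
  fixes f :: "real \<Rightarrow> real"
  assumes lip: "\<And>x y. \<bar>f x - f y\<bar> \<le> L * \<bar>x - y\<bar>" and h: "0 < h" "h * L < 1"
    and le: "x + h * f x \<le> y + h * f y"
  shows "x \<le> y"
proof (rule ccontr)
  assume "\<not> x \<le> y"
  then have yx: "0 < x - y" by simp
  have "f y - f x \<le> L * (x - y)" using lip[of y x] yx by (simp add: abs_minus_commute)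
  then have "h * (f y - f x) \<le> h * (L * (x - y))" using h by (intro mult_left_mono) auto
  also have "\<dots> < 1 * (x - y)" unfolding mult.assoc[symmetric] using h yx by (intro mult_strict_right_mono) auto
  finally show False using le by (simp add: algebra_simps)
qed

text \<open>\<open>w\<close>, \<open>wt\<close> and \<open>wx\<close> are kept abstract because the
  lemma serves both directions of time. Applications of one transport inequality show in turn that w
  is nondecreasing in x, nonincreasing in x, and zero.\<close>

lemma zero_data_imp_zero:
  fixes w wt wx :: "real \<Rightarrow> real \<Rightarrow> real"
  assumes L: "0 < L"
    and lip: "\<And>t x y. t \<in> {0..\<tau>} \<Longrightarrow> \<bar>w t x - w t y\<bar> \<le> L * \<bar>x - y\<bar>"
    and bd: "\<And>t. t \<in> {0..\<tau>} \<Longrightarrow> \<exists>B. \<forall>x. \<bar>w t x\<bar> \<le> B"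
    and cont: "\<And>x. continuous_on {0..\<tau>} (\<lambda>t. w t x)"
    and FTC: "\<And>t x y. t \<in> {0..\<tau>} \<Longrightarrow> x \<le> y \<Longrightarrow> w t y - w t x = (LINT z:{x..y}|lborel. wx t z)"
    and loc: "\<And>t. t \<in> {0..\<tau>} \<Longrightarrow> locally_integrable (wx t)"
    and sq: "\<And>t. t \<in> {0..\<tau>} \<Longrightarrow> integrable lborel (\<lambda>z. (wx t z)\<^sup>2)"
    and eq: "\<And>t. t \<in> {0..\<tau>} \<Longrightarrow> AE x in lborel. wt t x + w t x * wx t x = hs_source C (wx t) x"
    and quot: "\<And>t e. 0 \<le> t \<Longrightarrow> t < \<tau> \<Longrightarrow> 0 < e \<Longrightarrow>
        \<exists>d>0. \<forall>h. 0 < h \<and> h < d \<longrightarrow> (AE x in lborel. \<bar>(w (t + h) x - w t x) / h - wt t x\<bar> \<le> e)"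
    and init: "\<And>x. w 0 x = 0"
    and t: "t \<in> {0..\<tau>}"
  shows "w t x = 0"
proof -
  let ?Q = "\<lambda>t. hs_source C (wx t)"
  have fxL: "AE z in lborel. \<bar>wx t z\<bar> \<le> L" if "t \<in> {0..\<tau>}" for t
    by (rule AE_bounded_if_FTC[OF loc[OF that], where f="w t"]) (simp_all add: FTC[OF that] lip[OF that])
  \<comment> \<open>The Euler step seen from the end time: every y has a starting point with error
    at most e h, and the order of end points is that of the starting points.\<close>
  define euler where "euler t e h \<longleftrightarrow>
      (\<forall>y. \<exists>x. x + h * w t x = y \<and> \<bar>w (t + h) y - w t x - h * ?Q t x\<bar> \<le> e * h) \<and>
      (\<forall>x y. x + h * w t x \<le> y + h * w t y \<longrightarrow> x \<le> y)" for t e h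
  have step: "\<exists>d>0. \<forall>h. 0 < h \<and> h < d \<longrightarrow> euler t e h"
    if t: "0 \<le> t" "t < \<tau>" and e: "0 < e" for t e
  proof -
    have t': "t \<in> {0..\<tau>}" using t by auto
    obtain B where B: "\<And>x. \<bar>w t x\<bar> \<le> B" using bd[OF t'] by blast
    have FL: "\<bar>w (t + h) x - w (t + h) y\<bar> \<le> L * \<bar>x - y\<bar>" if "0 < h" "h < \<tau> - t" for h x y
      using that t by (intro lip) auto
    have "\<exists>d>0. \<forall>h. 0 < h \<and> h < d \<longrightarrow>
        (\<forall>x. \<bar>w (t + h) (x + h * w t x) - w t x - h * ?Q t x\<bar> \<le> e * h)"
    proof (rule euler_step_along_characteristics[where F="\<lambda>h. w (t + h)" and dF="\<tau> - t" and L=L and B=B])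
      show "\<bar>w t x\<bar> \<le> B" for x by (rule B)
      show "AE x in lborel. wt t x + w t x * wx t x = ?Q t x" by (rule eq[OF t'])
    qed (use L t e in \<open>simp_all add: lip[OF t'] FTC[OF t'] loc[OF t'] fxL[OF t'] sq[OF t'] quot[OF t] FL\<close>)
    then obtain d where d: "0 < d" "\<And>h x. 0 < h \<Longrightarrow> h < d \<Longrightarrow>
        \<bar>w (t + h) (x + h * w t x) - w t x - h * ?Q t x\<bar> \<le> e * h"
      by blast
    have P1: "\<exists>x. x + h * w t x = y \<and> \<bar>w (t + h) y - w t x - h * ?Q t x\<bar> \<le> e * h"
      if "0 < h" "h < d" for h y
    proof -
      obtain x where "x + h * w t x = y"
        by (rule characteristic_preimage[where f="w t", OF lip[OF t'] B \<open>0 < h\<close>])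
      with d(2)[OF that, of x] show ?thesis by auto
    qed
    have P2: "x \<le> y" if "0 < h" "h < 1 / L" "x + h * w t x \<le> y + h * w t y" for h x y
      using that L by (intro characteristic_mono[OF lip[OF t'], of h x y]) (auto simp: field_simps)
    show ?thesis unfolding euler_def
    proof (rule exI[of _ "min d (1 / L)"], intro conjI allI impI)
      show "0 < min d (1 / L)" using d(1) L by simp
    next
      fix h y assume "0 < h \<and> h < min d (1 / L)"
      then show "\<exists>x. x + h * w t x = y \<and> \<bar>w (t + h) y - w t x - h * ?Q t x\<bar> \<le> e * h"
        by (intro P1) auto
    next
      fix h x y assume "0 < h \<and> h < min d (1 / L)" "x + h * w t x \<le> y + h * w t y"
      then show "x \<le> y" by (intro P2[of h x y]) auto
    qed
  qed
  \<comment> \<open>The barrier argument for all pairs x \<le> y simultaneously. If the combination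
    of the source with weights \<alpha> and \<beta> is at most c times that of w, the latter, being
    zero at time 0, stays nonpositive.\<close>
  have transport: "\<alpha> * w t x + \<beta> * w t y \<le> 0"
    if ab: "\<bar>\<alpha>\<bar> \<le> 1" "\<bar>\<beta>\<bar> \<le> 1" and sum0: "\<And>t x y. t \<in> {0..\<tau>} \<Longrightarrow> x \<le> y \<Longrightarrow>
        \<alpha> * ?Q t x + \<beta> * ?Q t y \<le> c * (\<alpha> * w t x + \<beta> * w t y)"
      and c: "0 \<le> c" and t: "t \<in> {0..\<tau>}" and xy: "x \<le> y" for \<alpha> \<beta> c t x y
  proof -
    have "(\<lambda>p t. \<alpha> * w t (fst p) + \<beta> * w t (snd p)) (x, y) t \<le> 0"
    proof (rule barrier_bound[where f="\<lambda>p t. \<alpha> * w t (fst p) + \<beta> * w t (snd p)" and c=c and \<tau>=\<tau> and I="{p. fst p \<le> snd p}"])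
      fix t E e :: real
      assume t: "0 \<le> t" "t < \<tau>" and E: "\<forall>p\<in>{p. fst p \<le> snd p}. \<alpha> * w t (fst p) + \<beta> * w t (snd p) \<le> E" and e: "0 < e"
      \<comment> \<open>Half of the slack for each of the two points, whose weights are at most 1 in
        modulus.\<close>
      obtain d where d: "0 < d" and eu: "\<And>h. 0 < h \<Longrightarrow> h < d \<Longrightarrow> euler t (e/2) h"
        using step[OF t half_gt_zero[OF e]] by blast
      have "\<alpha> * w (t + h) x' + \<beta> * w (t + h) y' \<le> E + c * h * E + e * h"
        if h: "0 < h" "h < d" and le: "x' \<le> y'" for h x' y'
      proof -
        obtain x y where x: "x + h * w t x = x'" "\<bar>w (t + h) x' - w t x - h * ?Q t x\<bar> \<le> e/2 * h"
          and y: "y + h * w t y = y'" "\<bar>w (t + h) y' - w t y - h * ?Q t y\<bar> \<le> e/2 * h"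
          using eu[OF h] unfolding euler_def by meson
        have xy: "x \<le> y" using eu[OF h] x(1) y(1) le unfolding euler_def by metis
        have wE: "\<alpha> * w t x + \<beta> * w t y \<le> E" using E xy by force
        have scaled: "\<gamma> * v \<le> e/2 * h" if "\<bar>\<gamma>\<bar> \<le> 1" "\<bar>v\<bar> \<le> e/2 * h" for \<gamma> v
          using mult_mono[OF that] by (simp add: abs_mult[symmetric] abs_le_iff)
        have "\<alpha> * ?Q t x + \<beta> * ?Q t y \<le> c * E"
          using t xy c by (intro order_trans[OF sum0] mult_left_mono wE) auto
        then have "h * (\<alpha> * ?Q t x + \<beta> * ?Q t y) \<le> h * (c * E)"
          using h by (intro mult_left_mono) auto
        with scaled[OF ab(1) x(2)] scaled[OF ab(2) y(2)] wE show ?thesis by (simp add: algebra_simps)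
      qed
      then show "\<exists>d>0. \<forall>h. 0 < h \<and> h < d \<longrightarrow>
          (\<forall>p\<in>{p. fst p \<le> snd p}. \<alpha> * w (t + h) (fst p) + \<beta> * w (t + h) (snd p) \<le> E + c * h * E + e * h)"
        using d by auto
    qed (use t xy init in \<open>auto intro!: continuous_intros cont\<close>)
    then show ?thesis by simp
  qed
  \<comment> \<open>Weights 1 and -1 with c = 0: here the monotonicity of the source enters.\<close>
  have mono: "w t x \<le> w t y" if t: "t \<in> {0..\<tau>}" and xy: "x \<le> y" for t x y
    using transport[of 1 "-1" 0, OF _ _ _ _ t xy] hs_source_mono[OF sq] by simp
  have le: "w t y \<le> w t x" if t: "t \<in> {0..\<tau>}" and xy: "x \<le> y" for t x y
  proof -
    \<comment> \<open>From 0 \<le> \<open>wx\<close> \<le> L, almost everywhere, the square of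
      \<open>wx\<close> is at most L times \<open>wx\<close>. The quadratic source is thus
      controlled linearly, and the weights -1 and 1 work with c = L/2.\<close>
    have "?Q t y - ?Q t x \<le> L / 2 * (w t y - w t x)"
      if t': "t \<in> {0..\<tau>}" and xy: "x \<le> y" for t x y
    proof -
      have int: "set_integrable lborel {x..y} (wx t)"
        by (rule locally_integrable_imp_set_integrable[OF loc[OF t']])
      have wxnn: "AE z in lborel. 0 \<le> wx t z"
        by (rule AE_nonneg_if_FTC_mono[OF loc[OF t'], where f="w t"]) (simp_all add: FTC[OF t'] mono[OF t'])
      have "?Q t y - ?Q t x = (LINT z:{x<..y}|lborel. 1/2 * (wx t z)\<^sup>2)"
        by (rule hs_source_diff[OF sq[OF t'] xy])
      also have "\<dots> \<le> (LINT z:{x<..y}|lborel. L / 2 * wx t z)"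
      proof (rule set_integral_mono_AE)
        show "set_integrable lborel {x<..y} (\<lambda>z. 1/2 * (wx t z)\<^sup>2)"
          using sq[OF t'] by (intro set_integrable_mult_right integrable_imp_set_integrable) auto
        show "set_integrable lborel {x<..y} (\<lambda>z. L / 2 * wx t z)"
          by (intro set_integrable_mult_right set_integrable_subset[OF int]) auto
        show "AE z in lborel. z \<in> {x<..y} \<longrightarrow> 1/2 * (wx t z)\<^sup>2 \<le> L / 2 * wx t z"
          using fxL[OF t'] wxnn
        proof eventually_elim
          case (elim z)
          then have "wx t z * wx t z \<le> L * wx t z" by (intro mult_right_mono) auto
          then show ?case by (simp add: power2_eq_square)
        qed
      qed
      also have "\<dots> = (LINT z:{x..y}|lborel. L / 2 * wx t z)"
        using loc[OF t']
        by (intro set_integral_cong_set)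
          (auto simp: set_borel_measurable_def locally_integrable_def intro!: AE_I'[of "{x}"])
      also have "\<dots> = L / 2 * (w t y - w t x)" by (simp add: FTC[OF t' xy])
      finally show ?thesis .
    qed
    then show ?thesis using transport[of "-1" 1 "L/2", OF _ _ _ _ t xy] L by (simp add: algebra_simps)
  qed
  have const: "w t x = w t y" if "t \<in> {0..\<tau>}" for t x y
    using mono[OF that, of x y] le[OF that, of x y] mono[OF that, of y x] le[OF that, of y x]
    by (cases "x \<le> y") auto
  have Q0: "?Q t x = 0" if t: "t \<in> {0..\<tau>}" for t x
  proof -
    have ae: "AE z in lborel. wx t z = 0" 
      by (rule AE_zero_if_FTC_const[OF loc[OF t], where f="w t"]) (simp_all add: FTC[OF t] const[OF t])
    have "(LINT z:{..x}|lborel. 1/2 * (wx t z)\<^sup>2) = 0"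
      unfolding set_lebesgue_integral_def using ae
      by (intro integral_eq_zero_AE) (auto elim: eventually_mono)
    moreover have "(LINT z|lborel. (wx t z)\<^sup>2) = 0"
      using ae by (intro integral_eq_zero_AE) (auto elim: eventually_mono)
    ultimately show ?thesis by (simp add: hs_source_def)
  qed
  \<comment> \<open>Both signs of a single weight, the other weight being 0: the source is now zero,
    so w keeps its initial value.\<close>
  show ?thesis
    using transport[of 1 0 0, OF _ _ _ _ t order_refl] transport[of "-1" 0 0, OF _ _ _ _ t order_refl] Q0
    by (simp add: eq_iff)
qed

section \<open>The Littlewood--Paley kernels\<close>

lemma integrable_inverse_one_plus_square: "integrable lborel (\<lambda>x::real. M / (1 + x\<^sup>2))"
proof -
  have "integrable lborel (\<lambda>x::real. inverse (1 + x\<^sup>2))"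
    using integrable_inverse_1_plus_square by (simp add: set_integrable_def einterval_def)
  from integrable_mult_right[OF this, of M] show ?thesis by (simp add: field_simps)
qed

lemma integrable_if_quadratic_decay:
  fixes f :: "real \<Rightarrow> real"
  assumes "f \<in> borel_measurable borel" "\<And>x. \<bar>f x\<bar> \<le> M / (1 + x\<^sup>2)"
  shows "integrable lborel f"
  by (rule Bochner_Integration.integrable_bound[OF integrable_inverse_one_plus_square[of M]])
     (use assms in \<open>auto intro!: AE_I2 order_trans[OF assms(2) abs_ge_self] simp del: abs_divide\<close>)

text \<open>Absolute integrability on the product is reduced to an integrable bound \<open>b\<close>
  for the inner integrals of the modulus. In the applications \<open>b\<close> is an integrable
  weight times a constant.\<close>

lemma lborel_Fubini_swap:
  fixes F :: "real \<Rightarrow> real \<Rightarrow> real"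
  assumes m[measurable]: "case_prod F \<in> borel_measurable (borel \<Otimes>\<^sub>M borel)"
    and b: "integrable lborel b" and iy: "\<And>x. integrable lborel (F x)"
    and le: "\<And>x. (\<integral>y. \<bar>F x y\<bar> \<partial>lborel) \<le> b x"
  shows "(\<integral>y. \<integral>x. F x y \<partial>lborel \<partial>lborel) = (\<integral>x. \<integral>y. F x y \<partial>lborel \<partial>lborel)"
proof (rule lborel_pair.Fubini_integral)
  have [measurable]: "case_prod F \<in> borel_measurable (lborel \<Otimes>\<^sub>M lborel)" by simp
  show "integrable (lborel \<Otimes>\<^sub>M lborel) (case_prod F)"
  proof (rule lborel_pair.Fubini_integrable)
    show "integrable lborel (\<lambda>x. \<integral>y. norm (case_prod F (x, y)) \<partial>lborel)"
    proof (rule Bochner_Integration.integrable_bound[OF b])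
      show "(\<lambda>x. \<integral>y. norm (case_prod F (x, y)) \<partial>lborel) \<in> borel_measurable lborel" by measurable
      show "AE x in lborel. norm (\<integral>y. norm (case_prod F (x, y)) \<partial>lborel) \<le> norm (b x)"
        using le by (intro AE_I2) (auto simp: integral_nonneg_AE intro: order_trans[OF _ abs_ge_self])
    qed
  qed (use iy in auto)
qed

lemma integral_odd_zero:
  fixes f :: "real \<Rightarrow> real"
  assumes "\<And>x. f (- x) = - f x"
  shows "(\<integral>x. f x \<partial>lborel) = 0"
  using lborel_integral_real_affine[of "-1" f 0] assms by simp

text \<open>The function \<open>x\<^sup>2 cos(x\<xi>+\<theta>) g + cos(x\<xi>+\<theta>) g''\<close> is a total derivative in \<open>\<xi>\<close>.\<close>

lemma oscillatory_integral_decay: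
  fixes g g' g'' :: "real \<Rightarrow> real"
  assumes d1: "\<And>\<xi>. (g has_real_derivative g' \<xi>) (at \<xi>)" and d2: "\<And>\<xi>. (g' has_real_derivative g'' \<xi>) (at \<xi>)"
    and c: "continuous_on UNIV g''" and z: "g R = 0" "g (- R) = 0" "g' R = 0" "g' (- R) = 0" and R: "0 \<le> R"
  shows "\<exists>A. \<forall>x. \<bar>integral {-R..R} (\<lambda>\<xi>. cos (x * \<xi> + \<theta>) * g \<xi>)\<bar> \<le> A / (1 + x\<^sup>2)"
proof (intro exI allI)
  fix x :: real
  have cg: "continuous_on S g" for S using d1 by (meson DERIV_isCont continuous_at_imp_continuous_on)
  have cg'': "continuous_on S g''" for S using c by (rule continuous_on_subset) auto
  define T where "T \<xi> = cos (x * \<xi> + \<theta>)" for \<xi>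
  have cT: "continuous_on S T" for S unfolding T_def by (intro continuous_intros)
  have "((\<lambda>\<xi>. x\<^sup>2 * (T \<xi> * g \<xi>) + T \<xi> * g'' \<xi>) has_integral
     (x * sin (x * R + \<theta>) * g R + cos (x * R + \<theta>) * g' R) - (x * sin (x * (-R) + \<theta>) * g (-R) + cos (x * (-R) + \<theta>) * g' (-R))) {-R..R}"
  proof (rule fundamental_theorem_of_calculus)
    show "((\<lambda>\<xi>. x * sin (x * \<xi> + \<theta>) * g \<xi> + cos (x * \<xi> + \<theta>) * g' \<xi>) has_vector_derivative
        x\<^sup>2 * (T \<xi> * g \<xi>) + T \<xi> * g'' \<xi>) (at \<xi> within {-R..R})" for \<xi>
      unfolding has_real_derivative_iff_has_vector_derivative[symmetric] T_def
      by (rule has_field_derivative_at_within)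
         (auto intro!: derivative_eq_intros d1 d2 simp: algebra_simps power2_eq_square)
  qed (use R in simp)
  then have 1: "((\<lambda>\<xi>. x\<^sup>2 * (T \<xi> * g \<xi>) + T \<xi> * g'' \<xi>) has_integral 0) {-R..R}" by (simp add: z)
  have i1: "(\<lambda>\<xi>. T \<xi> * g \<xi>) integrable_on {-R..R}" and i2: "(\<lambda>\<xi>. T \<xi> * g'' \<xi>) integrable_on {-R..R}"
    by (intro integrable_continuous_real continuous_intros cT cg cg'')+
  have "x\<^sup>2 * integral {-R..R} (\<lambda>\<xi>. T \<xi> * g \<xi>) + integral {-R..R} (\<lambda>\<xi>. T \<xi> * g'' \<xi>) = 0"
    using has_integral_unique[OF 1 has_integral_add[OF has_integral_mult_right[OF integrable_integral[OF i1]] integrable_integral[OF i2]]]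
    by simp
  \<comment> \<open>Adding the integral itself turns the factor x^2 into 1 + x^2, so that the bound
    is also good near x = 0.\<close>
  then have "(1 + x\<^sup>2) * integral {-R..R} (\<lambda>\<xi>. T \<xi> * g \<xi>)
      = integral {-R..R} (\<lambda>\<xi>. T \<xi> * g \<xi>) - integral {-R..R} (\<lambda>\<xi>. T \<xi> * g'' \<xi>)"
    by (simp add: algebra_simps)
  also have "\<bar>\<dots>\<bar> \<le> integral {-R..R} (\<lambda>\<xi>. \<bar>g \<xi>\<bar>) + integral {-R..R} (\<lambda>\<xi>. \<bar>g'' \<xi>\<bar>)"
  proof -
    have "\<bar>integral {-R..R} (\<lambda>\<xi>. T \<xi> * h \<xi>)\<bar> \<le> integral {-R..R} (\<lambda>\<xi>. \<bar>h \<xi>\<bar>)"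
      if ch: "continuous_on {-R..R} h" for h
    proof -
      have "norm (integral {-R..R} (\<lambda>\<xi>. T \<xi> * h \<xi>)) \<le> integral {-R..R} (\<lambda>\<xi>. \<bar>h \<xi>\<bar>)"
      proof (rule integral_norm_bound_integral)
        show "norm (T \<xi> * h \<xi>) \<le> \<bar>h \<xi>\<bar>" for \<xi>
          by (simp add: T_def abs_mult mult_left_le_one_le)
      qed (intro integrable_continuous_real continuous_intros cT ch)+
      then show ?thesis by simp
    qed
    from this[OF cg] this[OF cg''] show ?thesis by linarith
  qed
  finally show "\<bar>integral {-R..R} (\<lambda>\<xi>. cos (x * \<xi> + \<theta>) * g \<xi>)\<bar>
      \<le> (integral {-R..R} (\<lambda>\<xi>. \<bar>g \<xi>\<bar>) + integral {-R..R} (\<lambda>\<xi>. \<bar>g'' \<xi>\<bar>)) / (1 + x\<^sup>2)"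
  proof -
    assume *: "\<bar>(1 + x\<^sup>2) * integral {-R..R} (\<lambda>\<xi>. T \<xi> * g \<xi>)\<bar>
      \<le> integral {-R..R} (\<lambda>\<xi>. \<bar>g \<xi>\<bar>) + integral {-R..R} (\<lambda>\<xi>. \<bar>g'' \<xi>\<bar>)"
    have "0 < 1 + x\<^sup>2" by (simp add: add_pos_nonneg)
    with * show ?thesis by (simp add: abs_mult pos_le_divide_eq T_def mult.commute)
  qed
qed

section \<open>Cosine transforms and Fourier inversion\<close>

definition cos_kernel :: "(real \<Rightarrow> real) \<Rightarrow> real \<Rightarrow> real" where
  "cos_kernel g x = (\<integral>\<xi>. cos (x * \<xi>) * g \<xi> \<partial>lborel) / (2 * pi)"

text \<open>For even g, such as \<phi> and \<open>lowpass \<phi>\<close>, the inverse transform is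
  real and \<open>cos_kernel\<close> is all of it. The kernel estimates can then be made with real
  integrals.\<close>

lemma Re_inverse_fourier:
  assumes "integrable lborel g"
  shows "Re (inverse_fourier g x) = cos_kernel g x"
proof -
  have gm[measurable]: "g \<in> borel_measurable borel" using borel_measurable_integrable[OF assms] by simp
  have "integrable lborel (\<lambda>\<xi>. cis (x * \<xi>) * complex_of_real (g \<xi>))"
  proof (rule Bochner_Integration.integrable_bound[OF assms])
    show "(\<lambda>\<xi>. cis (x * \<xi>) * complex_of_real (g \<xi>)) \<in> borel_measurable lborel"
      unfolding cis_conv_exp by measurable
  qed (simp add: norm_mult)
  then have "Re (\<integral>\<xi>. cis (x * \<xi>) * complex_of_real (g \<xi>) \<partial>lborel) = (\<integral>\<xi>. cos (x * \<xi>) * g \<xi> \<partial>lborel)"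
    by (subst integral_Re[symmetric]) auto
  moreover have "inverse_fourier g x = complex_of_real (1 / (2 * pi)) * (\<integral>\<xi>. cis (x * \<xi>) * complex_of_real (g \<xi>) \<partial>lborel)"
    by (simp add: inverse_fourier_def)
  ultimately show ?thesis by (simp add: cos_kernel_def del: of_real_divide of_real_mult)
qed

lemma cos_kernel_dilate:
  assumes "0 < a"
  shows "cos_kernel (\<lambda>\<xi>. g (\<xi> / a)) x = a * cos_kernel g (a * x)"
  unfolding cos_kernel_def
  by (subst lborel_integral_real_affine[where c=a and t=0]) (use assms in \<open>auto simp: mult_ac\<close>)

text \<open>The real part of the characteristic function of the normal distribution. A Gaussian is
  its own transform up to scaling, which makes it a convenient weight for inversion.\<close>

lemma integral_cos_std_normal:
  "(\<integral>x. cos (a * x) * std_normal_density x \<partial>lborel) = exp (- (a\<^sup>2) / 2)"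
proof -
  interpret real_distribution std_normal_distribution by (rule real_dist_normal_dist)
  have int: "integrable std_normal_distribution (\<lambda>x. iexp (a * x))"
    by (rule integrable_const_bound[where B=1]) auto
  have "exp (- (a\<^sup>2) / 2) = Re (char std_normal_distribution a)"
    unfolding char_std_normal_distribution by (metis Re_complex_of_real)
  also have "\<dots> = (\<integral>x. Re (iexp (a * x)) \<partial>std_normal_distribution)"
    unfolding char_def by (rule integral_Re[symmetric, OF int])
  also have "\<dots> = (\<integral>x. cos (a * x) \<partial>std_normal_distribution)" by (simp add: Re_exp)
  also have "\<dots> = (\<integral>x. std_normal_density x *\<^sub>R cos (a * x) \<partial>lborel)"
    by (rule integral_density) (auto intro!: AE_I2 normal_density_nonneg)
  finally show ?thesis by (simp add: mult.commute)
qed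

text \<open>Fourier inversion at the origin; the proof inserts the weights \<open>exp(-(sx)\<^sup>2/2)\<close> and lets \<open>s \<rightarrow> 0\<close>.\<close>

lemma integral_cos_kernel:
  assumes iG: "integrable lborel G" and bG: "\<And>\<xi>. \<bar>G \<xi>\<bar> \<le> B" and cG: "isCont G 0"
    and ik: "integrable lborel (cos_kernel G)"
  shows "(\<integral>x. cos_kernel G x \<partial>lborel) = G 0"
proof -
  have Gm[measurable]: "G \<in> borel_measurable borel" using borel_measurable_integrable[OF iG] by simp
  have km[measurable]: "cos_kernel G \<in> borel_measurable borel" using borel_measurable_integrable[OF ik] by simp
  define s where "s n = 1 / real (Suc n)" for n
  have s0: "0 < s n" for n by (simp add: s_def)
  have slim: "s \<longlonglongrightarrow> 0" unfolding s_def using LIMSEQ_inverse_real_of_nat by (simp add: inverse_eq_divide)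
  let ?n = std_normal_density
  have n_le: "?n x \<le> 1 / sqrt (2 * pi)" for x
    unfolding std_normal_density_def by (simp add: divide_simps)
  have cn: "continuous_on UNIV ?n" unfolding std_normal_density_def[abs_def] by (intro continuous_intros) auto
  have n_eq: "exp (- x\<^sup>2 / 2) = sqrt (2 * pi) * ?n x" for x by (simp add: std_normal_density_def)
  \<comment> \<open>Fubini moves the wide Gaussian weight in x onto its transform, a Gaussian of
    width \<open>s n\<close> in the frequency; after rescaling it averages G near 0. The factor
    sqrt(2 pi) makes the weight equal to 1 at x = 0.\<close>
  have eq: "(\<integral>x. cos_kernel G x * (sqrt (2 * pi) * ?n (s n * x)) \<partial>lborel) = (\<integral>z. G (s n * z) * ?n z \<partial>lborel)" for n
  proof -
    let ?F = "\<lambda>x \<xi>. ?n (s n * x) * (cos (x * \<xi>) * G \<xi>)"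
    have ins: "integrable lborel (\<lambda>x. ?n (s n * x))"
    proof -
      have "integrable lborel (\<lambda>x. ?n (0 + s n * x))"
        using s0[of n] by (intro lborel_integrable_real_affine integrable_normal_density) auto
      then show ?thesis by (simp only: add_0)
    qed
    have icG: "integrable lborel (\<lambda>\<xi>. cos (x * \<xi>) * G \<xi>)" for x
      by (rule Bochner_Integration.integrable_bound[OF iG]) (auto simp: abs_mult mult_left_le_one_le)
    have "(\<integral>x. cos_kernel G x * (sqrt (2 * pi) * ?n (s n * x)) \<partial>lborel)
        = sqrt (2 * pi) / (2 * pi) * (\<integral>x. \<integral>\<xi>. ?F x \<xi> \<partial>lborel \<partial>lborel)"
      by (simp add: cos_kernel_def field_simps flip: integral_mult_right_zero)
    also have "(\<integral>x. \<integral>\<xi>. ?F x \<xi> \<partial>lborel \<partial>lborel) = (\<integral>\<xi>. \<integral>x. ?F x \<xi> \<partial>lborel \<partial>lborel)"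
    proof (rule lborel_Fubini_swap[symmetric])
      show "integrable lborel (\<lambda>x. ?n (s n * x) * (\<integral>\<xi>. \<bar>G \<xi>\<bar> \<partial>lborel))"
        by (intro integrable_mult_left ins)
      show "integrable lborel (?F x)" for x by (intro integrable_mult_right icG)
      show "(\<integral>\<xi>. \<bar>?F x \<xi>\<bar> \<partial>lborel) \<le> ?n (s n * x) * (\<integral>\<xi>. \<bar>G \<xi>\<bar> \<partial>lborel)" for x
      proof -
        have "(\<integral>\<xi>. \<bar>?F x \<xi>\<bar> \<partial>lborel) \<le> (\<integral>\<xi>. ?n (s n * x) * \<bar>G \<xi>\<bar> \<partial>lborel)"
          by (intro integral_mono integrable_mult_right integrable_abs icG iG)
             (auto simp: abs_mult normal_density_nonneg mult_left_le_one_le intro!: mult_left_mono)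
        then show ?thesis by simp
      qed
    qed measurable
    also have "\<dots> = (\<integral>\<xi>. G \<xi> * (sqrt (2 * pi) * ?n (\<xi> / s n) / s n) \<partial>lborel)"
    proof (intro Bochner_Integration.integral_cong refl)
      fix \<xi>
      have "(\<integral>x. ?F x \<xi> \<partial>lborel) = G \<xi> * (\<integral>x. cos (x * \<xi>) * ?n (s n * x) \<partial>lborel)"
        by (simp add: mult_ac flip: integral_mult_right_zero)
      also have "(\<integral>x. cos (x * \<xi>) * ?n (s n * x) \<partial>lborel) = (\<integral>z. cos (\<xi> / s n * z) * ?n z \<partial>lborel) / s n"
        using s0[of n] by (subst lborel_integral_real_affine[where c="1 / s n" and t=0]) (auto simp: mult_ac)
      also have "\<dots> = sqrt (2 * pi) * ?n (\<xi> / s n) / s n"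
        by (simp only: integral_cos_std_normal n_eq)
      finally show "(\<integral>x. ?F x \<xi> \<partial>lborel) = G \<xi> * (sqrt (2 * pi) * ?n (\<xi> / s n) / s n)" .
    qed
    also have "\<dots> = sqrt (2 * pi) * (\<integral>z. G (s n * z) * ?n z \<partial>lborel)"
      using s0[of n] by (subst lborel_integral_real_affine[where c="s n" and t=0])
        (auto simp: field_simps simp flip: integral_mult_right_zero)
    also have "sqrt (2 * pi) / (2 * pi) * (sqrt (2 * pi) * (\<integral>z. G (s n * z) * ?n z \<partial>lborel))
        = (\<integral>z. G (s n * z) * ?n z \<partial>lborel)"
    proof -
      have "sqrt (2 * pi) * sqrt (2 * pi) = 2 * pi" by simp
      then have "sqrt (2 * pi) / (2 * pi) * sqrt (2 * pi) = 1" by (simp only: times_divide_eq_left) simp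
      then show ?thesis by (simp only: mult.assoc[symmetric] mult_1)
    qed
    finally show ?thesis .
  qed
  have "(\<lambda>n. \<integral>x. cos_kernel G x * (sqrt (2 * pi) * ?n (s n * x)) \<partial>lborel) \<longlonglongrightarrow> (\<integral>x. cos_kernel G x \<partial>lborel)"
  proof (rule integral_dominated_convergence[OF _ _ integrable_abs[OF ik]])
    show "AE x in lborel. (\<lambda>n. cos_kernel G x * (sqrt (2 * pi) * ?n (s n * x))) \<longlonglongrightarrow> cos_kernel G x"
    proof (rule AE_I2)
      fix x
      have "(\<lambda>n. s n * x) \<longlonglongrightarrow> 0 * x" by (intro tendsto_intros slim)
      then have "(\<lambda>n. ?n (s n * x)) \<longlonglongrightarrow> ?n (0 * x)"
        by (intro continuous_on_tendsto_compose[OF cn]) auto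
      then have "(\<lambda>n. cos_kernel G x * (sqrt (2 * pi) * ?n (s n * x))) \<longlonglongrightarrow> cos_kernel G x * (sqrt (2 * pi) * ?n (0 * x))"
        by (intro tendsto_intros)
      then show "(\<lambda>n. cos_kernel G x * (sqrt (2 * pi) * ?n (s n * x))) \<longlonglongrightarrow> cos_kernel G x"
        by (simp add: n_eq[symmetric])
    qed
    show "AE x in lborel. norm (cos_kernel G x * (sqrt (2 * pi) * ?n (s n * x))) \<le> \<bar>cos_kernel G x\<bar>" for n
      unfolding n_eq[symmetric] by (intro AE_I2) (simp add: abs_mult mult_left_le)
  qed measurable
  moreover have "(\<lambda>n. \<integral>z. G (s n * z) * ?n z \<partial>lborel) \<longlonglongrightarrow> (\<integral>z. G 0 * ?n z \<partial>lborel)"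
  proof (rule integral_dominated_convergence[where w="\<lambda>z. B * ?n z"])
    show "AE z in lborel. (\<lambda>n. G (s n * z) * ?n z) \<longlonglongrightarrow> G 0 * ?n z"
    proof (rule AE_I2)
      fix z
      have "(\<lambda>n. s n * z) \<longlonglongrightarrow> 0 * z" by (intro tendsto_intros slim)
      then have "(\<lambda>n. G (s n * z)) \<longlonglongrightarrow> G 0" using isCont_tendsto_compose[OF cG] by simp
      then show "(\<lambda>n. G (s n * z) * ?n z) \<longlonglongrightarrow> G 0 * ?n z" by (intro tendsto_intros)
    qed
    show "AE z in lborel. norm (G (s n * z) * ?n z) \<le> B * ?n z" for n
      using bG by (intro AE_I2) (auto simp: abs_mult normal_density_nonneg intro!: mult_right_mono)
  qed auto
  ultimately show ?thesis unfolding eq by (auto dest: LIMSEQ_unique)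
qed

text \<open>\<open>\<Sum>\<^bsub>j\<le>0\<^esub> \<phi>(2\<^sup>-\<^sup>j \<xi>)\<close>, written as \<open>1 - \<Sum>\<^bsub>j\<ge>1\<^esub> \<phi>(2\<^sup>-\<^sup>j \<xi>)\<close>.\<close>

definition lowpass :: "(real \<Rightarrow> real) \<Rightarrow> real \<Rightarrow> real" where
  "lowpass \<phi> \<xi> = (if \<bar>\<xi>\<bar> \<le> 4 then 1 - \<phi> (\<xi> / 2) - \<phi> (\<xi> / 4) else 0)"

definition low_kernel :: "(real \<Rightarrow> real) \<Rightarrow> real \<Rightarrow> real" where
  "low_kernel \<phi> = cos_kernel (lowpass \<phi>)"

section \<open>The low-pass multiplier and the decay of its kernel\<close>

lemma smooth_id: "smooth (\<lambda>x. x)"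
proof -
  have "deriv (\<lambda>x::real. x) = (\<lambda>_. 1)" by (auto intro!: DERIV_imp_deriv)
  then show ?thesis by (subst smooth_iff_deriv) (auto simp: smooth_const)
qed

lemma continuous_compact_support_integrable:
  fixes g :: "real \<Rightarrow> real"
  assumes "continuous_on UNIV g" "\<And>x. x \<notin> {a..b} \<Longrightarrow> g x = 0"
  shows "integrable lborel g"
proof -
  have "set_integrable lborel {a..b} g"
    by (rule borel_integrable_atLeastAtMost') (rule continuous_on_subset[OF assms(1)], simp)
  moreover have "(\<lambda>x. indicator {a..b} x *\<^sub>R g x) = g"
  proof
    fix x show "indicator {a..b} x *\<^sub>R g x = g x"
      using assms(2)[of x] by (cases "x \<in> {a..b}") simp_all
  qed
  ultimately show ?thesis by (simp add: set_integrable_def)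
qed

context
  fixes \<phi> :: "real \<Rightarrow> real"
  assumes dp: "dyadic_partition \<phi>"
begin

lemmas \<phi>_D = dyadic_partition_D[OF dp]

text \<open>The bounds 8/3 and 6 are where the scales j \<le> 0 and j \<ge> 3 leave the support of
  \<phi>. On this shell 1 - \<phi>(\<xi>/2) - \<phi>(\<xi>/4) vanishes, so the cut at 4 in
  \<open>lowpass\<close> leaves no jump.\<close>

lemma \<phi>_two: "\<phi> (\<xi> / 2) + \<phi> (\<xi> / 4) = 1" if "8/3 < \<bar>\<xi>\<bar>" "\<bar>\<xi>\<bar> < 6"
proof -
  have "(\<Sum>j\<in>{1,2}. \<phi> (2 powr (- real_of_int j) * \<xi>)) = 1"
  proof (rule dyadic_partition_sum[OF dp])
    fix j :: int assume "j \<notin> {1,2}"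
    then have "j \<le> 0 \<or> 3 \<le> j" by auto
    then show "\<phi> (2 powr (- real_of_int j) * \<xi>) = 0"
    proof
      assume "j \<le> 0"
      then have "(2::real) powr 0 \<le> 2 powr (- real_of_int j)" by (intro powr_mono) auto
      then have "1 * \<bar>\<xi>\<bar> \<le> \<bar>2 powr (- real_of_int j)\<bar> * \<bar>\<xi>\<bar>" by (intro mult_right_mono) auto
      with that(1) have "8/3 < \<bar>2 powr (- real_of_int j) * \<xi>\<bar>" unfolding abs_mult by linarith
      then show ?thesis by (rule \<phi>_D(4))
    next
      assume "3 \<le> j"
      then have "(2::real) powr (- real_of_int j) \<le> 2 powr (-3)" by (intro powr_mono) auto
      also have "(2::real) powr (-3) = 1 / 8" by (simp add: powr_neg_numeral)
      finally have "\<bar>2 powr (- real_of_int j) * \<xi>\<bar> \<le> 1 / 8 * \<bar>\<xi>\<bar>"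
        unfolding abs_mult by (intro mult_right_mono) auto
      with that(2) have "\<bar>2 powr (- real_of_int j) * \<xi>\<bar> < 3/4" by linarith
      then show ?thesis by (rule \<phi>_D(3))
    qed
  next
    show "\<xi> \<noteq> 0" using that(1) by auto
  qed simp
  moreover have "(2::real) powr - 2 = 1 / 4" by (simp add: powr_neg_numeral)
  ultimately show ?thesis by (simp add: powr_neg_one)
qed

lemma \<phi>_three: "\<phi> \<xi> + \<phi> (\<xi> / 2) + \<phi> (\<xi> / 4) = 1" if "2 < \<bar>\<xi>\<bar>" "\<bar>\<xi>\<bar> \<le> 4"
proof (cases "8/3 < \<bar>\<xi>\<bar>")
  case True
  with \<phi>_two[of \<xi>] \<phi>_D(4)[of \<xi>] that show ?thesis by simp
next
  case False
  \<comment> \<open>For 2 < \<bar>\<xi>\<bar> \<le> 8/3 the double of \<xi> lies in the shell of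
    \<open>\<phi>_two\<close>.\<close>
  have "\<phi> (2 * \<xi> / 2) + \<phi> (2 * \<xi> / 4) = 1" using that False by (intro \<phi>_two) (auto simp: abs_mult)
  moreover have "\<phi> (\<xi> / 4) = 0" using False by (intro \<phi>_D(3)) auto
  ultimately show ?thesis by simp
qed

text \<open>The telescoping identity of Littlewood-Paley theory: \<phi> is the low-pass multiplier
  minus its copy with half the bandwidth.\<close>

lemma lowpass_diff: "lowpass \<phi> \<xi> - lowpass \<phi> (2 * \<xi>) = \<phi> \<xi>"
proof -
  consider "\<bar>\<xi>\<bar> \<le> 2" | "2 < \<bar>\<xi>\<bar>" "\<bar>\<xi>\<bar> \<le> 4" | "4 < \<bar>\<xi>\<bar>" by linarith
  then show ?thesis
  proof cases
    case 1
    have "\<phi> (\<xi> / 4) = 0" using 1 by (intro \<phi>_D(3)) auto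
    with 1 show ?thesis by (simp add: lowpass_def abs_mult)
  next
    case 2
    with \<phi>_three[of \<xi>] show ?thesis by (simp add: lowpass_def abs_mult)
  next
    case 3
    with \<phi>_D(4)[of \<xi>] show ?thesis by (simp add: lowpass_def abs_mult)
  qed
qed

lemma lowpass_eq_1: "lowpass \<phi> \<xi> = 1" if "\<bar>\<xi>\<bar> < 3/2"
  using that \<phi>_D(3)[of "\<xi>/2"] \<phi>_D(3)[of "\<xi>/4"] by (simp add: lowpass_def)

lemma lowpass_even: "lowpass \<phi> (- \<xi>) = lowpass \<phi> \<xi>"
  using \<phi>_D(2)[of "\<xi>/2"] \<phi>_D(2)[of "\<xi>/4"] by (simp add: lowpass_def)

text \<open>Smooth on the whole line, but equal to 1 at high frequencies. It agrees with
  \<open>lowpass \<phi>\<close> on [-4, 4] and vanishes near both end points, so integration by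
  parts on that interval leaves no boundary terms.\<close>

definition lowpass_smooth :: "real \<Rightarrow> real" where
  "lowpass_smooth \<xi> = 1 - \<phi> (\<xi> / 2) - \<phi> (\<xi> / 4)"

lemma smooth_lowpass_smooth: "smooth lowpass_smooth"
proof -
  have "smooth (\<lambda>\<xi>. (1 + (-1) * \<phi> ((1/2) * \<xi> + 0)) + (-1) * \<phi> ((1/4) * \<xi> + 0))"
    by (intro smooth_add smooth_mult smooth_const smooth_affine[OF \<phi>_D(1)])
  then show ?thesis by (simp add: lowpass_smooth_def[abs_def])
qed

lemma lowpass_smooth_zero: "lowpass_smooth \<xi> = 0" if "8/3 < \<bar>\<xi>\<bar>" "\<bar>\<xi>\<bar> < 6"
  using \<phi>_two[OF that] by (simp add: lowpass_smooth_def)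

lemma lowpass_eq: "lowpass \<phi> \<xi> = lowpass_smooth \<xi> * indicator {-4..4} \<xi>"
  by (auto simp: lowpass_def lowpass_smooth_def indicator_def abs_le_iff)

lemma continuous_lowpass: "continuous_on UNIV (lowpass \<phi>)"
proof -
  have cs: "continuous_on S lowpass_smooth" for S by (rule smooth_continuous[OF smooth_lowpass_smooth])
  have "continuous_on ({-4..4} \<union> ({..-4} \<union> {4..})) (\<lambda>\<xi>. if \<xi> \<in> {-4..4} then lowpass_smooth \<xi> else 0)"
  proof (rule continuous_on_If)
    fix \<xi> :: real assume "\<xi> \<in> {..-4} \<union> {4..}" "\<xi> \<in> {-4..4}"
    then have "\<bar>\<xi>\<bar> = 4" by auto
    then show "lowpass_smooth \<xi> = 0" by (intro lowpass_smooth_zero) auto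
  next
    fix \<xi> :: real assume "\<xi> \<in> {-4..4}" "\<xi> \<notin> {-4..4}"
    then show "lowpass_smooth \<xi> = 0" by simp
  qed (auto intro: cs closed_Un)
  moreover have "{-4..4} \<union> ({..-4} \<union> {4..}) = (UNIV :: real set)" by auto
  moreover have "(\<lambda>\<xi>. if \<xi> \<in> {-4..4} then lowpass_smooth \<xi> else 0) = lowpass \<phi>"
    by (auto simp: lowpass_eq indicator_def)
  ultimately show ?thesis by (simp only:)
qed

lemma integrable_lowpass: "integrable lborel (lowpass \<phi>)"
  by (rule continuous_compact_support_integrable[OF continuous_lowpass, of "-4" 4])
     (auto simp: lowpass_eq)

lemma continuous_\<phi>: "continuous_on S \<phi>"
  by (rule smooth_continuous[OF \<phi>_D(1)])

lemma integrable_\<phi>: "integrable lborel \<phi>"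
  by (rule continuous_compact_support_integrable[OF continuous_\<phi>, of "-3" 3]) (auto intro!: \<phi>_D(4))

lemma low_kernel_eq:
  "low_kernel \<phi> x = integral {-4..4} (\<lambda>\<xi>. cos (x * \<xi>) * lowpass_smooth \<xi>) / (2 * pi)"
proof -
  have "set_integrable lborel {-4..4} (\<lambda>\<xi>. cos (x * \<xi>) * lowpass_smooth \<xi>)"
    by (intro borel_integrable_atLeastAtMost' continuous_intros smooth_continuous[OF smooth_lowpass_smooth])
  from set_borel_integral_eq_integral(2)[OF this]
  show ?thesis by (simp add: low_kernel_def cos_kernel_def lowpass_eq set_lebesgue_integral_def mult_ac)
qed

text \<open>Two integrations by parts give quadratic decay, enough for the kernel and its derivative
  to be integrable. Differentiating in x under the integral multiplies the multiplier by \<xi>,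
  which is the function Q.\<close>

lemma low_kernel_bounds:
  "\<exists>\<chi>' M. 0 < M \<and> (\<forall>x. (low_kernel \<phi> has_real_derivative \<chi>' x) (at x)) \<and> continuous_on UNIV \<chi>' \<and>
     (\<forall>x. \<bar>low_kernel \<phi> x\<bar> \<le> M / (1 + x\<^sup>2)) \<and> (\<forall>x. \<bar>\<chi>' x\<bar> \<le> M / (1 + x\<^sup>2))"
proof -
  let ?P = lowpass_smooth
  define Q where "Q \<xi> = \<xi> * ?P \<xi>" for \<xi>
  have sQ: "smooth Q" unfolding Q_def[abs_def] by (intro smooth_mult smooth_id smooth_lowpass_smooth)
  have decay: "\<exists>A. \<forall>x. \<bar>integral {-4..4} (\<lambda>\<xi>. cos (x * \<xi> + \<theta>) * g \<xi>)\<bar> \<le> A / (1 + x\<^sup>2)"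
    if sg: "smooth g" and g0: "\<And>\<xi>. 8/3 < \<bar>\<xi>\<bar> \<Longrightarrow> \<bar>\<xi>\<bar> < 6 \<Longrightarrow> g \<xi> = 0" for g \<theta>
  proof (rule oscillatory_integral_decay)
    have sg': "smooth (deriv g)" using sg smooth_iff_deriv by blast
    show "(g has_real_derivative deriv g \<xi>) (at \<xi>)" for \<xi> by (rule smooth_DERIV[OF sg])
    show "(deriv g has_real_derivative deriv (deriv g) \<xi>) (at \<xi>)" for \<xi> by (rule smooth_DERIV[OF sg'])
    show "continuous_on UNIV (deriv (deriv g))"
      using sg' smooth_iff_deriv[of "deriv g"] by (intro smooth_continuous) simp
    \<comment> \<open>g vanishes in neighbourhoods of 4 and -4, hence its derivative does
      too.\<close>
    have d0: "deriv g \<xi> = 0" if "\<xi> \<in> S" "open S" "\<And>\<eta>. \<eta> \<in> S \<Longrightarrow> g \<eta> = 0" for \<xi> S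
    proof -
      have "\<forall>\<^sub>F \<eta> in nhds \<xi>. g \<eta> = 0"
        using eventually_nhds_in_open[OF that(2,1)] by eventually_elim (rule that(3))
      then have "deriv g \<xi> = deriv (\<lambda>_. 0) \<xi>" by (intro deriv_cong_ev) auto
      then show ?thesis by simp
    qed
    show "deriv g 4 = 0" by (rule d0[of _ "{3<..<5}"]) (auto intro!: g0)
    show "deriv g (-4) = 0" by (rule d0[of _ "{-5<..<-3}"]) (auto intro!: g0)
  qed (auto intro!: g0)
  obtain A where A: "\<And>x. \<bar>integral {-4..4} (\<lambda>\<xi>. cos (x * \<xi> + 0) * ?P \<xi>)\<bar> \<le> A / (1 + x\<^sup>2)"
    using decay[OF smooth_lowpass_smooth lowpass_smooth_zero] by blast
  have Q0: "Q \<xi> = 0" if "8/3 < \<bar>\<xi>\<bar>" "\<bar>\<xi>\<bar> < 6" for \<xi> using lowpass_smooth_zero[OF that] by (simp add: Q_def)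
  \<comment> \<open>The phase pi/2 turns the cosine into the negative sine that differentiation in x
    produces.\<close>
  obtain A' where A': "\<And>x. \<bar>integral {-4..4} (\<lambda>\<xi>. cos (x * \<xi> + pi / 2) * Q \<xi>)\<bar> \<le> A' / (1 + x\<^sup>2)"
    using decay[OF sQ Q0] by blast
  define \<chi>' where "\<chi>' x = integral {-4..4} (\<lambda>\<xi>. - sin (x * \<xi>) * Q \<xi>) / (2 * pi)" for x
  define M where "M = \<bar>A\<bar> + \<bar>A'\<bar> + 1"
  have cQ: "continuous_on S Q" and cP: "continuous_on S ?P" for S
    using smooth_continuous[OF sQ] smooth_continuous[OF smooth_lowpass_smooth] by auto
  have cf: "continuous_on (UNIV \<times> cbox (-4) (4::real)) (\<lambda>(x, \<xi>). - sin (x * \<xi>) * Q \<xi>)"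
    unfolding split_beta by (intro continuous_intros continuous_on_compose2[OF cQ]) auto
  have "((\<lambda>x. integral (cbox (-4) 4) (\<lambda>\<xi>. cos (x * \<xi>) * ?P \<xi>)) has_real_derivative
      integral (cbox (-4) 4) (\<lambda>\<xi>. - sin (x * \<xi>) * Q \<xi>)) (at x within UNIV)" for x
  proof (rule leibniz_rule_field_derivative[OF _ _ cf])
    show "((\<lambda>x. cos (x * \<xi>) * ?P \<xi>) has_real_derivative - sin (x * \<xi>) * Q \<xi>) (at x within UNIV)" for x \<xi>
      by (auto intro!: derivative_eq_intros simp: Q_def)
    show "(\<lambda>\<xi>. cos (x * \<xi>) * ?P \<xi>) integrable_on cbox (-4) 4" for x
      by (intro integrable_continuous continuous_intros cP)
  qed auto
  then have "(low_kernel \<phi> has_real_derivative \<chi>' x) (at x)" for x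
    unfolding low_kernel_eq[abs_def] \<chi>'_def by (intro DERIV_cdivide) simp
  moreover have "continuous_on UNIV \<chi>'"
    unfolding \<chi>'_def using integral_continuous_on_param[OF cf] by (intro continuous_intros) auto
  moreover have "\<bar>I / (2 * pi)\<bar> \<le> M / (1 + x\<^sup>2)" if "\<bar>I\<bar> \<le> B / (1 + x\<^sup>2)" "\<bar>B\<bar> \<le> M" for I B x
  proof -
    have "\<bar>I / (2 * pi)\<bar> \<le> \<bar>I\<bar> / 1" unfolding abs_divide
      using pi_gt3 by (intro divide_left_mono) auto
    also have "\<dots> \<le> B / (1 + x\<^sup>2)" using that(1) by simp
    also have "\<dots> \<le> M / (1 + x\<^sup>2)" using that(2) by (intro divide_right_mono) auto
    finally show ?thesis .
  qed
  note bound = this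
  have "\<bar>low_kernel \<phi> x\<bar> \<le> M / (1 + x\<^sup>2)" for x
    unfolding low_kernel_eq using A[of x] by (intro bound[of _ A]) (auto simp: M_def)
  moreover have "\<bar>\<chi>' x\<bar> \<le> M / (1 + x\<^sup>2)" for x
    unfolding \<chi>'_def using A'[of x] by (intro bound[of _ A']) (auto simp: M_def minus_sin_cos_eq)
  moreover have "0 < M" by (simp add: M_def)
  ultimately show ?thesis by blast
qed

lemma low_kernel_continuous: "continuous_on S (low_kernel \<phi>)"
proof -
  obtain \<chi>' where "\<And>x. (low_kernel \<phi> has_real_derivative \<chi>' x) (at x)"
    using low_kernel_bounds by blast
  then show ?thesis by (intro continuous_at_imp_continuous_on ballI DERIV_isCont)
qed

lemma low_kernel_integrable: "integrable lborel (low_kernel \<phi>)"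
proof -
  obtain \<chi>' M where "\<And>x. \<bar>low_kernel \<phi> x\<bar> \<le> M / (1 + x\<^sup>2)"
    using low_kernel_bounds by blast
  then show ?thesis
    by (rule integrable_if_quadratic_decay[rotated])
       (rule borel_measurable_continuous_onI[OF low_kernel_continuous])
qed

lemma lowpass_bounded: "\<exists>B. \<forall>\<xi>. \<bar>lowpass \<phi> \<xi>\<bar> \<le> B"
proof -
  have "bounded (lowpass_smooth ` {-4..4})"
    by (intro compact_imp_bounded compact_continuous_image smooth_continuous[OF smooth_lowpass_smooth]) auto
  then obtain B where B: "\<And>\<xi>. \<xi> \<in> {-4..4} \<Longrightarrow> \<bar>lowpass_smooth \<xi>\<bar> \<le> B"
    unfolding bounded_real by blast
  have "\<bar>lowpass \<phi> \<xi>\<bar> \<le> \<bar>B\<bar>" for \<xi>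
  proof (cases "\<xi> \<in> {-4..4}")
    case True
    from B[OF this] True show ?thesis by (simp add: lowpass_eq)
  qed (simp add: lowpass_eq)
  then show ?thesis by blast
qed

text \<open>Inversion at the origin, applied to the multiplier translated by \<eta>. Its cosine
  kernel is \<open>low_kernel \<phi>\<close> modulated by cos(x \<eta>), because the sine part is
  the integral of an odd function.\<close>

lemma low_kernel_inversion:
  "(\<integral>x. low_kernel \<phi> x * cos (x * \<eta>) \<partial>lborel) = lowpass \<phi> \<eta>"
proof -
  have Lm[measurable]: "lowpass \<phi> \<in> borel_measurable borel"
    by (rule borel_measurable_continuous_onI[OF continuous_lowpass])
  have km[measurable]: "low_kernel \<phi> \<in> borel_measurable borel"
    by (rule borel_measurable_continuous_onI[OF low_kernel_continuous])
  have icL: "integrable lborel (\<lambda>\<xi>. T (x * \<xi>) * lowpass \<phi> \<xi>)"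
    if "T = cos \<or> T = sin" for T :: "real \<Rightarrow> real" and x
    using that by (intro Bochner_Integration.integrable_bound[OF integrable_lowpass])
      (auto simp: abs_mult mult_left_le_one_le)
  have eq: "cos_kernel (\<lambda>\<xi>. lowpass \<phi> (\<eta> + \<xi>)) x = low_kernel \<phi> x * cos (x * \<eta>)" for x
  proof -
    have "(\<integral>\<xi>. cos (x * \<xi>) * lowpass \<phi> (\<eta> + \<xi>) \<partial>lborel) = (\<integral>\<xi>. cos (x * (\<xi> - \<eta>)) * lowpass \<phi> \<xi> \<partial>lborel)"
      by (subst lborel_integral_real_affine[where c=1 and t="-\<eta>"]) auto
    also have "\<dots> = (\<integral>\<xi>. cos (x * \<eta>) * (cos (x * \<xi>) * lowpass \<phi> \<xi>) + sin (x * \<eta>) * (sin (x * \<xi>) * lowpass \<phi> \<xi>) \<partial>lborel)"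
      by (intro Bochner_Integration.integral_cong refl) (simp add: right_diff_distrib cos_diff algebra_simps)
    also have "\<dots> = cos (x * \<eta>) * (\<integral>\<xi>. cos (x * \<xi>) * lowpass \<phi> \<xi> \<partial>lborel) + sin (x * \<eta>) * (\<integral>\<xi>. sin (x * \<xi>) * lowpass \<phi> \<xi> \<partial>lborel)"
      by (subst Bochner_Integration.integral_add) (auto intro!: icL)
    also have "(\<integral>\<xi>. sin (x * \<xi>) * lowpass \<phi> \<xi> \<partial>lborel) = 0"
      by (rule integral_odd_zero) (simp add: lowpass_even)
    finally show ?thesis by (simp add: cos_kernel_def low_kernel_def)
  qed
  obtain B where B: "\<And>\<xi>. \<bar>lowpass \<phi> \<xi>\<bar> \<le> B" using lowpass_bounded by blast
  have "(\<integral>x. cos_kernel (\<lambda>\<xi>. lowpass \<phi> (\<eta> + \<xi>)) x \<partial>lborel) = lowpass \<phi> (\<eta> + 0)"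
  proof (rule integral_cos_kernel[where B=B])
    show "integrable lborel (\<lambda>\<xi>. lowpass \<phi> (\<eta> + \<xi>))"
      using lborel_integrable_real_affine[OF integrable_lowpass, of 1 \<eta>] by simp
    show "isCont (\<lambda>\<xi>. lowpass \<phi> (\<eta> + \<xi>)) 0"
      using continuous_on_compose2[OF continuous_lowpass, of UNIV "\<lambda>\<xi>. \<eta> + \<xi>"]
      by (auto simp: continuous_on_eq_continuous_at intro!: continuous_intros)
    show "integrable lborel (cos_kernel (\<lambda>\<xi>. lowpass \<phi> (\<eta> + \<xi>)))"
      unfolding eq[abs_def]
      by (rule Bochner_Integration.integrable_bound[OF low_kernel_integrable])
         (auto simp: abs_mult mult_left_le)
  qed (rule B)
  then show ?thesis by (simp add: eq)
qed

section \<open>The kernel of a dyadic block\<close>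

definition band_kernel :: "real \<Rightarrow> real" where
  "band_kernel x = low_kernel \<phi> x - low_kernel \<phi> (x / 2) / 2"

text \<open>This is \<open>lowpass_diff\<close> on the side of kernels, where halving the bandwidth
  is a dilation. The kernel of \<phi> thereby inherits continuity and integrability from
  \<open>low_kernel \<phi>\<close>.\<close>

lemma cos_kernel_\<phi>: "cos_kernel \<phi> x = band_kernel x"
proof -
  have i2: "integrable lborel (\<lambda>\<xi>. lowpass \<phi> (2 * \<xi>))"
    using lborel_integrable_real_affine[OF integrable_lowpass, of 2 0] by simp
  have ic: "integrable lborel (\<lambda>\<xi>. cos (x * \<xi>) * g \<xi>)" if "integrable lborel g" for g
  proof -
    have [measurable]: "g \<in> borel_measurable borel" using borel_measurable_integrable[OF that] by simp
    show ?thesis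
      by (rule Bochner_Integration.integrable_bound[OF that]) (auto simp: abs_mult mult_left_le_one_le)
  qed
  have "(\<integral>\<xi>. cos (x * \<xi>) * \<phi> \<xi> \<partial>lborel) = (\<integral>\<xi>. cos (x * \<xi>) * lowpass \<phi> \<xi> - cos (x * \<xi>) * lowpass \<phi> (2 * \<xi>) \<partial>lborel)"
    by (simp only: right_diff_distrib[symmetric] lowpass_diff)
  also have "\<dots> = (\<integral>\<xi>. cos (x * \<xi>) * lowpass \<phi> \<xi> \<partial>lborel) - (\<integral>\<xi>. cos (x * \<xi>) * lowpass \<phi> (2 * \<xi>) \<partial>lborel)"
    by (rule Bochner_Integration.integral_diff[OF ic[OF integrable_lowpass] ic[OF i2]])
  finally have "cos_kernel \<phi> x = cos_kernel (lowpass \<phi>) x - cos_kernel (\<lambda>\<xi>. lowpass \<phi> (2 * \<xi>)) x"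
    unfolding cos_kernel_def by (simp only: diff_divide_distrib)
  moreover have "cos_kernel (\<lambda>\<xi>. lowpass \<phi> (2 * \<xi>)) x = cos_kernel (lowpass \<phi>) (x / 2) / 2"
    using cos_kernel_dilate[of "1/2" "lowpass \<phi>" x] by (simp add: mult.commute)
  ultimately show ?thesis by (simp add: band_kernel_def low_kernel_def)
qed

lemma band_kernel_continuous: "continuous_on S band_kernel"
proof -
  have "continuous_on S (\<lambda>x. low_kernel \<phi> (x / 2))"
    by (rule continuous_on_compose2[OF low_kernel_continuous[of UNIV]]) (auto intro!: continuous_intros)
  then show ?thesis
    unfolding band_kernel_def[abs_def] by (intro continuous_intros low_kernel_continuous) auto
qed

lemma band_kernel_integrable: "integrable lborel band_kernel"
  unfolding band_kernel_def[abs_def]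
proof (rule Bochner_Integration.integrable_diff[OF low_kernel_integrable])
  have "integrable lborel (\<lambda>x. low_kernel \<phi> (0 + 1/2 * x))"
    by (rule lborel_integrable_real_affine[OF low_kernel_integrable]) simp
  then show "integrable lborel (\<lambda>x. low_kernel \<phi> (x / 2) / 2)" by simp
qed

text \<open>\<open>lowpass \<phi> (\<xi>/2) = 1\<close> on the support of \<open>\<phi>\<close>.\<close>

lemma band_kernel_reproducing:
  "(\<integral>y. 2 * low_kernel \<phi> (2 * y) * band_kernel (w - y) \<partial>lborel) = band_kernel w"
proof -
  have \<phi>m[measurable]: "\<phi> \<in> borel_measurable borel" by (rule borel_measurable_continuous_onI[OF continuous_\<phi>])
  have km[measurable]: "low_kernel \<phi> \<in> borel_measurable borel"
    by (rule borel_measurable_continuous_onI[OF low_kernel_continuous])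
  define k where "k y = 2 * low_kernel \<phi> (2 * y)" for y
  have k_m[measurable]: "k \<in> borel_measurable borel" unfolding k_def[abs_def] by measurable
  have ik: "integrable lborel k"
    unfolding k_def[abs_def] using lborel_integrable_real_affine[OF low_kernel_integrable, of 2 0] by simp
  have keven: "k (- y) = k y" for y by (simp add: k_def low_kernel_def cos_kernel_def)
  have kinv: "(\<integral>y. k y * cos (y * \<xi>) \<partial>lborel) = lowpass \<phi> (\<xi> / 2)" for \<xi>
    unfolding low_kernel_inversion[symmetric] k_def
    by (subst (2) lborel_integral_real_affine[where c=2 and t=0]) (auto simp: mult_ac)
  have ikT: "integrable lborel (\<lambda>y. k y * T (y * \<xi>))" if "T = cos \<or> T = sin" for T :: "real \<Rightarrow> real" and \<xi>
    using that by (intro Bochner_Integration.integrable_bound[OF ik]) (auto simp: abs_mult mult_left_le)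
  have ic: "integrable lborel (\<lambda>\<xi>. cos ((w - y) * \<xi>) * \<phi> \<xi>)" for y
    by (rule Bochner_Integration.integrable_bound[OF integrable_\<phi>]) (auto simp: abs_mult mult_left_le_one_le)
  have "(\<integral>y. k y * band_kernel (w - y) \<partial>lborel) = (\<integral>y. \<integral>\<xi>. k y * (cos ((w - y) * \<xi>) * \<phi> \<xi>) \<partial>lborel \<partial>lborel) / (2 * pi)"
    unfolding cos_kernel_\<phi>[symmetric] cos_kernel_def by simp
  also have "(\<integral>y. \<integral>\<xi>. k y * (cos ((w - y) * \<xi>) * \<phi> \<xi>) \<partial>lborel \<partial>lborel)
      = (\<integral>\<xi>. \<integral>y. k y * (cos ((w - y) * \<xi>) * \<phi> \<xi>) \<partial>lborel \<partial>lborel)"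
  proof (rule lborel_Fubini_swap[symmetric])
    show "integrable lborel (\<lambda>y. \<bar>k y\<bar> * (\<integral>\<xi>. \<bar>\<phi> \<xi>\<bar> \<partial>lborel))" by (intro integrable_mult_left integrable_abs ik)
    show "integrable lborel (\<lambda>\<xi>. k y * (cos ((w - y) * \<xi>) * \<phi> \<xi>))" for y by (intro integrable_mult_right ic)
    show "(\<integral>\<xi>. \<bar>k y * (cos ((w - y) * \<xi>) * \<phi> \<xi>)\<bar> \<partial>lborel) \<le> \<bar>k y\<bar> * (\<integral>\<xi>. \<bar>\<phi> \<xi>\<bar> \<partial>lborel)" for y
    proof -
      have "(\<integral>\<xi>. \<bar>k y * (cos ((w - y) * \<xi>) * \<phi> \<xi>)\<bar> \<partial>lborel) \<le> (\<integral>\<xi>. \<bar>k y\<bar> * \<bar>\<phi> \<xi>\<bar> \<partial>lborel)"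
        by (intro integral_mono integrable_mult_right integrable_abs ic integrable_\<phi>)
           (auto simp: abs_mult mult_left_le_one_le intro!: mult_left_mono)
      then show ?thesis by simp
    qed
  qed measurable
  also have "\<dots> = (\<integral>\<xi>. cos (w * \<xi>) * \<phi> \<xi> \<partial>lborel)"
  proof (intro Bochner_Integration.integral_cong refl)
    fix \<xi>
    have "(\<integral>y. k y * (cos ((w - y) * \<xi>) * \<phi> \<xi>) \<partial>lborel)
        = (\<integral>y. (\<phi> \<xi> * cos (w * \<xi>)) * (k y * cos (y * \<xi>)) + (\<phi> \<xi> * sin (w * \<xi>)) * (k y * sin (y * \<xi>)) \<partial>lborel)"
      by (intro Bochner_Integration.integral_cong refl) (simp add: left_diff_distrib cos_diff algebra_simps)
    also have "\<dots> = (\<phi> \<xi> * cos (w * \<xi>)) * (\<integral>y. k y * cos (y * \<xi>) \<partial>lborel) + (\<phi> \<xi> * sin (w * \<xi>)) * (\<integral>y. k y * sin (y * \<xi>) \<partial>lborel)"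
      by (subst Bochner_Integration.integral_add) (auto intro!: ikT)
    also have "(\<integral>y. k y * sin (y * \<xi>) \<partial>lborel) = 0" by (rule integral_odd_zero) (simp add: keven)
    \<comment> \<open>On the support of \<phi> the modulus of \<xi>/2 is at most 4/3, below the
      bound 3/2 of \<open>lowpass_eq_1\<close>.\<close>
    also have "(\<phi> \<xi> * cos (w * \<xi>)) * (\<integral>y. k y * cos (y * \<xi>) \<partial>lborel) = cos (w * \<xi>) * \<phi> \<xi>"
    proof (cases "8/3 < \<bar>\<xi>\<bar>")
      case True
      then show ?thesis using \<phi>_D(4) by simp
    next
      case False
      then show ?thesis by (simp add: kinv lowpass_eq_1)
    qed
    finally show "(\<integral>y. k y * (cos ((w - y) * \<xi>) * \<phi> \<xi>) \<partial>lborel) = cos (w * \<xi>) * \<phi> \<xi>" by simp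
  qed
  also have "\<dots> / (2 * pi) = band_kernel w" unfolding cos_kernel_\<phi>[symmetric] cos_kernel_def ..
  finally show ?thesis by (simp add: k_def)
qed

end

section \<open>Lipschitz bounds from Besov norms\<close>

text \<open>Young's inequality for an integrable kernel and a bounded function; the factor
  1/\<bar>c\<bar> is the effect of the dilation on the integral.\<close>

lemma integrable_kernel_mult_bounded:
  fixes k f :: "real \<Rightarrow> real"
  assumes k: "integrable lborel k" and f[measurable]: "f \<in> borel_measurable borel" and A: "\<And>x. \<bar>f x\<bar> \<le> A"
    and "c \<noteq> 0"
  shows "integrable lborel (\<lambda>y. k (c * (x - y)) * f y)"
    and "(\<integral>y. \<bar>k (c * (x - y)) * f y\<bar> \<partial>lborel) \<le> A / \<bar>c\<bar> * (\<integral>y. \<bar>k y\<bar> \<partial>lborel)"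
proof -
  have km[measurable]: "k \<in> borel_measurable borel" using borel_measurable_integrable[OF k] by simp
  have A0: "0 \<le> A" using A[of 0] by linarith
  have ik: "integrable lborel (\<lambda>y. k (c * x + (- c) * y))"
    using assms(4) by (intro lborel_integrable_real_affine k) auto
  then have ik': "integrable lborel (\<lambda>y. k (c * (x - y)))" by (simp add: right_diff_distrib)
  show i: "integrable lborel (\<lambda>y. k (c * (x - y)) * f y)"
  proof (rule Bochner_Integration.integrable_bound[OF integrable_mult_left[OF ik', of A]])
    show "AE y in lborel. norm (k (c * (x - y)) * f y) \<le> norm (k (c * (x - y)) * A)"
      using A A0 by (intro AE_I2) (auto simp: abs_mult intro!: mult_left_mono)
  qed measurable
  have "(\<integral>y. \<bar>k (c * (x - y)) * f y\<bar> \<partial>lborel) \<le> (\<integral>y. \<bar>k (c * (x - y))\<bar> * A \<partial>lborel)"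
    using A by (intro integral_mono integrable_abs i integrable_mult_left ik') (auto simp: abs_mult intro!: mult_left_mono)
  also have "\<dots> = A * (\<integral>y. \<bar>k (c * (x - y))\<bar> \<partial>lborel)" by simp
  also have "(\<integral>y. \<bar>k (c * (x - y))\<bar> \<partial>lborel) = (\<integral>y. \<bar>k y\<bar> \<partial>lborel) / \<bar>c\<bar>"
    using lborel_integral_real_affine[of "-c" "\<lambda>y. \<bar>k y\<bar>" "c * x"] assms(4)
    by (simp add: right_diff_distrib)
  finally show "(\<integral>y. \<bar>k (c * (x - y)) * f y\<bar> \<partial>lborel) \<le> A / \<bar>c\<bar> * (\<integral>y. \<bar>k y\<bar> \<partial>lborel)"
    by simp
qed

text \<open>The Fourier multiplier \<open>lowpass \<phi> (\<xi> / b)\<close> as a convolution; for b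
  = 2^j it keeps the frequencies of the blocks up to index j.\<close>

definition lowpass_op :: "(real \<Rightarrow> real) \<Rightarrow> real \<Rightarrow> (real \<Rightarrow> real) \<Rightarrow> real \<Rightarrow> real" where
  "lowpass_op \<phi> b h x = (\<integral>y. b * low_kernel \<phi> (b * (x - y)) * h y \<partial>lborel)"

context
  fixes \<phi> :: "real \<Rightarrow> real"
  assumes dp: "dyadic_partition \<phi>"
begin

text \<open>A Bernstein inequality for the sum of a bounded and an integrable part. The derivative
  b^2 \<chi>'(b x) of the kernel has integral norm b I, which meets the bounded part T, and supremum
  at most b^2 M, which meets the integrable part g. I and M depend on \<phi> alone, hence the
  quantifiers over everything else inside.\<close>

lemma lowpass_op_lipschitz:
  "\<exists>I M. 0 \<le> I \<and> 0 \<le> M \<and> (\<forall>b h A T g N x y. 0 < b \<longrightarrow> h \<in> borel_measurable borel \<longrightarrow> (\<forall>x. \<bar>h x\<bar> \<le> A) \<longrightarrow>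
     0 \<le> T \<longrightarrow> 0 \<le> N \<longrightarrow> g \<in> borel_measurable borel \<longrightarrow> (\<forall>z. 0 \<le> g z) \<longrightarrow>
     (AE z in lborel. \<bar>h z\<bar> \<le> T + g z) \<longrightarrow> (\<integral>\<^sup>+ z. ennreal (g z) \<partial>lborel) \<le> ennreal N \<longrightarrow>
     \<bar>lowpass_op \<phi> b h x - lowpass_op \<phi> b h y\<bar> \<le> (T * b * I + b\<^sup>2 * M * N) * \<bar>x - y\<bar>)"
proof -
  obtain \<chi>' M where M: "0 < M" and d\<chi>: "\<And>x. (low_kernel \<phi> has_real_derivative \<chi>' x) (at x)"
    and c\<chi>': "continuous_on UNIV \<chi>'" and \<chi>'b: "\<And>x. \<bar>\<chi>' x\<bar> \<le> M / (1 + x\<^sup>2)"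
    using low_kernel_bounds[OF dp] by blast
  have \<chi>m[measurable]: "low_kernel \<phi> \<in> borel_measurable borel"
    by (rule borel_measurable_continuous_onI[OF low_kernel_continuous[OF dp]])
  have \<chi>'m[measurable]: "\<chi>' \<in> borel_measurable borel"
    by (rule borel_measurable_continuous_onI[OF c\<chi>'])
  have i\<chi>': "integrable lborel \<chi>'" by (rule integrable_if_quadratic_decay[OF \<chi>'m \<chi>'b])
  have \<chi>'M: "\<bar>\<chi>' x\<bar> \<le> M" for x
  proof -
    have "M / (1 + x\<^sup>2) \<le> M / 1" using M by (intro divide_left_mono) (auto simp: add_pos_nonneg)
    then show ?thesis using \<chi>'b[of x] by simp
  qed
  define I where "I = (\<integral>x. \<bar>\<chi>' x\<bar> \<partial>lborel)"
  have I0: "0 \<le> I" unfolding I_def by (intro integral_nonneg_AE) auto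
  have nnI: "(\<integral>\<^sup>+ x. ennreal \<bar>\<chi>' x\<bar> \<partial>lborel) = ennreal I"
    unfolding I_def by (intro nn_integral_eq_integral integrable_abs i\<chi>') auto
  have main: "\<bar>lowpass_op \<phi> b h x - lowpass_op \<phi> b h y\<bar> \<le> (T * b * I + b\<^sup>2 * M * N) * (x - y)"
    if b: "0 < b" and hm[measurable]: "h \<in> borel_measurable borel" and hA: "\<And>x. \<bar>h x\<bar> \<le> A"
      and T: "0 \<le> T" and N: "0 \<le> N" and gm[measurable]: "g \<in> borel_measurable borel" and g0: "\<And>z. 0 \<le> g z"
      and hTg: "AE z in lborel. \<bar>h z\<bar> \<le> T + g z" and gN: "(\<integral>\<^sup>+ z. ennreal (g z) \<partial>lborel) \<le> ennreal N"
      and yx: "y \<le> x" for b h A T g N x y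
  proof -
    define k where "k w = b * low_kernel \<phi> (b * w)" for w
    define k' where "k' w = b\<^sup>2 * \<chi>' (b * w)" for w
    have km[measurable]: "k \<in> borel_measurable borel" unfolding k_def[abs_def] by measurable
    have k'm[measurable]: "k' \<in> borel_measurable borel" unfolding k'_def[abs_def] by measurable
    have ck': "continuous_on S k'" for S
      unfolding k'_def[abs_def] by (intro continuous_intros continuous_on_compose2[OF c\<chi>']) auto
    have dk: "((\<lambda>s. k (s - z)) has_real_derivative k' (s - z)) (at s)" for s z
      unfolding k_def k'_def by (auto intro!: derivative_eq_intros DERIV_chain2[OF d\<chi>] simp: power2_eq_square)
    have ikh: "integrable lborel (\<lambda>z. k (x - z) * h z)" for x
      unfolding k_def mult.assoc using b
      by (intro integrable_mult_right integrable_kernel_mult_bounded(1)[OF low_kernel_integrable[OF dp] hm hA]) auto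
    let ?G = "\<lambda>s z. ennreal (\<bar>k' (s - z)\<bar> * \<bar>h z\<bar>)"
    define c where "c = T * b * I + b\<^sup>2 * M * N"
    have inner: "(\<integral>\<^sup>+ z. ?G s z \<partial>lborel) \<le> ennreal c" for s
    proof -
      have "(\<integral>\<^sup>+ z. ?G s z \<partial>lborel)
          \<le> (\<integral>\<^sup>+ z. ennreal T * ennreal \<bar>k' (s - z)\<bar> + ennreal (b\<^sup>2 * M) * ennreal (g z) \<partial>lborel)"
      proof (rule nn_integral_mono_AE)
        show "AE z in lborel. ?G s z \<le> ennreal T * ennreal \<bar>k' (s - z)\<bar> + ennreal (b\<^sup>2 * M) * ennreal (g z)"
          using hTg
        proof eventually_elim
          case (elim z)
          have "\<bar>k' (s - z)\<bar> * \<bar>h z\<bar> \<le> \<bar>k' (s - z)\<bar> * (T + g z)" using elim by (intro mult_left_mono) auto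
          also have "\<dots> = T * \<bar>k' (s - z)\<bar> + \<bar>k' (s - z)\<bar> * g z" by (simp add: algebra_simps)
          also have "\<bar>k' (s - z)\<bar> * g z \<le> (b\<^sup>2 * M) * g z"
            using \<chi>'M g0 by (intro mult_right_mono) (auto simp: k'_def abs_mult intro!: mult_left_mono)
          finally have "?G s z \<le> ennreal (T * \<bar>k' (s - z)\<bar> + (b\<^sup>2 * M) * g z)"
            by (intro ennreal_leI) simp
          also have "\<dots> = ennreal T * ennreal \<bar>k' (s - z)\<bar> + ennreal (b\<^sup>2 * M) * ennreal (g z)"
            using T g0 M by (simp add: ennreal_plus ennreal_mult)
          finally show ?case .
        qed
      qed
      also have "\<dots> = ennreal T * (\<integral>\<^sup>+ z. ennreal \<bar>k' (s - z)\<bar> \<partial>lborel) + ennreal (b\<^sup>2 * M) * (\<integral>\<^sup>+ z. ennreal (g z) \<partial>lborel)"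
        by (simp add: nn_integral_add nn_integral_cmult)
      also have "(\<integral>\<^sup>+ z. ennreal \<bar>k' (s - z)\<bar> \<partial>lborel) = ennreal (b * I)"
      proof -
        have "(\<integral>\<^sup>+ w. ennreal \<bar>\<chi>' w\<bar> \<partial>lborel) = ennreal b * (\<integral>\<^sup>+ z. ennreal \<bar>\<chi>' (b * s + (- b) * z)\<bar> \<partial>lborel)"
          using nn_integral_real_affine[of "\<lambda>w. ennreal \<bar>\<chi>' w\<bar>" "- b" "b * s"] b by simp
        then have "ennreal (b * I) = ennreal b * (ennreal b * (\<integral>\<^sup>+ z. ennreal \<bar>\<chi>' (b * s + (- b) * z)\<bar> \<partial>lborel))"
          using b I0 by (simp add: nnI ennreal_mult)
        also have "\<dots> = (\<integral>\<^sup>+ z. ennreal (b\<^sup>2) * ennreal \<bar>\<chi>' (b * s + (- b) * z)\<bar> \<partial>lborel)"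
          using b by (subst nn_integral_cmult) (auto simp: power2_eq_square ennreal_mult mult.assoc)
        also have "\<dots> = (\<integral>\<^sup>+ z. ennreal \<bar>k' (s - z)\<bar> \<partial>lborel)"
          by (intro nn_integral_cong) (simp add: k'_def abs_mult ennreal_mult right_diff_distrib)
        finally show ?thesis by simp
      qed
      also have "ennreal T * ennreal (b * I) + ennreal (b\<^sup>2 * M) * (\<integral>\<^sup>+ z. ennreal (g z) \<partial>lborel)
          \<le> ennreal T * ennreal (b * I) + ennreal (b\<^sup>2 * M) * ennreal N"
        by (intro add_left_mono mult_left_mono gN) auto
      also have "\<dots> = ennreal c"
        using T b I0 M N by (simp add: c_def ennreal_plus ennreal_mult mult.assoc)
      finally show ?thesis .
    qed
    have c0: "0 \<le> c" using T b I0 M N by (simp add: c_def)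
    have diff: "lowpass_op \<phi> b h x - lowpass_op \<phi> b h y = (\<integral>z. (k (x - z) - k (y - z)) * h z \<partial>lborel)"
      unfolding lowpass_op_def left_diff_distrib
      by (subst Bochner_Integration.integral_diff[OF ikh ikh]) (simp add: k_def)
    have "ennreal \<bar>lowpass_op \<phi> b h x - lowpass_op \<phi> b h y\<bar>
        \<le> (\<integral>\<^sup>+ z. ennreal (norm ((k (x - z) - k (y - z)) * h z)) \<partial>lborel)"
      unfolding diff real_norm_def[symmetric]
      by (intro integral_norm_bound_ennreal) (simp add: left_diff_distrib ikh)
    \<comment> \<open>The difference of the kernels at x and y is the integral of the derivative
      over [y, x]. With nonnegative integrals the order can be exchanged without an integrability
      proof, and \<open>inner\<close> then bounds the contribution of each s.\<close>
    also have "\<dots> \<le> (\<integral>\<^sup>+ z. (\<integral>\<^sup>+ s. indicator {y..x} s * ?G s z \<partial>lborel) \<partial>lborel)"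
    proof (rule nn_integral_mono)
      fix z
      have "set_integrable lborel {y..x} (\<lambda>s. k' (s - z))"
        by (intro borel_integrable_atLeastAtMost' continuous_on_compose2[OF ck'[of UNIV]] continuous_intros) auto
      then have i: "integrable lborel (\<lambda>s. k' (s - z) * indicator {y..x} s)"
        by (simp add: set_integrable_def mult.commute)
      have "(\<integral>s. k' (s - z) * indicator {y..x} s \<partial>lborel) = k (x - z) - k (y - z)"
      proof (rule integral_FTC_Icc_real[OF yx])
        have "continuous_on UNIV (\<lambda>s. k' (s - z))"
          by (intro continuous_on_compose2[OF ck'[of UNIV]] continuous_intros) auto
        then show "isCont (\<lambda>s. k' (s - z)) s" for s by (simp add: continuous_on_eq_continuous_at)
      qed (rule dk)
      then have "ennreal \<bar>k (x - z) - k (y - z)\<bar> \<le> (\<integral>\<^sup>+ s. ennreal (norm (k' (s - z) * indicator {y..x} s)) \<partial>lborel)"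
        using integral_norm_bound_ennreal[OF i] by simp
      also have "\<dots> = (\<integral>\<^sup>+ s. indicator {y..x} s * ennreal \<bar>k' (s - z)\<bar> \<partial>lborel)"
        by (intro nn_integral_cong) (auto simp: indicator_def)
      finally have "ennreal \<bar>k (x - z) - k (y - z)\<bar> * ennreal \<bar>h z\<bar>
          \<le> (\<integral>\<^sup>+ s. indicator {y..x} s * ennreal \<bar>k' (s - z)\<bar> \<partial>lborel) * ennreal \<bar>h z\<bar>"
        by (intro mult_right_mono) auto
      also have "\<dots> = (\<integral>\<^sup>+ s. indicator {y..x} s * ?G s z \<partial>lborel)"
        by (subst nn_integral_multc[symmetric]) (auto simp: ennreal_mult mult.assoc)
      finally show "ennreal (norm ((k (x - z) - k (y - z)) * h z))
          \<le> (\<integral>\<^sup>+ s. indicator {y..x} s * ?G s z \<partial>lborel)"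
        by (simp add: abs_mult ennreal_mult)
    qed
    also have "\<dots> = (\<integral>\<^sup>+ s. (\<integral>\<^sup>+ z. indicator {y..x} s * ?G s z \<partial>lborel) \<partial>lborel)"
      by (rule lborel_pair.Fubini') measurable
    also have "\<dots> \<le> (\<integral>\<^sup>+ s. ennreal c * indicator {y..x} s \<partial>lborel)"
    proof (rule nn_integral_mono)
      fix s
      have "(\<integral>\<^sup>+ z. indicator {y..x} s * ?G s z \<partial>lborel)
          = indicator {y..x} s * (\<integral>\<^sup>+ z. ?G s z \<partial>lborel)"
        by (rule nn_integral_cmult) measurable
      also have "\<dots> \<le> indicator {y..x} s * ennreal c" by (intro mult_left_mono inner) auto
      finally show "(\<integral>\<^sup>+ z. indicator {y..x} s * ?G s z \<partial>lborel) \<le> ennreal c * indicator {y..x} s"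
        by (simp add: mult.commute)
    qed
    also have "\<dots> = ennreal (c * (x - y))"
      using yx c0 by (subst nn_integral_cmult_indicator) (auto simp: ennreal_mult)
    finally show ?thesis using c0 yx by (simp add: c_def)
  qed
  show ?thesis
  proof (rule exI[of _ I], rule exI[of _ M], intro conjI allI impI)
    fix b A T N x y :: real and h g :: "real \<Rightarrow> real"
    assume *: "0 < (b::real)" "h \<in> borel_measurable borel" "\<forall>x. \<bar>h x\<bar> \<le> (A::real)" "0 \<le> (T::real)" "0 \<le> (N::real)"
      "g \<in> borel_measurable borel" "\<forall>z. 0 \<le> (g z :: real)" "AE z in lborel. \<bar>h z\<bar> \<le> T + g z"
      "(\<integral>\<^sup>+ z. ennreal (g z) \<partial>lborel) \<le> ennreal N"
    show "\<bar>lowpass_op \<phi> b h x - lowpass_op \<phi> b h y\<bar> \<le> (T * b * I + b\<^sup>2 * M * N) * \<bar>x - y\<bar>"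
    proof (cases "y \<le> x")
      case True
      with main[OF *(1,2) _ *(4-6) _ *(8,9), of A y x] *(3,7) show ?thesis by simp
    next
      case False
      with main[OF *(1,2) _ *(4-6) _ *(8,9), of A x y] *(3,7) show ?thesis by (simp add: abs_minus_commute)
    qed
  qed (use I0 M in auto)
qed

lemma dyadic_block_eq:
  fixes f :: "real \<Rightarrow> real" and j :: int
  defines "a \<equiv> 2 powr (real_of_int j)"
  shows "dyadic_block \<phi> j f x = (\<integral>y. a * band_kernel \<phi> (a * (x - y)) * f y \<partial>lborel)"
proof -
  have a: "0 < a" by (simp add: a_def)
  have eq: "(\<lambda>\<xi>. \<phi> (2 powr (- real_of_int j) * \<xi>)) = (\<lambda>\<xi>. \<phi> (\<xi> / a))"
    by (simp add: a_def powr_minus divide_inverse mult.commute)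
  have "integrable lborel (\<lambda>\<xi>. \<phi> (0 + (1 / a) * \<xi>))"
    using a by (intro lborel_integrable_real_affine integrable_\<phi>[OF dp]) auto
  then have i: "integrable lborel (\<lambda>\<xi>. \<phi> (\<xi> / a))" by simp
  show ?thesis
    unfolding dyadic_block_def eq Re_inverse_fourier[OF i] cos_kernel_dilate[OF a] cos_kernel_\<phi>[OF dp] ..
qed

lemma dyadic_block_eq_lowpass_diff:
  fixes f :: "real \<Rightarrow> real" and j :: int
  assumes f: "f \<in> borel_measurable borel" "\<And>x. \<bar>f x\<bar> \<le> A"
  shows "dyadic_block \<phi> j f x = lowpass_op \<phi> (2 powr (real_of_int j)) f x - lowpass_op \<phi> (2 powr (real_of_int (j - 1))) f x"
proof -
  define a where "a = 2 powr (real_of_int j)"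
  have a: "0 < a" by (simp add: a_def)
  have a2: "2 powr (real_of_int (j - 1)) = a / 2" by (simp add: a_def powr_diff)
  have i: "integrable lborel (\<lambda>y. b * low_kernel \<phi> (b * (x - y)) * f y)" if "0 < b" for b
    unfolding mult.assoc using that
    by (intro integrable_mult_right integrable_kernel_mult_bounded(1)[OF low_kernel_integrable[OF dp] f]) auto
  have "dyadic_block \<phi> j f x = (\<integral>y. a * low_kernel \<phi> (a * (x - y)) * f y - a/2 * low_kernel \<phi> (a/2 * (x - y)) * f y \<partial>lborel)"
    unfolding dyadic_block_eq a_def[symmetric]
    by (intro Bochner_Integration.integral_cong refl) (simp add: band_kernel_def[OF dp] algebra_simps)
  also have "\<dots> = lowpass_op \<phi> a f x - lowpass_op \<phi> (a / 2) f x"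
    unfolding lowpass_op_def using a by (intro Bochner_Integration.integral_diff i) auto
  finally show ?thesis by (simp only: a2 a_def)
qed

text \<open>Dilates of \<open>low_kernel \<phi>\<close> form an approximate identity; their mass 1
  is the value of the multiplier at frequency 0.\<close>

lemma lowpass_op_tendsto:
  assumes f: "continuous_on UNIV f" "\<And>x. \<bar>f x\<bar> \<le> A"
  shows "(\<lambda>n. lowpass_op \<phi> (2 ^ n) f x) \<longlonglongrightarrow> f x"
proof -
  have fm[measurable]: "f \<in> borel_measurable borel" by (rule borel_measurable_continuous_onI[OF f(1)])
  have \<chi>m[measurable]: "low_kernel \<phi> \<in> borel_measurable borel"
    by (rule borel_measurable_continuous_onI[OF low_kernel_continuous[OF dp]])
  have eq: "lowpass_op \<phi> (2 ^ n) f x = (\<integral>z. low_kernel \<phi> z * f (x - z / 2 ^ n) \<partial>lborel)" for n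
    unfolding lowpass_op_def
    by (subst lborel_integral_real_affine[where c="- (1 / 2 ^ n)" and t=x]) (auto simp: mult.assoc)
  have "(\<lambda>n. \<integral>z. low_kernel \<phi> z * f (x - z / 2 ^ n) \<partial>lborel) \<longlonglongrightarrow> (\<integral>z. low_kernel \<phi> z * f x \<partial>lborel)"
  proof (rule integral_dominated_convergence[where w="\<lambda>z. \<bar>low_kernel \<phi> z\<bar> * A"])
    show "integrable lborel (\<lambda>z. \<bar>low_kernel \<phi> z\<bar> * A)"
      by (intro integrable_mult_left integrable_abs low_kernel_integrable[OF dp])
    show "AE z in lborel. (\<lambda>n. low_kernel \<phi> z * f (x - z / 2 ^ n)) \<longlonglongrightarrow> low_kernel \<phi> z * f x"
    proof (rule AE_I2)
      fix z :: real
      have "(\<lambda>n. z / 2 ^ n) \<longlonglongrightarrow> 0" by (rule LIMSEQ_divide_realpow_zero) simp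
      then have "(\<lambda>n. x - z / 2 ^ n) \<longlonglongrightarrow> x - 0" by (intro tendsto_intros)
      then have "(\<lambda>n. f (x - z / 2 ^ n)) \<longlonglongrightarrow> f x"
        by (intro continuous_on_tendsto_compose[OF f(1)]) auto
      then show "(\<lambda>n. low_kernel \<phi> z * f (x - z / 2 ^ n)) \<longlonglongrightarrow> low_kernel \<phi> z * f x"
        by (intro tendsto_intros)
    qed
    show "AE z in lborel. norm (low_kernel \<phi> z * f (x - z / 2 ^ n)) \<le> \<bar>low_kernel \<phi> z\<bar> * A" for n
      using f(2) by (intro AE_I2) (auto simp: abs_mult intro!: mult_left_mono)
  qed measurable
  moreover have "(\<integral>z. low_kernel \<phi> z \<partial>lborel) = 1"
    using low_kernel_inversion[OF dp, of 0] lowpass_eq_1[OF dp, of 0] by simp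
  ultimately show ?thesis by (simp add: eq)
qed

lemma dyadic_block_bounded_measurable:
  assumes f: "f \<in> borel_measurable borel" "\<And>x. \<bar>f x\<bar> \<le> A"
  shows "dyadic_block \<phi> j f \<in> borel_measurable borel" and "\<exists>B. \<forall>x. \<bar>dyadic_block \<phi> j f x\<bar> \<le> B"
proof -
  define a where "a = 2 powr (real_of_int j)"
  have a: "0 < a" by (simp add: a_def)
  note [measurable] = f(1)
  have Km[measurable]: "band_kernel \<phi> \<in> borel_measurable borel"
    by (rule borel_measurable_continuous_onI[OF band_kernel_continuous[OF dp]])
  show "dyadic_block \<phi> j f \<in> borel_measurable borel"
    unfolding dyadic_block_eq[abs_def] by measurable
  have "\<bar>dyadic_block \<phi> j f x\<bar> \<le> a * (A / \<bar>a\<bar> * (\<integral>y. \<bar>band_kernel \<phi> y\<bar> \<partial>lborel))" for x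
  proof -
    have "\<bar>dyadic_block \<phi> j f x\<bar> = a * \<bar>\<integral>y. band_kernel \<phi> (a * (x - y)) * f y \<partial>lborel\<bar>"
      unfolding dyadic_block_eq a_def[symmetric] mult.assoc using a by (simp add: abs_mult)
    also have "\<dots> \<le> a * (\<integral>y. \<bar>band_kernel \<phi> (a * (x - y)) * f y\<bar> \<partial>lborel)"
      using a by (intro mult_left_mono integral_abs_bound) auto
    also have "\<dots> \<le> a * (A / \<bar>a\<bar> * (\<integral>y. \<bar>band_kernel \<phi> y\<bar> \<partial>lborel))"
      using a by (intro mult_left_mono integrable_kernel_mult_bounded(2)[OF band_kernel_integrable[OF dp] f]) auto
    finally show ?thesis .
  qed
  then show "\<exists>B. \<forall>x. \<bar>dyadic_block \<phi> j f x\<bar> \<le> B" by blast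
qed

text \<open>Makes a block accessible to \<open>lowpass_op_lipschitz\<close>: being its own low-pass
  convolution, it obtains a Lipschitz bound from its size alone.\<close>

lemma dyadic_block_reproducing:
  assumes f[measurable]: "f \<in> borel_measurable borel" and A: "\<And>x. \<bar>f x\<bar> \<le> A"
  shows "lowpass_op \<phi> (2 * 2 powr (real_of_int j)) (dyadic_block \<phi> j f) x = dyadic_block \<phi> j f x"
proof -
  define a where "a = 2 powr (real_of_int j)"
  have a: "0 < a" by (simp add: a_def)
  have Km[measurable]: "band_kernel \<phi> \<in> borel_measurable borel"
    by (rule borel_measurable_continuous_onI[OF band_kernel_continuous[OF dp]])
  have \<chi>m[measurable]: "low_kernel \<phi> \<in> borel_measurable borel"
    by (rule borel_measurable_continuous_onI[OF low_kernel_continuous[OF dp]])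
  define k where "k z = 2 * a * low_kernel \<phi> (2 * a * (x - z))" for z
  have k_m[measurable]: "k \<in> borel_measurable borel" unfolding k_def[abs_def] by measurable
  have ik: "integrable lborel k"
    unfolding k_def[abs_def]
    using integrable_kernel_mult_bounded(1)[OF low_kernel_integrable[OF dp], of "\<lambda>_. 1" 1 "2 * a" x] a
    by (intro integrable_mult_right) simp
  let ?J = "A / \<bar>a\<bar> * (\<integral>y. \<bar>band_kernel \<phi> y\<bar> \<partial>lborel)"
  have iK: "integrable lborel (\<lambda>y. band_kernel \<phi> (a * (z - y)) * f y)"
    and iK': "(\<integral>y. \<bar>band_kernel \<phi> (a * (z - y)) * f y\<bar> \<partial>lborel) \<le> ?J" for z
    using integrable_kernel_mult_bounded[OF band_kernel_integrable[OF dp] f A, of a z] a by auto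
  have "lowpass_op \<phi> (2 * a) (dyadic_block \<phi> j f) x = (\<integral>z. \<integral>y. k z * (a * (band_kernel \<phi> (a * (z - y)) * f y)) \<partial>lborel \<partial>lborel)"
    unfolding lowpass_op_def dyadic_block_eq a_def[symmetric] k_def by (simp add: mult.assoc)
  also have "\<dots> = (\<integral>y. \<integral>z. k z * (a * (band_kernel \<phi> (a * (z - y)) * f y)) \<partial>lborel \<partial>lborel)"
  proof (rule lborel_Fubini_swap[symmetric])
    show "integrable lborel (\<lambda>z. \<bar>k z\<bar> * (a * ?J))" by (intro integrable_mult_left integrable_abs ik)
    show "integrable lborel (\<lambda>y. k z * (a * (band_kernel \<phi> (a * (z - y)) * f y)))" for z
      by (intro integrable_mult_right iK)
    show "(\<integral>y. \<bar>k z * (a * (band_kernel \<phi> (a * (z - y)) * f y))\<bar> \<partial>lborel) \<le> \<bar>k z\<bar> * (a * ?J)" for z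
    proof -
      have "(\<integral>y. \<bar>k z * (a * (band_kernel \<phi> (a * (z - y)) * f y))\<bar> \<partial>lborel)
          = \<bar>k z\<bar> * (a * (\<integral>y. \<bar>band_kernel \<phi> (a * (z - y)) * f y\<bar> \<partial>lborel))"
        using a by (simp add: abs_mult flip: integral_mult_right_zero)
      also have "\<dots> \<le> \<bar>k z\<bar> * (a * ?J)" using a iK'[of z] by (intro mult_left_mono) auto
      finally show ?thesis .
    qed
  qed measurable
  also have "\<dots> = (\<integral>y. a * band_kernel \<phi> (a * (x - y)) * f y \<partial>lborel)"
  proof (intro Bochner_Integration.integral_cong refl)
    fix y
    have "(\<integral>z. k z * (a * (band_kernel \<phi> (a * (z - y)) * f y)) \<partial>lborel)
        = (a * f y) * (\<integral>z. k z * band_kernel \<phi> (a * (z - y)) \<partial>lborel)"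
      by (simp add: mult_ac flip: integral_mult_right_zero)
    also have "(\<integral>z. k z * band_kernel \<phi> (a * (z - y)) \<partial>lborel)
        = (\<integral>t. 2 * low_kernel \<phi> (2 * t) * band_kernel \<phi> (a * (x - y) - t) \<partial>lborel)"
    proof -
      \<comment> \<open>The substitution z = x - t/a removes the scale a and leaves the identity
        \<open>band_kernel_reproducing\<close>.\<close>
      have 1: "k (x + - (1 / a) * t) = a * (2 * low_kernel \<phi> (2 * t))" for t
        using a by (simp add: k_def)
      have 2: "a * (x + - (1 / a) * t - y) = a * (x - y) - t" for t
        using a by (simp add: algebra_simps)
      have "(\<integral>z. k z * band_kernel \<phi> (a * (z - y)) \<partial>lborel)
          = \<bar>- (1 / a)\<bar> *\<^sub>R (\<integral>t. k (x + - (1 / a) * t) * band_kernel \<phi> (a * (x + - (1 / a) * t - y)) \<partial>lborel)"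
        using a by (intro lborel_integral_real_affine) auto
      also have "\<dots> = (1 / a) * (\<integral>t. a * (2 * low_kernel \<phi> (2 * t) * band_kernel \<phi> (a * (x - y) - t)) \<partial>lborel)"
        unfolding 1 2 using a by (simp add: mult.assoc)
      finally show ?thesis using a by simp
    qed
    also have "\<dots> = band_kernel \<phi> (a * (x - y))" by (rule band_kernel_reproducing[OF dp])
    finally show "(\<integral>z. k z * (a * (band_kernel \<phi> (a * (z - y)) * f y)) \<partial>lborel) = a * band_kernel \<phi> (a * (x - y)) * f y"
      by (simp add: mult_ac)
  qed
  also have "\<dots> = dyadic_block \<phi> j f x" unfolding dyadic_block_eq a_def ..
  finally show ?thesis by (simp only: a_def)
qed

end

section \<open>Bounds contained in the norms\<close>

lemma epowr_ennreal: "0 \<le> a \<Longrightarrow> epowr (ennreal a) x = ennreal (a powr x)"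
  by (simp add: epowr_def)

lemma epowr_inverse_le:
  assumes "0 < R" "0 \<le> A" "epowr S (1 / R) \<le> ennreal A"
  shows "S \<le> ennreal (A powr R)"
proof (cases S)
  case (real a)
  have "a powr (1 / R) \<le> A" using assms(2,3) real by (simp add: epowr_ennreal)
  then have "(a powr (1 / R)) powr R \<le> A powr R" using assms(1) by (intro powr_mono2) auto
  then have "a \<le> A powr R" using assms(1) real by (simp add: powr_powr)
  then show ?thesis using real by (simp add: ennreal_leI)
next
  case top
  then show ?thesis using assms(3) by (simp add: epowr_def top_unique)
qed

lemma epowr_le_imp_le:
  assumes "0 < R" "0 \<le> A" "epowr F R \<le> ennreal (A powr R)"
  shows "F \<le> ennreal A"
proof (cases F)
  case (real a)
  have "a powr R \<le> A powr R" using assms(3) real by (simp add: epowr_ennreal)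
  then have "a \<le> A" using powr_less_mono2[OF assms(1,2), of a] by (cases "a \<le> A") auto
  then show ?thesis using real by (simp add: ennreal_leI)
next
  case top
  then show ?thesis using assms(3) by (simp add: epowr_def top_unique)
qed

lemma enn2real_pos_exponent: "1 \<le> p \<Longrightarrow> p \<noteq> \<infinity> \<Longrightarrow> 1 \<le> enn2real p"
  by (cases p) auto

text \<open>The embedding of l^r into l^\<infinity>. Summability over the blocks can be given up,
  since s \<ge> 2 leaves a geometric factor to spare when p > 1.\<close>

lemma sequence_norm_ge_term:
  fixes F :: "int \<Rightarrow> ennreal"
  assumes "Lp_norm (count_space UNIV) r F \<le> ennreal A" "1 \<le> r" "0 \<le> A"
  shows "F j \<le> ennreal A"
proof (cases "r = \<infinity>")
  case True
  have "AE i in count_space UNIV. F i \<le> esssup (count_space UNIV) F" by (rule esssup_AE)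
  then have "F j \<le> esssup (count_space UNIV) F" by (simp add: AE_count_space)
  also have "\<dots> \<le> ennreal A" using assms(1) True by (simp add: Lp_norm_def)
  finally show ?thesis .
next
  case False
  let ?R = "enn2real r"
  have R: "1 \<le> ?R" using enn2real_pos_exponent[OF assms(2) False] .
  have "(\<integral>\<^sup>+ i. epowr (F i) ?R \<partial>count_space UNIV) \<le> ennreal (A powr ?R)"
    using assms(1,3) False R by (intro epowr_inverse_le) (auto simp: Lp_norm_def)
  moreover have "epowr (F j) ?R \<le> (\<integral>\<^sup>+ i. epowr (F i) ?R \<partial>count_space UNIV)"
    by (rule nn_integral_ge_point) simp
  ultimately have "epowr (F j) ?R \<le> ennreal (A powr ?R)" by (rule order_trans[rotated])
  then show ?thesis using R assms(3) by - (rule epowr_le_imp_le[of ?R], auto)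
qed

lemma L_norm_infinity_AE:
  assumes "L_norm \<infinity> f \<le> ennreal A" "0 \<le> A"
  shows "AE x in lborel. \<bar>f x\<bar> \<le> A"
proof -
  have "AE x in lborel. ennreal \<bar>f x\<bar> \<le> esssup lborel (\<lambda>x. ennreal \<bar>f x\<bar>)" by (rule esssup_AE)
  then show ?thesis
  proof eventually_elim
    case (elim x)
    also have "esssup lborel (\<lambda>x. ennreal \<bar>f x\<bar>) \<le> ennreal A" using assms(1) by (simp add: L_norm_def Lp_norm_def)
    finally show ?case using assms(2) by simp
  qed
qed

lemma L_norm_infinity_bound:
  assumes "continuous_on UNIV f" "L_norm \<infinity> f \<le> ennreal A" "0 \<le> A"
  shows "\<bar>f x\<bar> \<le> A"
proof (rule AE_le_imp_le[where f="\<lambda>x. \<bar>f x\<bar>" and g="\<lambda>_. A"])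
  show "continuous_on UNIV (\<lambda>x. \<bar>f x\<bar>)" by (intro continuous_on_rabs assms(1))
  show "AE x in lborel. \<bar>f x\<bar> \<le> A" by (rule L_norm_infinity_AE[OF assms(2,3)])
qed (rule continuous_on_const)

lemma L_norm_finite_exponent:
  assumes "L_norm p f \<le> ennreal A" "1 \<le> p" "p \<noteq> \<infinity>" "0 \<le> A"
  shows "(\<integral>\<^sup>+ x. ennreal (\<bar>f x\<bar> powr enn2real p) \<partial>lborel) \<le> ennreal (A powr enn2real p)"
proof -
  have "(\<integral>\<^sup>+ x. epowr (ennreal \<bar>f x\<bar>) (enn2real p) \<partial>lborel) \<le> ennreal (A powr enn2real p)"
    using assms enn2real_pos_exponent[OF assms(2,3)]
    by (intro epowr_inverse_le) (auto simp: L_norm_def Lp_norm_def)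
  then show ?thesis by (simp add: epowr_ennreal)
qed

section \<open>Lipschitz constants from the blocks\<close>

context
  fixes \<phi> :: "real \<Rightarrow> real"
  assumes dp: "dyadic_partition \<phi>"
begin

text \<open>f is the limit of its low-pass convolutions, and consecutive ones differ by one block.
  The Lipschitz constants of the blocks add up to a geometric series on top of that of the low
  frequencies.\<close>

lemma lipschitz_from_blocks:
  assumes f: "continuous_on UNIV f" "\<And>x. \<bar>f x\<bar> \<le> A"
    and low: "\<bar>lowpass_op \<phi> 1 f x - lowpass_op \<phi> 1 f y\<bar> \<le> K * \<bar>x - y\<bar>"
    and blocks: "\<And>n. \<bar>dyadic_block \<phi> (int (Suc n)) f x - dyadic_block \<phi> (int (Suc n)) f y\<bar> \<le> D * \<rho> ^ n * \<bar>x - y\<bar>"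
    and D: "0 \<le> D" and \<rho>: "0 \<le> \<rho>" "\<rho> < 1"
  shows "\<bar>f x - f y\<bar> \<le> (K + D / (1 - \<rho>)) * \<bar>x - y\<bar>"
proof -
  have fm: "f \<in> borel_measurable borel" by (rule borel_measurable_continuous_onI[OF f(1)])
  have b: "dyadic_block \<phi> (int (Suc n)) f z = lowpass_op \<phi> (2 ^ Suc n) f z - lowpass_op \<phi> (2 ^ n) f z" for n z
    using dyadic_block_eq_lowpass_diff[OF dp fm f(2), of "int (Suc n)" z] by (simp add: powr_realpow[symmetric] powr_add)
  have part: "\<bar>lowpass_op \<phi> (2 ^ n) f x - lowpass_op \<phi> (2 ^ n) f y\<bar> \<le> (K + (\<Sum>i<n. D * \<rho> ^ i)) * \<bar>x - y\<bar>" for n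
  proof (induction n)
    case 0
    then show ?case using low by simp
  next
    case (Suc n)
    then show ?case using blocks[of n] unfolding b by (simp add: algebra_simps)
  qed
  have sum: "(\<Sum>i<n. D * \<rho> ^ i) \<le> D / (1 - \<rho>)" for n
  proof -
    have "(\<Sum>i<n. \<rho> ^ i) \<le> (\<Sum>i. \<rho> ^ i)"
      using \<rho> by (intro sum_le_suminf summable_geometric) auto
    also have "\<dots> = 1 / (1 - \<rho>)" using \<rho> by (intro suminf_geometric) auto
    finally have "D * (\<Sum>i<n. \<rho> ^ i) \<le> D * (1 / (1 - \<rho>))" using D by (intro mult_left_mono) auto
    then show ?thesis by (simp add: sum_distrib_left)
  qed
  have le: "\<bar>lowpass_op \<phi> (2 ^ n) f x - lowpass_op \<phi> (2 ^ n) f y\<bar> \<le> (K + D / (1 - \<rho>)) * \<bar>x - y\<bar>" for n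
    using sum[of n] by (intro order_trans[OF part] mult_right_mono) auto
  have "(\<lambda>n. \<bar>lowpass_op \<phi> (2 ^ n) f x - lowpass_op \<phi> (2 ^ n) f y\<bar>) \<longlonglongrightarrow> \<bar>f x - f y\<bar>"
    by (intro tendsto_intros lowpass_op_tendsto[OF dp f])
  then show ?thesis by (rule LIMSEQ_le_const2) (use le in blast)
qed

lemma E_norm_components:
  assumes "E_norm \<phi> s p q r f \<le> ennreal A"
  shows "L_norm \<infinity> f \<le> ennreal A" "besov_norm \<phi> s p r f \<le> ennreal A" "W1_norm q f \<le> ennreal A"
proof -
  have le: "x \<le> x + y + z + w" "y \<le> x + y + z + w" "w \<le> x + y + z + w" for x y z w :: ennreal
    by (simp_all add: add_increasing2 add_increasing)
  show "L_norm \<infinity> f \<le> ennreal A" "besov_norm \<phi> s p r f \<le> ennreal A" "W1_norm q f \<le> ennreal A"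
    using assms unfolding E_norm_def by (rule order_trans[OF le(1)] order_trans[OF le(2)] order_trans[OF le(3)])+
qed

text \<open>For n \<ge> 0 the weight 2^(n s) is at least 2^(2n), so one decay rate serves every
  admissible s.\<close>

lemma besov_block_bound:
  assumes "besov_norm \<phi> s p r f \<le> ennreal A" "2 \<le> s" "1 \<le> r" "0 \<le> A"
  shows "L_norm p (dyadic_block \<phi> (int n) f) \<le> ennreal (A * 2 powr (- 2 * real n))"
proof -
  let ?L = "L_norm p (dyadic_block \<phi> (int n) f)"
  have *: "ennreal (2 powr (real_of_int (int n) * s)) * ?L \<le> ennreal A"
    using sequence_norm_ge_term[OF assms(1)[unfolded besov_norm_def] assms(3,4), of "int n"] .
  show ?thesis
  proof (cases ?L)
    case (real l)
    have "2 powr (2 * real n) * l \<le> 2 powr (real n * s) * l"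
      using assms(2) real mult_left_mono[of 2 s "real n"] by (intro mult_right_mono powr_mono) (auto simp: mult.commute)
    also have "\<dots> \<le> A" using * real assms(4) by (simp add: ennreal_mult[symmetric])
    finally have "l \<le> A * 2 powr (- 2 * real n)"
      by (simp add: powr_minus field_simps)
    then show ?thesis using real by (simp add: ennreal_leI)
  next
    case top
    with * show ?thesis by (simp add: ennreal_mult_top top_unique)
  qed
qed

lemma W1_infinity_lipschitz:
  assumes f: "continuous_on UNIV f" and W: "W1_norm \<infinity> f \<le> ennreal A" and A: "0 \<le> A"
  shows "\<bar>f x - f y\<bar> \<le> (A + 1) * \<bar>x - y\<bar>"
proof -
  \<comment> \<open>The norm is an infimum over weak derivatives; the strict inequality yields an
    actual one with bound A + 1.\<close>
  have "W1_norm \<infinity> f < ennreal (A + 1)" using A by (intro le_less_trans[OF W] ennreal_lessI) auto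
  then obtain g where g: "weak_derivative f g" "L_norm \<infinity> g < ennreal (A + 1)"
    unfolding W1_norm_def by (auto simp: INF_less_iff)
  have ae: "AE z in lborel. \<bar>g z\<bar> \<le> A + 1" using A g(2) by (intro L_norm_infinity_AE) auto
  have loc: "locally_integrable g" using g(1) by (simp add: weak_derivative_def)
  have *: "\<bar>f y - f x\<bar> \<le> (A + 1) * (y - x)" if "x \<le> y" for x y
  proof -
    have "\<bar>1 * (LINT z:{x..y}|lborel. g z) - (y - x) * 0\<bar> \<le> (A + 1) * (y - x)"
      by (rule set_integral_AE_near_const[OF loc that]) (use ae in eventually_elim, simp)
    then show ?thesis by (simp add: weak_derivative_FTC[OF dp g(1) f that])
  qed
  show ?thesis using *[of x y] *[of y x] by (cases "x \<le> y") (auto simp: abs_minus_commute)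
qed

text \<open>Where \<bar>h\<bar> > T, the negative exponent 1 - P makes \<bar>h\<bar>^(1-P) at most
  T^(1-P). The two summands are the bounded and the integrable part in
  \<open>lowpass_op_lipschitz\<close>.\<close>

lemma powr_tail_split:
  fixes h P T :: real
  assumes "1 < P" "0 < T"
  shows "\<bar>h\<bar> \<le> T + T powr (1 - P) * \<bar>h\<bar> powr P"
proof (cases "\<bar>h\<bar> \<le> T")
  case True
  moreover have "0 \<le> T powr (1 - P) * \<bar>h\<bar> powr P" by simp
  ultimately show ?thesis by linarith
next
  case False
  then have h: "T \<le> \<bar>h\<bar>" "0 < \<bar>h\<bar>" using assms(2) by auto
  have "\<bar>h\<bar> = \<bar>h\<bar> powr (1 - P) * \<bar>h\<bar> powr P" using h by (simp add: powr_add[symmetric])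
  also have "\<dots> \<le> T powr (1 - P) * \<bar>h\<bar> powr P"
    using assms h by (intro mult_right_mono powr_mono2') auto
  finally show ?thesis using assms(2) by linarith
qed

text \<open>For \<open>p > 1\<close> this is Bernstein's inequality summed over the dyadic blocks, convergent because
  \<open>s \<ge> 2 > 1 + 1/p\<close>; \<open>powr_tail_split\<close> with \<open>T = 2\<^sup>-\<^sup>2\<^sup>n\<^sup>+\<^sup>n\<^sup>/\<^sup>p\<close> replaces Hoelder's inequality.  For
  \<open>p = 1\<close> the norm contains that of \<open>W\<^sup>1\<^sup>,\<^sup>\<infinity>\<close>.\<close>

lemma E_norm_imp_lipschitz:
  assumes adm: "admissible s p r" and pq: "1 / p + 1 / q = 1" and A: "0 \<le> A"
  shows "\<exists>K. \<forall>f. continuous_on UNIV f \<longrightarrow> E_norm \<phi> s p q r f \<le> ennreal A \<longrightarrow>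
    (\<forall>x y. \<bar>f x - f y\<bar> \<le> K * \<bar>x - y\<bar>)"
proof (cases "p = 1")
  case True
  have "(1::ennreal) / 1 = 1" using divide_ennreal[of 1 1] by simp
  then have "(1::ennreal) + 1 / q = 1 + 0" using pq True by simp
  then have "1 / q = 0" unfolding ennreal_add_left_cancel by simp
  then have q: "q = \<infinity>" by (simp add: ennreal_divide_eq_0_iff)
  have "\<bar>f x - f y\<bar> \<le> (A + 1) * \<bar>x - y\<bar>"
    if "continuous_on UNIV f" "E_norm \<phi> s p q r f \<le> ennreal A" for f x y
    using W1_infinity_lipschitz[OF that(1) _ A] E_norm_components(3)[OF that(2)] by (simp add: q)
  then show ?thesis by blast
next
  case False
  let ?D = "\<lambda>n. dyadic_block \<phi> (int (Suc n))"
  have s: "2 \<le> s" and p1: "1 \<le> p" and r1: "1 \<le> r" using adm by (auto simp: admissible_def)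
  obtain I M where I: "0 \<le> I" and M: "0 \<le> M" and
    "\<forall>b h A T g N x y. 0 < b \<longrightarrow> h \<in> borel_measurable borel \<longrightarrow> (\<forall>x. \<bar>h x\<bar> \<le> A) \<longrightarrow>
     0 \<le> T \<longrightarrow> 0 \<le> N \<longrightarrow> g \<in> borel_measurable borel \<longrightarrow> (\<forall>z. 0 \<le> g z) \<longrightarrow>
     (AE z in lborel. \<bar>h z\<bar> \<le> T + g z) \<longrightarrow> (\<integral>\<^sup>+ z. ennreal (g z) \<partial>lborel) \<le> ennreal N \<longrightarrow>
     \<bar>lowpass_op \<phi> b h x - lowpass_op \<phi> b h y\<bar> \<le> (T * b * I + b\<^sup>2 * M * N) * \<bar>x - y\<bar>"
    using lowpass_op_lipschitz[OF dp] by (elim exE conjE) (rule that)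
  note lip = this(3)[rule_format]
  \<comment> \<open>The low frequencies use the bound of f alone: T = A and no integrable
    part.\<close>
  have low: "\<bar>lowpass_op \<phi> 1 f x - lowpass_op \<phi> 1 f y\<bar> \<le> A * I * \<bar>x - y\<bar>"
    if f: "continuous_on UNIV f" "E_norm \<phi> s p q r f \<le> ennreal A" for f x y
  proof -
    have "\<bar>lowpass_op \<phi> 1 f x - lowpass_op \<phi> 1 f y\<bar> \<le> (A * 1 * I + 1\<^sup>2 * M * 0) * \<bar>x - y\<bar>"
      using L_norm_infinity_bound[OF f(1) E_norm_components(1)[OF f(2)] A] A
      by (intro lip[where A=A and g="\<lambda>_. 0"] borel_measurable_continuous_onI[OF f(1)]) auto
    then show ?thesis by simp
  qed
  have fA: "\<bar>f x\<bar> \<le> A" if f: "continuous_on UNIV f" "E_norm \<phi> s p q r f \<le> ennreal A" for f x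
    by (rule L_norm_infinity_bound[OF f(1) E_norm_components(1)[OF f(2)] A])
  have block: "\<bar>?D n f x - ?D n f y\<bar>
      \<le> (T * (2 * 2 powr real (Suc n)) * I + (2 * 2 powr real (Suc n))\<^sup>2 * M * N) * \<bar>x - y\<bar>"
    if f: "continuous_on UNIV f" "E_norm \<phi> s p q r f \<le> ennreal A" and TN: "0 \<le> T" "0 \<le> N"
      and g: "g \<in> borel_measurable borel" "\<And>z. 0 \<le> g z"
      and le: "AE z in lborel. \<bar>?D n f z\<bar> \<le> T + g z" "(\<integral>\<^sup>+ z. ennreal (g z) \<partial>lborel) \<le> ennreal N"
    for f n x y T N g
  proof -
    have fm: "f \<in> borel_measurable borel" by (rule borel_measurable_continuous_onI[OF f(1)])
    define h where "h = ?D n f"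
    have hm: "h \<in> borel_measurable borel"
      unfolding h_def by (rule dyadic_block_bounded_measurable(1)[OF dp fm fA[OF f]])
    obtain B where B: "\<And>x. \<bar>h x\<bar> \<le> B"
      unfolding h_def using dyadic_block_bounded_measurable(2)[OF dp fm fA[OF f]] by blast
    have rep: "lowpass_op \<phi> (2 * 2 powr real (Suc n)) h x = h x" for x
      unfolding h_def using dyadic_block_reproducing[OF dp fm fA[OF f], of "int (Suc n)"] by simp
    show ?thesis
      using lip[OF _ hm B TN g le[folded h_def], of "2 * 2 powr real (Suc n)" x y] unfolding rep by (simp add: h_def)
  qed
  have "\<exists>D \<rho>. 0 \<le> D \<and> 0 \<le> \<rho> \<and> \<rho> < 1 \<and> (\<forall>f n x y. continuous_on UNIV f \<longrightarrow> E_norm \<phi> s p q r f \<le> ennreal A \<longrightarrow>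
     \<bar>?D n f x - ?D n f y\<bar> \<le> D * \<rho> ^ n * \<bar>x - y\<bar>)"
  proof (cases "p = \<infinity>")
    case pinf: True
    \<comment> \<open>For p = \<infinity> the block is bounded by A 2^(-2m) and the Lipschitz bound
      costs a factor 2^(m+1) I; with m = n + 1 the powers of 2 combine to 2^(-n).\<close>
    have "\<bar>?D n f x - ?D n f y\<bar> \<le> (A * I) * (1/2) ^ n * \<bar>x - y\<bar>"
      if f: "continuous_on UNIV f" "E_norm \<phi> s p q r f \<le> ennreal A" for f n x y
    proof -
      define m where "m = real (Suc n)"
      define T where "T = A * 2 powr (- 2 * m)"
      have "AE z in lborel. \<bar>?D n f z\<bar> \<le> T"
        unfolding T_def m_def using besov_block_bound[OF E_norm_components(2)[OF f(2)] s r1 A, of "Suc n"] A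
        unfolding pinf by (intro L_norm_infinity_AE) auto
      then have "\<bar>?D n f x - ?D n f y\<bar>
          \<le> (T * (2 * 2 powr m) * I + (2 * 2 powr m)\<^sup>2 * M * 0) * \<bar>x - y\<bar>"
        using A unfolding m_def by (intro block[OF f, where g="\<lambda>_. 0"]) (auto simp: T_def)
      also have "T * (2 * 2 powr m) * I + (2 * 2 powr m)\<^sup>2 * M * 0 = (A * I) * (1/2) ^ n"
      proof -
        have "2 powr (- 2 * m) * (2 * 2 powr m) = 2 powr (- 2 * m) * (2 powr 1 * 2 powr m)" by simp
        also have "\<dots> = 2 powr (- 2 * m + (1 + m))" by (simp only: powr_add)
        also have "- 2 * m + (1 + m) = - real n" by (simp add: m_def)
        also have "2 powr (- real n) = (1/2) ^ n"
          by (simp add: powr_minus powr_realpow power_one_over inverse_eq_divide)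
        finally have "A * I * (2 powr (- 2 * m) * (2 * 2 powr m)) = A * I * (1/2) ^ n" by (simp only:)
        then show ?thesis unfolding T_def by (simp add: mult_ac)
      qed
      finally show ?thesis .
    qed
    then show ?thesis using A I by (intro exI[of _ "A * I"] exI[of _ "1/2"]) auto
  next
    case pfin: False
    define P where "P = enn2real p"
    have "P \<noteq> 1" using False pfin p1 unfolding P_def by (metis ennreal_1 ennreal_enn2real_if infinity_ennreal_def)
    then have P: "1 < P" using enn2real_pos_exponent[OF p1 pfin] unfolding P_def by linarith
    define \<rho> where "\<rho> = 2 powr (1 / P - 1)"
    have \<rho>: "0 \<le> \<rho>" "\<rho> < 1"
    proof -
      have "1 / P - 1 < 0" using P by simp
      then have "2 powr (1 / P - 1) < 2 powr 0" by (intro powr_less_mono) auto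
      then show "\<rho> < 1" "0 \<le> \<rho>" by (simp_all add: \<rho>_def)
    qed
    \<comment> \<open>The factors 2 and 4 stem from b = 2 * 2^m and its square.\<close>
    define D where "D = 2 * I + 4 * M * A powr P"
    have D: "0 \<le> D" using I M by (simp add: D_def)
    have "\<bar>?D n f x - ?D n f y\<bar> \<le> D * \<rho> ^ n * \<bar>x - y\<bar>"
      if f: "continuous_on UNIV f" "E_norm \<phi> s p q r f \<le> ennreal A" for f n x y
    proof -
      define h where "h = ?D n f"
      have hm[measurable]: "h \<in> borel_measurable borel" unfolding h_def
        by (rule dyadic_block_bounded_measurable(1)[OF dp borel_measurable_continuous_onI[OF f(1)] fA[OF f]])
      define m where "m = real (Suc n)"
      define b where "b = 2 * 2 powr m"
      have nint: "(\<integral>\<^sup>+ z. ennreal (\<bar>h z\<bar> powr P) \<partial>lborel) \<le> ennreal ((A * 2 powr (- 2 * m)) powr P)"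
        unfolding h_def P_def m_def using A
        by (intro L_norm_finite_exponent[OF besov_block_bound[OF E_norm_components(2)[OF f(2)] s r1 A] p1 pfin]) auto
      \<comment> \<open>The height of a bump of width 2^(-m) whose L^P norm is 2^(-2m). It balances
        the two terms: both become multiples of 2^(m/P - m) = \<rho>^m.\<close>
      define T where "T = 2 powr (- 2 * m + m / P)"
      have T: "0 < T" by (simp add: T_def)
      define N where "N = T powr (1 - P) * (A * 2 powr (- 2 * m)) powr P"
      have "\<bar>?D n f x - ?D n f y\<bar> \<le> (T * b * I + b\<^sup>2 * M * N) * \<bar>x - y\<bar>"
        unfolding b_def m_def
      proof (rule block[OF f, where g="\<lambda>z. T powr (1 - P) * \<bar>h z\<bar> powr P"])
        have "(\<integral>\<^sup>+ z. ennreal (T powr (1 - P) * \<bar>h z\<bar> powr P) \<partial>lborel)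
            = ennreal (T powr (1 - P)) * (\<integral>\<^sup>+ z. ennreal (\<bar>h z\<bar> powr P) \<partial>lborel)"
          by (subst nn_integral_cmult[symmetric]) (auto simp: ennreal_mult)
        also have "\<dots> \<le> ennreal (T powr (1 - P)) * ennreal ((A * 2 powr (- 2 * m)) powr P)"
          by (intro mult_left_mono nint) auto
        finally show "(\<integral>\<^sup>+ z. ennreal (T powr (1 - P) * \<bar>h z\<bar> powr P) \<partial>lborel) \<le> ennreal N"
          by (simp add: N_def ennreal_mult)
        show "AE z in lborel. \<bar>?D n f z\<bar> \<le> T + T powr (1 - P) * \<bar>h z\<bar> powr P"
          unfolding h_def[symmetric] by (intro AE_I2 powr_tail_split P T)
      qed (use T in \<open>auto simp: N_def\<close>)
      also have "T * b * I + b\<^sup>2 * M * N = D * \<rho> powr m"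
      proof -
        have \<rho>m: "\<rho> powr m = 2 powr (m / P - m)" by (simp add: \<rho>_def powr_powr left_diff_distrib)
        have "T * b = 2 * (2 powr (- 2 * m + m / P) * 2 powr m)" by (simp add: T_def b_def)
        also have "\<dots> = 2 * 2 powr (- 2 * m + m / P + m)" by (simp only: powr_add)
        also have "- 2 * m + m / P + m = m / P - m" by simp
        finally have 1: "T * b = 2 * \<rho> powr m" by (simp only: \<rho>m)
        have "b\<^sup>2 = 4 * (2 powr m * 2 powr m)" by (simp add: b_def power2_eq_square)
        also have "2 powr m * 2 powr m = 2 powr (2 * m)" by (simp only: powr_add[symmetric] mult_2)
        finally have "b\<^sup>2 = 4 * 2 powr (2 * m)" .
        then have "b\<^sup>2 * N = 4 * A powr P * (2 powr (2 * m) * (2 powr ((- 2 * m + m / P) * (1 - P)) * 2 powr (- 2 * m * P)))"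
          using A by (simp add: N_def T_def powr_powr powr_mult)
        also have "2 powr (2 * m) * (2 powr ((- 2 * m + m / P) * (1 - P)) * 2 powr (- 2 * m * P))
            = 2 powr (2 * m + ((- 2 * m + m / P) * (1 - P) + (- 2 * m * P)))"
          by (simp only: powr_add)
        also have "2 * m + ((- 2 * m + m / P) * (1 - P) + (- 2 * m * P)) = m / P - m"
          using P by (simp add: field_simps)
        finally have 2: "b\<^sup>2 * N = 4 * A powr P * \<rho> powr m" by (simp only: \<rho>m)
        have "T * b * I + b\<^sup>2 * M * N = (T * b) * I + (b\<^sup>2 * N) * M" by simp
        then show ?thesis unfolding 1 2 D_def by (simp add: algebra_simps)
      qed
      also have "D * \<rho> powr m * \<bar>x - y\<bar> \<le> D * \<rho> ^ n * \<bar>x - y\<bar>"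
      proof (intro mult_right_mono mult_left_mono D)
        have "\<rho> \<noteq> 0" by (simp add: \<rho>_def)
        then have "\<rho> powr m = \<rho> ^ Suc n" unfolding m_def using \<rho> by (intro powr_realpow) auto
        also have "\<dots> \<le> \<rho> ^ n" using \<rho> by (simp add: mult_left_le_one_le)
        finally show "\<rho> powr m \<le> \<rho> ^ n" .
      qed auto
      finally show ?thesis .
    qed
    then show ?thesis using \<rho> D by blast
  qed
  then obtain D \<rho> where D: "0 \<le> D" "0 \<le> \<rho>" "\<rho> < 1" and
    blocks: "\<And>f n x y. continuous_on UNIV f \<Longrightarrow> E_norm \<phi> s p q r f \<le> ennreal A \<Longrightarrow>
     \<bar>?D n f x - ?D n f y\<bar> \<le> D * \<rho> ^ n * \<bar>x - y\<bar>"
    by blast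
  have "\<bar>f x - f y\<bar> \<le> (A * I + D / (1 - \<rho>)) * \<bar>x - y\<bar>"
    if f: "continuous_on UNIV f" "E_norm \<phi> s p q r f \<le> ennreal A" for f x y
    using L_norm_infinity_bound[OF f(1) E_norm_components(1)[OF f(2)] A]
    by (rule lipschitz_from_blocks[OF f(1) _ low[OF f] blocks[OF f] D])
  then show ?thesis by blast
qed

end

section \<open>Strong solutions\<close>

lemma eventually_norm_le:
  fixes N :: "real \<Rightarrow> ennreal" and t :: real
  assumes "(N \<longlongrightarrow> 0) (at t within S)" "0 < e"
  obtains d where "0 < d" "\<And>\<tau>. \<tau> \<in> S \<Longrightarrow> \<tau> \<noteq> t \<Longrightarrow> \<bar>\<tau> - t\<bar> < d \<Longrightarrow> N \<tau> \<le> ennreal e"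
proof -
  have "\<forall>\<^sub>F \<tau> in at t within S. N \<tau> < ennreal e"
    using assms by (intro order_tendstoD(2)) (auto simp: ennreal_less_zero_iff)
  then obtain d where "0 < d" "\<forall>\<tau>\<in>S. \<tau> \<noteq> t \<and> dist \<tau> t < d \<longrightarrow> N \<tau> < ennreal e"
    unfolding eventually_at by blast
  then show ?thesis by (intro that[of d]) (auto simp: dist_real_def intro: less_imp_le)
qed

text \<open>\<open>Ebar_norm\<close> dominates the essential supremum, so the difference quotients
  converge uniformly in x up to null sets.\<close>

lemma C1_in_quotient:
  assumes C1: "C1_in (Ebar_norm \<phi> s p r) T u ut" and t: "t \<in> {0..T}" and e: "0 < e"
  obtains d where "0 < d"
    "\<And>\<tau>. \<tau> \<in> {0..T} \<Longrightarrow> \<tau> \<noteq> t \<Longrightarrow> \<bar>\<tau> - t\<bar> < d \<Longrightarrow> AE x in lborel. \<bar>(u \<tau> x - u t x) / (\<tau> - t) - ut t x\<bar> \<le> e"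
proof -
  have "((\<lambda>\<tau>. Ebar_norm \<phi> s p r (\<lambda>x. (u \<tau> x - u t x) / (\<tau> - t) - ut t x)) \<longlongrightarrow> 0) (at t within {0..T})"
    using C1 t by (simp add: C1_in_def)
  then obtain d where d: "0 < d" "\<And>\<tau>. \<tau> \<in> {0..T} \<Longrightarrow> \<tau> \<noteq> t \<Longrightarrow> \<bar>\<tau> - t\<bar> < d \<Longrightarrow>
      Ebar_norm \<phi> s p r (\<lambda>x. (u \<tau> x - u t x) / (\<tau> - t) - ut t x) \<le> ennreal e"
    by (rule eventually_norm_le[OF _ e]) (rule that)
  have "AE x in lborel. \<bar>(u \<tau> x - u t x) / (\<tau> - t) - ut t x\<bar> \<le> e"
    if "\<tau> \<in> {0..T}" "\<tau> \<noteq> t" "\<bar>\<tau> - t\<bar> < d" for \<tau>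
  proof (rule L_norm_infinity_AE)
    have "L_norm \<infinity> f \<le> Ebar_norm \<phi> s p r f" for f by (simp add: Ebar_norm_def)
    then show "L_norm \<infinity> (\<lambda>x. (u \<tau> x - u t x) / (\<tau> - t) - ut t x) \<le> ennreal e"
      using d(2)[OF that] by (rule order_trans)
  qed (use e in simp)
  with d(1) show ?thesis by (rule that)
qed

section \<open>A solution on a compact time interval\<close>

context
  fixes \<phi> :: "real \<Rightarrow> real" and C s :: real and p q r :: ennreal and T :: real
    and u ut ux :: "real \<Rightarrow> real \<Rightarrow> real"
  assumes dp: "dyadic_partition \<phi>" and adm: "admissible s p r" and pq: "1 / p + 1 / q = 1"
    and C0: "C0_in (E_norm \<phi> s p q r) T u" and C1: "C1_in (Ebar_norm \<phi> s p r) T u ut"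
    and cont: "\<And>t. t \<in> {0..T} \<Longrightarrow> continuous_on UNIV (u t)"
    and wd: "\<And>t. t \<in> {0..T} \<Longrightarrow> weak_derivative (u t) (ux t)"
    and sq: "\<And>t. t \<in> {0..T} \<Longrightarrow> integrable lborel (\<lambda>z. (ux t z)\<^sup>2)"
    and eqn: "\<And>t. t \<in> {0..T} \<Longrightarrow> AE x in lborel. ut t x + u t x * ux t x = hs_source C (ux t) x"
begin

lemma solution_E_bound:
  assumes "t \<in> {0..T}"
  obtains A where "0 \<le> A" "E_norm \<phi> s p q r (u t) \<le> ennreal A"
proof -
  have "E_norm \<phi> s p q r (u t) < \<infinity>" using C0 assms by (simp add: C0_in_def)
  then have "E_norm \<phi> s p q r (u t) \<le> ennreal (enn2real (E_norm \<phi> s p q r (u t)))" by simp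
  then show ?thesis by (rule that[OF enn2real_nonneg])
qed

lemma solution_E_continuous:
  assumes "t \<in> {0..T}" "0 < e"
  obtains d where "0 < d"
    "\<And>\<tau>. \<tau> \<in> {0..T} \<Longrightarrow> \<tau> \<noteq> t \<Longrightarrow> \<bar>\<tau> - t\<bar> < d \<Longrightarrow> E_norm \<phi> s p q r (\<lambda>x. u \<tau> x - u t x) \<le> ennreal e"
proof -
  have "((\<lambda>\<tau>. E_norm \<phi> s p q r (\<lambda>x. u \<tau> x - u t x)) \<longlongrightarrow> 0) (at t within {0..T})"
    using C0 assms(1) by (simp add: C0_in_def)
  then show ?thesis by (rule eventually_norm_le[OF _ assms(2)]) (rule that)
qed

lemma solution_bounded:
  assumes "t \<in> {0..T}"
  shows "\<exists>B. \<forall>x. \<bar>u t x\<bar> \<le> B"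
proof -
  obtain A where A: "0 \<le> A" "E_norm \<phi> s p q r (u t) \<le> ennreal A" using solution_E_bound[OF assms] .
  show ?thesis using L_norm_infinity_bound[OF cont[OF assms] E_norm_components(1)[OF dp A(2)] A(1)] by blast
qed

lemma solution_continuous_in_time: "continuous_on {0..T} (\<lambda>t. u t x)"
  unfolding continuous_on_iff
proof (intro ballI allI impI)
  fix t e :: real assume t: "t \<in> {0..T}" and e: "0 < e"
  obtain d where d: "0 < d" "\<And>\<tau>. \<tau> \<in> {0..T} \<Longrightarrow> \<tau> \<noteq> t \<Longrightarrow> \<bar>\<tau> - t\<bar> < d \<Longrightarrow> E_norm \<phi> s p q r (\<lambda>x. u \<tau> x - u t x) \<le> ennreal (e/2)"
    using solution_E_continuous[OF t half_gt_zero[OF e]] by blast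
  have "dist (u \<tau> x) (u t x) < e" if \<tau>: "\<tau> \<in> {0..T}" "dist \<tau> t < d" for \<tau>
  proof (cases "\<tau> = t")
    case False
    have "\<bar>u \<tau> x - u t x\<bar> \<le> e/2"
      using E_norm_components(1)[OF dp d(2)[OF \<tau>(1) False]] \<tau>(2) e
      by (intro L_norm_infinity_bound[where f="\<lambda>x. u \<tau> x - u t x"] continuous_intros cont \<tau> t) (auto simp: dist_real_def)
    then show ?thesis using e by (simp add: dist_real_def)
  qed (use e in simp)
  with d(1) show "\<exists>d>0. \<forall>\<tau>\<in>{0..T}. dist \<tau> t < d \<longrightarrow> dist (u \<tau> x) (u t x) < e" by blast
qed

text \<open>\<open>E_norm_imp_lipschitz\<close> gives one constant per norm bound. Near a time t, u
  is the sum of u(t) and a difference of norm at most 1, and the Lipschitz constants of the two add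
  up; this avoids a triangle inequality for \<open>E_norm\<close>. Bisection turns local uniformity
  in time into uniformity on [0, T].\<close>

lemma solution_lipschitz:
  assumes "0 \<le> T"
  obtains L where "0 < L" "\<And>t x y. t \<in> {0..T} \<Longrightarrow> \<bar>u t x - u t y\<bar> \<le> L * \<bar>x - y\<bar>"
proof -
  define P where "P a b \<longleftrightarrow> (\<exists>L. \<forall>t\<in>{a..b} \<inter> {0..T}. \<forall>x y. \<bar>u t x - u t y\<bar> \<le> L * \<bar>x - y\<bar>)" for a b
  have "P 0 T"
  proof (rule Bolzano[OF assms])
    fix a b c assume ab: "P a b" and bc: "P b c" and "a \<le> b" "b \<le> c"
    obtain L1 where L1: "\<And>t x y. t \<in> {a..b} \<inter> {0..T} \<Longrightarrow> \<bar>u t x - u t y\<bar> \<le> L1 * \<bar>x - y\<bar>"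
      using ab unfolding P_def by blast
    obtain L2 where L2: "\<And>t x y. t \<in> {b..c} \<inter> {0..T} \<Longrightarrow> \<bar>u t x - u t y\<bar> \<le> L2 * \<bar>x - y\<bar>"
      using bc unfolding P_def by blast
    have "\<bar>u t x - u t y\<bar> \<le> max L1 L2 * \<bar>x - y\<bar>" if t: "t \<in> {a..c} \<inter> {0..T}" for t x y
    proof (cases "t \<le> b")
      case True
      then have "\<bar>u t x - u t y\<bar> \<le> L1 * \<bar>x - y\<bar>" using t by (intro L1) auto
      also have "\<dots> \<le> max L1 L2 * \<bar>x - y\<bar>" by (intro mult_right_mono) auto
      finally show ?thesis .
    next
      case False
      then have "\<bar>u t x - u t y\<bar> \<le> L2 * \<bar>x - y\<bar>" using t by (intro L2) auto
      also have "\<dots> \<le> max L1 L2 * \<bar>x - y\<bar>" by (intro mult_right_mono) auto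
      finally show ?thesis .
    qed
    then show "P a c" unfolding P_def by blast
  next
    fix t assume "0 \<le> t" "t \<le> T"
    then have t: "t \<in> {0..T}" by simp
    obtain A where A: "0 \<le> A" "E_norm \<phi> s p q r (u t) \<le> ennreal A" using solution_E_bound[OF t] .
    obtain K where K: "\<And>x y. \<bar>u t x - u t y\<bar> \<le> K * \<bar>x - y\<bar>"
      using E_norm_imp_lipschitz[OF dp adm pq A(1)] cont[OF t] A(2) by blast
    obtain K1 where K1: "\<And>f x y. continuous_on UNIV f \<Longrightarrow> E_norm \<phi> s p q r f \<le> ennreal 1 \<Longrightarrow> \<bar>f x - f y\<bar> \<le> K1 * \<bar>x - y\<bar>"
      using E_norm_imp_lipschitz[OF dp adm pq zero_le_one] by blast
    obtain d where d: "0 < d" "\<And>\<tau>. \<tau> \<in> {0..T} \<Longrightarrow> \<tau> \<noteq> t \<Longrightarrow> \<bar>\<tau> - t\<bar> < d \<Longrightarrow> E_norm \<phi> s p q r (\<lambda>x. u \<tau> x - u t x) \<le> ennreal 1"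
      using solution_E_continuous[OF t zero_less_one] by blast
    have loc: "\<bar>u \<tau> x - u \<tau> y\<bar> \<le> (\<bar>K\<bar> + \<bar>K1\<bar>) * \<bar>x - y\<bar>" if \<tau>: "\<tau> \<in> {0..T}" "\<bar>\<tau> - t\<bar> < d" for \<tau> x y
    proof -
      have k: "K * \<bar>x - y\<bar> \<le> \<bar>K\<bar> * \<bar>x - y\<bar>" "K1 * \<bar>x - y\<bar> \<le> \<bar>K1\<bar> * \<bar>x - y\<bar>"
        by (intro mult_right_mono; simp)+
      have nn: "0 \<le> \<bar>K1\<bar> * \<bar>x - y\<bar>" by simp
      show ?thesis
      proof (cases "\<tau> = t")
        case True
        show ?thesis using K[of x y] k nn unfolding distrib_right True by linarith
      next
        case False
        have "\<bar>(u \<tau> x - u t x) - (u \<tau> y - u t y)\<bar> \<le> K1 * \<bar>x - y\<bar>"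
          by (rule K1[where f="\<lambda>x. u \<tau> x - u t x"])
             (intro continuous_intros cont \<tau> t d(2)[OF \<tau>(1) False \<tau>(2)])+
        then show ?thesis using K[of x y] k unfolding distrib_right by linarith
      qed
    qed
    show "\<exists>d>0. \<forall>a b. a \<le> t \<and> t \<le> b \<and> b - a < d \<longrightarrow> P a b"
    proof (intro exI[of _ d] conjI allI impI d(1))
      fix a b assume ab: "a \<le> t \<and> t \<le> b \<and> b - a < d"
      have "\<forall>\<tau>\<in>{a..b} \<inter> {0..T}. \<forall>x y. \<bar>u \<tau> x - u \<tau> y\<bar> \<le> (\<bar>K\<bar> + \<bar>K1\<bar>) * \<bar>x - y\<bar>"
        using ab by (intro ballI allI loc) auto
      then show "P a b" unfolding P_def by blast
    qed
  qed
  then obtain L where L: "\<And>t x y. t \<in> {0..T} \<Longrightarrow> \<bar>u t x - u t y\<bar> \<le> L * \<bar>x - y\<bar>"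
    unfolding P_def Int_absorb by blast
  have "\<bar>u t x - u t y\<bar> \<le> (\<bar>L\<bar> + 1) * \<bar>x - y\<bar>" if "t \<in> {0..T}" for t x y
    using L[OF that, of x y] by (rule order_trans) (intro mult_right_mono, auto)
  then show ?thesis by (intro that[of "\<bar>L\<bar> + 1"]) auto
qed

lemma solution_FTC:
  assumes "t \<in> {0..T}" "x \<le> y"
  shows "u t y - u t x = (LINT z:{x..y}|lborel. ux t z)"
  by (rule weak_derivative_FTC[OF dp wd[OF assms(1)] cont[OF assms(1)] assms(2)])

lemma solution_ux_locally_integrable: "t \<in> {0..T} \<Longrightarrow> locally_integrable (ux t)"
  using wd by (simp add: weak_derivative_def)

text \<open>Backward in time the equation is solved by \<open>-u(t\<^sub>1 - t, x)\<close>; the sign \<open>\<sigma>\<close> is the direction of time.\<close>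

lemma solution_zero_propagates:
  assumes t1: "t1 \<in> {0..T}" and z: "\<And>x. u t1 x = 0" and t: "t \<in> {0..T}"
  shows "u t x = 0"
proof -
  obtain L where L: "0 < L" and lip: "\<And>t x y. t \<in> {0..T} \<Longrightarrow> \<bar>u t x - u t y\<bar> \<le> L * \<bar>x - y\<bar>"
    using solution_lipschitz t1 by (metis atLeastAtMost_iff order_trans)
  define \<sigma> :: real where "\<sigma> = (if t1 \<le> t then 1 else -1)"
  define S where "S t' = t1 + \<sigma> * t'" for t'
  have \<sigma>: "\<bar>\<sigma>\<bar> = 1" "\<sigma> * \<sigma> = 1" by (simp_all add: \<sigma>_def)
  have cancel: "\<sigma> * v * (\<sigma> * w) = v * w" for v w
  proof -
    have "\<sigma> * v * (\<sigma> * w) = (\<sigma> * \<sigma>) * (v * w)" by (simp only: mult_ac)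
    then show ?thesis by (simp add: \<sigma>)
  qed
  \<comment> \<open>The source is quadratic and does not see the sign.\<close>
  have src: "hs_source C (\<lambda>z. \<sigma> * v z) x = hs_source C v x" for v x
    by (simp add: hs_source_def power2_eq_square cancel)
  have in_T: "S t' \<in> {0..T}" if "t' \<in> {0..\<bar>t - t1\<bar>}" for t'
    using that t t1 by (auto simp: S_def \<sigma>_def)
  \<comment> \<open>For w(t') = \<sigma> u(t1 + \<sigma> t') the time derivative and the product of
    w with its spatial derivative both acquire \<sigma>^2 = 1, so the same equation holds and
    \<open>wt\<close> carries no sign.\<close>
  have "\<sigma> * u (S \<bar>t - t1\<bar>) x = 0"
  proof (rule zero_data_imp_zero[OF L, where \<tau>="\<bar>t - t1\<bar>" and w="\<lambda>t x. \<sigma> * u (S t) x" and wt="\<lambda>t. ut (S t)"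
        and wx="\<lambda>t z. \<sigma> * ux (S t) z" and C=C])
    show "continuous_on {0..\<bar>t - t1\<bar>} (\<lambda>t. \<sigma> * u (S t) x)" for x
      using in_T by (intro continuous_on_mult_left continuous_on_compose2[OF solution_continuous_in_time[of x]])
        (auto simp: S_def intro!: continuous_intros)
    show "\<sigma> * u (S 0) x = 0" for x using z by (simp add: S_def)
    fix t' assume t': "t' \<in> {0..\<bar>t - t1\<bar>}"
    show "\<bar>\<sigma> * u (S t') x - \<sigma> * u (S t') y\<bar> \<le> L * \<bar>x - y\<bar>" for x y
      using lip[OF in_T[OF t'], of x y] \<sigma> by (simp add: right_diff_distrib[symmetric] abs_mult)
    show "\<exists>B. \<forall>x. \<bar>\<sigma> * u (S t') x\<bar> \<le> B"
      using solution_bounded[OF in_T[OF t']] \<sigma> by (simp add: abs_mult)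
    show "\<sigma> * u (S t') y - \<sigma> * u (S t') x = (LINT z:{x..y}|lborel. \<sigma> * ux (S t') z)" if "x \<le> y" for x y
      using solution_FTC[OF in_T[OF t'] that] by (simp add: right_diff_distrib[symmetric])
    show "locally_integrable (\<lambda>z. \<sigma> * ux (S t') z)"
      using solution_ux_locally_integrable[OF in_T[OF t']] by (auto simp: locally_integrable_def)
    show "integrable lborel (\<lambda>z. (\<sigma> * ux (S t') z)\<^sup>2)"
      using sq[OF in_T[OF t']] by (simp add: power_mult_distrib)
    show "AE x in lborel. ut (S t') x + \<sigma> * u (S t') x * (\<sigma> * ux (S t') x) = hs_source C (\<lambda>z. \<sigma> * ux (S t') z) x"
      using eqn[OF in_T[OF t']] by (simp add: src cancel)
  next
    fix t' e :: real assume t': "0 \<le> t'" "t' < \<bar>t - t1\<bar>" and e: "0 < e"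
    have "t' \<in> {0..\<bar>t - t1\<bar>}" using t' by simp
    then obtain d where d: "0 < d" "\<And>\<tau>. \<tau> \<in> {0..T} \<Longrightarrow> \<tau> \<noteq> S t' \<Longrightarrow> \<bar>\<tau> - S t'\<bar> < d \<Longrightarrow>
        AE x in lborel. \<bar>(u \<tau> x - u (S t') x) / (\<tau> - S t') - ut (S t') x\<bar> \<le> e"
      using C1_in_quotient[OF C1 in_T e, of t'] by auto
    show "\<exists>d>0. \<forall>h. 0 < h \<and> h < d \<longrightarrow> (AE x in lborel. \<bar>(\<sigma> * u (S (t' + h)) x - \<sigma> * u (S t') x) / h - ut (S t') x\<bar> \<le> e)"
    proof (rule exI[of _ "min d (\<bar>t - t1\<bar> - t')"], intro conjI allI impI)
      fix h assume h: "0 < h \<and> h < min d (\<bar>t - t1\<bar> - t')"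
      have diff: "S (t' + h) - S t' = \<sigma> * h" by (simp add: S_def algebra_simps)
      then have "\<bar>S (t' + h) - S t'\<bar> = h" using \<sigma> h by (simp add: abs_mult)
      then have "AE x in lborel. \<bar>(u (S (t' + h)) x - u (S t') x) / (S (t' + h) - S t') - ut (S t') x\<bar> \<le> e"
        using h t' by (intro d(2) in_T) auto
      then show "AE x in lborel. \<bar>(\<sigma> * u (S (t' + h)) x - \<sigma> * u (S t') x) / h - ut (S t') x\<bar> \<le> e"
        unfolding diff by (auto simp: \<sigma>_def diff_divide_distrib)
    qed (use d t' in auto)
  qed simp
  moreover have "S \<bar>t - t1\<bar> = t" by (simp add: S_def \<sigma>_def)
  ultimately show ?thesis using \<sigma> by auto
qed

end

section \<open>Vanishing of the source forces vanishing energy\<close>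

lemma AE_interval_witness:
  fixes c d :: real
  assumes "AE x in lborel. P x" "c < d"
  obtains x where "c < x" "x < d" "P x"
proof -
  have "\<exists>x\<in>{c<..<d}. P x"
  proof (rule ccontr)
    assume "\<not> (\<exists>x\<in>{c<..<d}. P x)"
    with assms(1) have "AE x in lborel. x \<notin> {c<..<d}" by (auto elim: eventually_mono)
    then have "{c<..<d} \<in> null_sets lborel" by (subst AE_iff_null_sets) auto
    then have "emeasure lborel {c<..<d} = 0" by (rule null_setsD1)
    with assms(2) show False by simp
  qed
  then show ?thesis using that by auto
qed

definition hs_energy :: "(real \<Rightarrow> real) \<Rightarrow> real" where
  "hs_energy v = (LINT z|lborel. (v z)\<^sup>2)"

lemma hs_energy_nonneg: "0 \<le> hs_energy v"
  unfolding hs_energy_def by (intro integral_nonneg_AE) auto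

lemma hs_source_bounds:
  assumes sq: "integrable lborel (\<lambda>z. (v z)\<^sup>2)"
  shows "C * hs_energy v \<le> hs_source C v x" "hs_source C v x \<le> (C + 1/2) * hs_energy v"
proof -
  have "(LINT z:{..x}|lborel. 1/2 * (v z)\<^sup>2) \<le> (LINT z|lborel. 1/2 * (v z)\<^sup>2)"
    unfolding set_lebesgue_integral_def
    by (intro integral_mono integrable_mult_indicator integrable_mult_right sq) (auto simp: indicator_def)
  moreover have "0 \<le> (LINT z:{..x}|lborel. 1/2 * (v z)\<^sup>2)"
    unfolding set_lebesgue_integral_def by (intro integral_nonneg_AE) (auto simp: indicator_def)
  ultimately show "C * hs_energy v \<le> hs_source C v x" "hs_source C v x \<le> (C + 1/2) * hs_energy v"
    by (simp_all add: hs_source_def hs_energy_def distrib_right)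
qed

lemma hs_source_tendsto:
  fixes X :: "nat \<Rightarrow> real"
  assumes sq: "integrable lborel (\<lambda>z. (v z)\<^sup>2)"
  shows "filterlim X at_top sequentially \<Longrightarrow> (\<lambda>n. hs_source C v (X n)) \<longlonglongrightarrow> (C + 1/2) * hs_energy v"
    and "filterlim X at_bot sequentially \<Longrightarrow> (\<lambda>n. hs_source C v (X n)) \<longlonglongrightarrow> C * hs_energy v"
proof -
  \<comment> \<open>One dominated convergence for both limits: S will be the whole line or
    empty.\<close>
  have lim: "(\<lambda>n. LINT z:{..X n}|lborel. 1/2 * (v z)\<^sup>2) \<longlonglongrightarrow> (LINT z:S|lborel. 1/2 * (v z)\<^sup>2)"
    if S: "S \<in> sets borel" "\<And>z. \<forall>\<^sub>F n in sequentially. z \<in> {..X n} \<longleftrightarrow> z \<in> S" for S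
    unfolding set_lebesgue_integral_def
  proof (rule integral_dominated_convergence[where w="\<lambda>z. 1/2 * (v z)\<^sup>2"])
    have vm[measurable]: "(\<lambda>z. (v z)\<^sup>2) \<in> borel_measurable borel" using borel_measurable_integrable[OF sq] by simp
    have gm: "(\<lambda>z. 1/2 * (v z)\<^sup>2) \<in> borel_measurable borel" by measurable
    show "(\<lambda>z. indicator S z *\<^sub>R (1/2 * (v z)\<^sup>2)) \<in> borel_measurable lborel"
      using gm S(1) by (intro borel_measurable_scaleR borel_measurable_indicator) auto
    show "(\<lambda>z. indicator {..X n} z *\<^sub>R (1/2 * (v z)\<^sup>2)) \<in> borel_measurable lborel" for n
      using gm by (intro borel_measurable_scaleR borel_measurable_indicator) auto
    show "AE z in lborel. (\<lambda>n. indicator {..X n} z *\<^sub>R (1/2 * (v z)\<^sup>2)) \<longlonglongrightarrow> indicator S z *\<^sub>R (1/2 * (v z)\<^sup>2)"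
    proof (rule AE_I2, rule tendsto_eventually)
      fix z
      show "\<forall>\<^sub>F n in sequentially. indicator {..X n} z *\<^sub>R (1/2 * (v z)\<^sup>2) = indicator S z *\<^sub>R (1/2 * (v z)\<^sup>2)"
        using S(2)[of z] by eventually_elim (simp add: indicator_def)
    qed
    show "AE z in lborel. norm (indicator {..X n} z *\<^sub>R (1/2 * (v z)\<^sup>2)) \<le> 1/2 * (v z)\<^sup>2" for n
      by (intro AE_I2) (auto simp: indicator_def)
  qed (intro integrable_mult_right sq)
  {
    assume "filterlim X at_top sequentially"
    then have "\<forall>\<^sub>F n in sequentially. z \<in> {..X n} \<longleftrightarrow> z \<in> UNIV" for z by (auto simp: filterlim_at_top)
    from lim[OF _ this]
    have "(\<lambda>n. LINT z:{..X n}|lborel. 1/2 * (v z)\<^sup>2) \<longlonglongrightarrow> 1/2 * hs_energy v"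
      by (simp add: set_lebesgue_integral_def hs_energy_def)
    then have "(\<lambda>n. (LINT z:{..X n}|lborel. 1/2 * (v z)\<^sup>2) + C * hs_energy v) \<longlonglongrightarrow> 1/2 * hs_energy v + C * hs_energy v"
      by (intro tendsto_intros)
    then show "(\<lambda>n. hs_source C v (X n)) \<longlonglongrightarrow> (C + 1/2) * hs_energy v"
      by (simp add: hs_source_def hs_energy_def distrib_right add.commute)
  next
    assume X: "filterlim X at_bot sequentially"
    have "\<forall>\<^sub>F n in sequentially. z \<in> {..X n} \<longleftrightarrow> z \<in> {}" for z
    proof -
      have "\<forall>\<^sub>F n in sequentially. X n \<le> z - 1" using X by (auto simp: filterlim_at_bot)
      then show ?thesis by eventually_elim auto
    qed
    from lim[OF _ this]
    have "(\<lambda>n. LINT z:{..X n}|lborel. 1/2 * (v z)\<^sup>2) \<longlonglongrightarrow> 0"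
      by (simp add: set_lebesgue_integral_def)
    then have "(\<lambda>n. (LINT z:{..X n}|lborel. 1/2 * (v z)\<^sup>2) + C * hs_energy v) \<longlonglongrightarrow> 0 + C * hs_energy v"
      by (intro tendsto_intros)
    then show "(\<lambda>n. hs_source C v (X n)) \<longlonglongrightarrow> C * hs_energy v"
      by (simp add: hs_source_def hs_energy_def)
  }
qed

lemma hs_energy_zero_if_source_vanishes:
  fixes a b :: ereal
  assumes sq: "integrable lborel (\<lambda>z. (v z)\<^sup>2)" and ab: "a < b"
    and ae: "AE x in lborel. a < ereal x \<longrightarrow> ereal x < b \<longrightarrow> hs_source C v x = 0"
    and cases: "C > 0 \<or> (C = 0 \<and> b = \<infinity>) \<or> (- 1/2 < C \<and> C < 0 \<and> (b = \<infinity> \<or> a = - \<infinity>)) \<or>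
         (C = - 1/2 \<and> a = - \<infinity>) \<or> C < - 1/2"
  shows "hs_energy v = 0"
proof -
  have m: "0 \<le> hs_energy v" by (rule hs_energy_nonneg)
  obtain c where c: "a < ereal c" "ereal c < b" using ereal_dense2[OF ab] by blast
  obtain d where d: "ereal c < ereal d" "ereal d < b" using ereal_dense2[OF c(2)] by blast
  obtain x where x: "c < x" "x < d" "a < ereal x \<longrightarrow> ereal x < b \<longrightarrow> hs_source C v x = 0"
    using AE_interval_witness[OF ae, of c d] d(1) by auto
  have "a < ereal x" "ereal x < b"
    using c(1) d(2) x(1,2) by (auto intro: less_trans[of a "ereal c" "ereal x"] less_trans[of "ereal x" "ereal d" b])
  then have between: "C * hs_energy v \<le> 0" "0 \<le> (C + 1/2) * hs_energy v"
    using x(3) hs_source_bounds[OF sq, of C x] by simp_all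
  \<comment> \<open>The five cases regroup by what decides them: for C > 0 and C < -1/2 signs on any
    interval, for C > -1/2 the limit of the source at \<infinity>, for C < 0 its limit at
    -\<infinity>.\<close>
  consider "0 < C" | "C < - 1/2" | "- 1/2 < C" "b = \<infinity>" | "C < 0" "a = - \<infinity>"
    using cases by force
  then show ?thesis
  proof cases
    case 3
    \<comment> \<open>The source is known to vanish only almost everywhere, so sample points tending
      to \<infinity> are picked one by one from intervals of length 1.\<close>
    have "\<exists>x. c + real n < x \<and> hs_source C v x = 0" for n :: nat
    proof -
      obtain x where x: "c + real n < x" "a < ereal x \<longrightarrow> ereal x < b \<longrightarrow> hs_source C v x = 0"
        using AE_interval_witness[OF ae, of "c + real n" "c + real n + 1"] by auto
      moreover have "a < ereal x" using c(1) x(1) by (intro less_trans[of a "ereal c" "ereal x"]) auto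
      ultimately show ?thesis using 3(2) by auto
    qed
    then obtain X where X: "\<And>n. c + real n < X n" "\<And>n. hs_source C v (X n) = 0" by metis
    have "filterlim X at_top sequentially"
    proof (rule filterlim_at_top_mono)
      show "filterlim (\<lambda>n. c + real n) at_top sequentially"
        by (intro filterlim_tendsto_add_at_top[OF tendsto_const] filterlim_real_sequentially)
      show "\<forall>\<^sub>F n in sequentially. c + real n \<le> X n" using X(1) by (auto intro: always_eventually less_imp_le)
    qed
    from hs_source_tendsto(1)[OF sq this, of C] have "(C + 1/2) * hs_energy v = 0"
      by (simp add: X(2) LIMSEQ_const_iff)
    with 3(1) show ?thesis by simp
  next
    case 4
    have "\<exists>x. x < c - real n \<and> hs_source C v x = 0" for n :: nat
    proof -
      obtain x where x: "x < c - real n" "a < ereal x \<longrightarrow> ereal x < b \<longrightarrow> hs_source C v x = 0"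
        using AE_interval_witness[OF ae, of "c - real n - 1" "c - real n"] by auto
      moreover have "ereal x < b" using c(2) x(1) by (intro less_trans[of "ereal x" "ereal c" b]) auto
      ultimately show ?thesis using 4(2) by auto
    qed
    then obtain X where X: "\<And>n. X n < c - real n" "\<And>n. hs_source C v (X n) = 0" by metis
    have "filterlim (\<lambda>n. - X n) at_top sequentially"
    proof (rule filterlim_at_top_mono)
      show "filterlim (\<lambda>n. - c + real n) at_top sequentially"
        by (intro filterlim_tendsto_add_at_top[OF tendsto_const] filterlim_real_sequentially)
      show "\<forall>\<^sub>F n in sequentially. - c + real n \<le> - X n"
        using X(1) by (intro always_eventually allI) (smt (verit))
    qed
    then have "filterlim X at_bot sequentially" by (simp add: filterlim_uminus_at_top)
    from hs_source_tendsto(2)[OF sq this, of C] have "C * hs_energy v = 0"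
      by (simp add: X(2) LIMSEQ_const_iff)
    with 4(1) show ?thesis by simp
  qed (use m between in \<open>auto simp: mult_le_0_iff zero_le_mult_iff\<close>)
qed

section \<open>The zero solution\<close>

lemma Lp_norm_zero: "Lp_norm M p (\<lambda>x. 0) = 0"
proof (cases "p = \<infinity>")
  case True
  have "esssup M (\<lambda>x. 0::ennreal) \<le> 0" by (rule esssup_I) auto
  then show ?thesis using True by (simp add: Lp_norm_def)
qed (simp add: Lp_norm_def epowr_def)

lemma weak_derivative_zero: "weak_derivative (\<lambda>x. 0) (\<lambda>x. 0)"
  by (simp add: weak_derivative_def locally_integrable_def set_integrable_def)

lemma E_norm_zero: "E_norm \<phi> s p q r (\<lambda>x. 0) = 0" and Ebar_norm_zero: "Ebar_norm \<phi> s p r (\<lambda>x. 0) = 0"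
proof -
  have L: "L_norm p (\<lambda>x. 0) = 0" for p by (simp add: L_norm_def Lp_norm_zero)
  have "dyadic_block \<phi> j (\<lambda>x. 0) = (\<lambda>x. 0)" for j by (simp add: dyadic_block_def fun_eq_iff)
  then have B: "besov_norm \<phi> s p r (\<lambda>x. 0) = 0" for s by (simp add: besov_norm_def L Lp_norm_zero)
  have "W1_norm q (\<lambda>x. 0) \<le> L_norm q (\<lambda>x. 0)"
    unfolding W1_norm_def by (rule INF_lower) (simp add: weak_derivative_zero)
  then have W: "W1_norm q (\<lambda>x. 0) = 0" by (simp add: L)
  show "E_norm \<phi> s p q r (\<lambda>x. 0) = 0" "Ebar_norm \<phi> s p r (\<lambda>x. 0) = 0"
    by (simp_all add: E_norm_def Ebar_norm_def L B W)
qed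

lemma strong_solution_zero: "0 < Tm \<Longrightarrow> strong_solution \<phi> C s p q r Tm (\<lambda>x. 0) (\<lambda>t x. 0)"
  unfolding strong_solution_def
  by (auto simp: C0_in_def C1_in_def E_norm_zero Ebar_norm_zero weak_derivative_zero set_lebesgue_integral_def
      intro!: exI[of _ "\<lambda>t x. 0"])

theorem theorem6p1:
  fixes \<phi> :: "real \<Rightarrow> real" and C s :: real and p q r :: ennreal
    and Tm a b :: ereal and t1 t2 :: real
    and u0 :: "real \<Rightarrow> real" and u :: "real \<Rightarrow> real \<Rightarrow> real"
  assumes "dyadic_partition \<phi>"
    and "admissible s p r" and "1 / p + 1 / q = 1"
    and "maximal_strong_solution \<phi> C s p q r Tm u0 u"
    and "a < b" and "0 \<le> t1" and "t1 < t2" and "ereal t2 < Tm"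
    and "\<And>t x. a < ereal x \<Longrightarrow> ereal x < b \<Longrightarrow> t1 \<le> t \<Longrightarrow> t \<le> t2 \<Longrightarrow> u t x = 0"
    and "C > 0 \<or>
         (C = 0 \<and> b = \<infinity>) \<or>
         (- 1/2 < C \<and> C < 0 \<and> (b = \<infinity> \<or> a = - \<infinity>)) \<or>
         (C = - 1/2 \<and> a = - \<infinity>) \<or>
         C < - 1/2"
  shows "Tm = \<infinity> \<and> (\<forall>t\<ge>0. \<forall>x. u t x = 0)"
proof -
  note dp = assms(1) and adm = assms(2) and pq = assms(3)
  have ss: "strong_solution \<phi> C s p q r Tm u0 u"
    and max: "\<not> (\<exists>T' v. Tm < T' \<and> strong_solution \<phi> C s p q r T' u0 v \<and> (\<forall>t x. 0 \<le> t \<and> ereal t < Tm \<longrightarrow> v t x = u t x))"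
    using assms(4) by (auto simp: maximal_strong_solution_def)
  obtain ut ux where sol: "\<And>T. 0 < T \<Longrightarrow> ereal T < Tm \<Longrightarrow>
        C0_in (E_norm \<phi> s p q r) T u \<and> C1_in (Ebar_norm \<phi> s p r) T u ut \<and>
        (\<forall>t\<in>{0..T}. continuous_on UNIV (u t) \<and> weak_derivative (u t) (ux t) \<and>
           integrable lborel (\<lambda>z. (ux t z)\<^sup>2) \<and>
           (AE x in lborel. ut t x + u t x * ux t x = hs_source C (ux t) x))"
    using ss unfolding strong_solution_def hs_source_def by blast
  have t2: "0 < t2" "t1 \<in> {0..t2}" using assms(6,7) by auto
  note sol2 = sol[OF t2(1) assms(8)]
  have C1: "C1_in (Ebar_norm \<phi> s p r) t2 u ut" using sol2 by simp
  have sol_t1: "continuous_on UNIV (u t1)" "weak_derivative (u t1) (ux t1)"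
    "integrable lborel (\<lambda>z. (ux t1 z)\<^sup>2)" "AE x in lborel. ut t1 x + u t1 x * ux t1 x = hs_source C (ux t1) x"
    using sol2 t2(2) by auto
  \<comment> \<open>The quotient between t1 and a later time up to t2 is zero on (a,b), and it lies
    within 1/(n+1) of \<open>ut t1\<close>. Later times are the ones at which u is known to
    vanish.\<close>
  have "AE x in lborel. a < ereal x \<longrightarrow> ereal x < b \<longrightarrow> \<bar>ut t1 x\<bar> \<le> 1 / real (Suc n)" for n
  proof -
    obtain d where d: "0 < d" "\<And>\<tau>. \<tau> \<in> {0..t2} \<Longrightarrow> \<tau> \<noteq> t1 \<Longrightarrow> \<bar>\<tau> - t1\<bar> < d \<Longrightarrow>
        AE x in lborel. \<bar>(u \<tau> x - u t1 x) / (\<tau> - t1) - ut t1 x\<bar> \<le> 1 / real (Suc n)"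
      by (rule C1_in_quotient[OF C1 t2(2), of "1 / real (Suc n)"]) auto
    define \<tau> where "\<tau> = min t2 (t1 + d / 2)"
    have \<tau>: "\<tau> \<in> {0..t2}" "\<tau> \<noteq> t1" "\<bar>\<tau> - t1\<bar> < d" "t1 \<le> \<tau>" "\<tau> \<le> t2"
      using d(1) assms(6,7) by (auto simp: \<tau>_def)
    show ?thesis
      using d(2)[OF \<tau>(1-3)]
    proof eventually_elim
      case (elim x)
      then show ?case using assms(9)[of x \<tau>] assms(9)[of x t1] \<tau>(4,5) assms(7) by auto
    qed
  qed
  \<comment> \<open>The bounds form a countable family, so their exceptional sets can be
    united.\<close>
  then have "AE x in lborel. \<forall>n. a < ereal x \<longrightarrow> ereal x < b \<longrightarrow> \<bar>ut t1 x\<bar> \<le> 1 / real (Suc n)"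
    by (subst AE_all_countable) auto
  with sol_t1(4) have "AE x in lborel. a < ereal x \<longrightarrow> ereal x < b \<longrightarrow> hs_source C (ux t1) x = 0"
  proof eventually_elim
    case (elim x)
    show ?case
    proof (intro impI)
      assume x: "a < ereal x" "ereal x < b"
      have "u t1 x = 0" using assms(7) by (intro assms(9) x) auto
      moreover have "\<bar>ut t1 x\<bar> \<le> 0"
      proof (rule LIMSEQ_le_const)
        show "(\<lambda>n. 1 / real (Suc n)) \<longlonglongrightarrow> 0"
          using LIMSEQ_inverse_real_of_nat by (simp add: inverse_eq_divide)
        show "\<exists>N. \<forall>n\<ge>N. \<bar>ut t1 x\<bar> \<le> 1 / real (Suc n)" using elim(2) x by blast
      qed
      ultimately show "hs_source C (ux t1) x = 0" using elim(1) by simp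
    qed
  qed
  from hs_energy_zero_if_source_vanishes[OF sol_t1(3) assms(5) this assms(10)]
  have "AE z in lborel. (ux t1 z)\<^sup>2 = 0"
    unfolding hs_energy_def by (subst (asm) integral_nonneg_eq_0_iff_AE[OF sol_t1(3)]) auto
  then have ux0: "AE z in lborel. ux t1 z = 0" by eventually_elim simp
  have const: "u t1 y = u t1 x" if "x \<le> y" for x y
  proof -
    have "u t1 y - u t1 x = (LINT z:{x..y}|lborel. ux t1 z)"
      by (rule weak_derivative_FTC[OF dp sol_t1(2,1) that])
    also have "\<dots> = 0"
      unfolding set_lebesgue_integral_def by (rule integral_eq_zero_AE) (use ux0 in eventually_elim, simp)
    finally show ?thesis by simp
  qed
  \<comment> \<open>The constant value of u at time t1 is read off at a point of (a,b).\<close>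
  obtain c where c: "a < ereal c" "ereal c < b" using ereal_dense2[OF assms(5)] by blast
  have "u t1 c = 0" using assms(7) by (intro assms(9) c) auto
  then have z: "u t1 x = 0" for x using const[of x c] const[of c x] by (cases "x \<le> c") auto
  have zero: "u t x = 0" if t: "0 \<le> t" "ereal t < Tm" for t x
  proof -
    \<comment> \<open>A horizon that contains both t and t1 and is still below \<open>Tm\<close>;
      \<open>ut\<close> and \<open>ux\<close> were obtained independently of it.\<close>
    define T where "T = max t t2"
    have T: "0 < T" "ereal T < Tm" "t1 \<in> {0..T}" "t \<in> {0..T}"
      using t t2 assms(8) by (auto simp: T_def max_def)
    show ?thesis
      by (rule solution_zero_propagates[OF dp adm pq, of T u ut ux C t1 t x])
         (use sol[OF T(1,2)] T z in auto)
  qed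
  have Tm: "0 < Tm" and u0: "\<And>x. u 0 x = u0 x" using ss by (auto simp: strong_solution_def)
  have "u0 x = 0" for x using zero[of 0 x] Tm u0[of x] by (simp add: zero_ereal_def)
  then have u0_eq: "u0 = (\<lambda>x. 0)" by auto
  have "Tm = \<infinity>"
  proof (rule ccontr)
    assume "Tm \<noteq> \<infinity>"
    then have "Tm < \<infinity>" by simp
    moreover have "strong_solution \<phi> C s p q r \<infinity> u0 (\<lambda>t x. 0)"
      unfolding u0_eq by (rule strong_solution_zero) simp
    moreover have "\<forall>t x. 0 \<le> t \<and> ereal t < Tm \<longrightarrow> 0 = u t x" using zero by simp
    ultimately show False using max by blast
  qed
  with zero show ?thesis by simp
qed

end
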